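(* Let $G=(X,b,m)$ be a connected, locally finite weighted graph which is model (weakly spherically symmetric). If $m(X)=\infty$, then $G$ is Feller.
   Context: Weighted graph: $G=(X,b,m)$ where $X$ is a countably infinite set (vertices), $b:X\times X\to[0,\infty)$ satisfies $b(x,y)=b(y,x)$, $b(x,x)=0$ and $|\{y : b(x,y)>0\}|<\infty$ for all $x$ (local finiteness), and $m:X\to(0,\infty)$ is a vertex measure, extended to subsets of $X$ by additivity, so $m(X)=\sum_{x\in X}m(x)$. Write $x\sim y$ if $b(x,y)>0$. $G$ is connected if any two vertices are joined by a finite path $x=x_0\sim x_1\sim\dots\sim x_n=y$; $d(x,y)$ is the least number $n$ of edges of such a path (combinatorial graph metric). Laplacian and heat semigroup: the formal Laplacian is $\widetilde\Delta f(x)=\frac1{m(x)}\sum_{y\in X}b(x,y)(f(x)-f(y))$ for $f:X\to\mathbb{R}$. $C_c(X)$ is the space of finitely supported real functions, and $\ell^2(X,m)$ is the Hilbert space of real functions with $\sum_x f(x)^2m(x)<\infty$, with inner product $\langle f,g\rangle=\sum_x f(x)g(x)m(x)$. $\Delta$ is the Friedrichs extension in $\ell^2(X,m)$ of $\widetilde\Delta|_{C_c(X)}$, i.e. the self-adjoint operator of the closure of the form $\frac12\sum_{x,y}b(x,y)(f(x)-f(y))(g(x)-g(y))$ on $C_c(X)$. The semigroup $P_t=e^{-t\Delta}$ has a heat kernel $p_t(x,y)\ge 0$ and acts on bounded functions by $P_tf(x)=\sum_{y\in X}p_t(x,y)f(y)m(y)$. Feller: $C_0(X)$ is the space of functions vanishing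 at infinity, i.e. the closure of $C_c(X)$ in the sup norm. $G$ is Feller if $P_t$ maps $C_0(X)$ into $C_0(X)$ for all $t\ge0$. Curvatures: for $x_0\in X$ and integer $r$ let $S_r(x_0)=\{y : d(y,x_0)=r\}$ (empty if $r<0$). For $x\in S_r(x_0)$, the outer ($+$) and inner ($-$) curvatures with respect to $x_0$ are $\kappa_\pm(x)=\frac1{m(x)}\sum_{y\in S_{r\pm1}(x_0)}b(x,y)$. Model graph: $G$ is model (weakly spherically symmetric) if there is a vertex $o$ (the root) such that the functions $\kappa_\pm$ with respect to $o$ depend only on the distance to $o$. *)

theory Defs
  imports "HOL-Analysis.Analysis"
begin

text \<open>The vertex set is the whole (countably infinite) type; \<open>b\<close> and \<open>m\<close> are the edge weight
  and the vertex measure.\<close>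

locale weighted_graph =
  fixes b :: "'a \<Rightarrow> 'a \<Rightarrow> real" and m :: "'a \<Rightarrow> real"
  assumes countable_vertices: "countable (UNIV :: 'a set)"
    and infinite_vertices: "infinite (UNIV :: 'a set)"
    and weight_nonneg: "b x y \<ge> 0"
    and weight_sym: "b x y = b y x"
    and weight_diag: "b x x = 0"
    and locally_finite: "finite {y. b x y > 0}"
    and measure_pos: "m x > 0"

definition vertex_measure :: "('a \<Rightarrow> real) \<Rightarrow> 'a set \<Rightarrow> ennreal" where
  "vertex_measure m A = (\<Sum>\<^sub>\<infinity>x\<in>A. ennreal (m x))"

definition adj :: "('a \<Rightarrow> 'a \<Rightarrow> real) \<Rightarrow> 'a \<Rightarrow> 'a \<Rightarrow> bool" where
  "adj b x y \<longleftrightarrow> b x y > 0"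

definition connected_graph :: "('a \<Rightarrow> 'a \<Rightarrow> real) \<Rightarrow> bool" where
  "connected_graph b \<longleftrightarrow> (\<forall>x y. (adj b)\<^sup>*\<^sup>* x y)"

text \<open>Meaningful only if \<open>x\<close> and \<open>y\<close> are joined by a path.\<close>

definition graph_dist :: "('a \<Rightarrow> 'a \<Rightarrow> real) \<Rightarrow> 'a \<Rightarrow> 'a \<Rightarrow> nat" where
  "graph_dist b x y = (LEAST n. (adj b ^^ n) x y)"

definition sphere_at :: "('a \<Rightarrow> 'a \<Rightarrow> real) \<Rightarrow> 'a \<Rightarrow> int \<Rightarrow> 'a set" where
  "sphere_at b x0 r = {y. int (graph_dist b y x0) = r}"

definition outer_curvature :: "('a \<Rightarrow> 'a \<Rightarrow> real) \<Rightarrow> ('a \<Rightarrow> real) \<Rightarrow> 'a \<Rightarrow> 'a \<Rightarrow> real" where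
  "outer_curvature b m x0 x =
     1 / m x * (\<Sum>\<^sub>\<infinity>y \<in> sphere_at b x0 (int (graph_dist b x x0) + 1). b x y)"

definition inner_curvature :: "('a \<Rightarrow> 'a \<Rightarrow> real) \<Rightarrow> ('a \<Rightarrow> real) \<Rightarrow> 'a \<Rightarrow> 'a \<Rightarrow> real" where
  "inner_curvature b m x0 x =
     1 / m x * (\<Sum>\<^sub>\<infinity>y \<in> sphere_at b x0 (int (graph_dist b x x0) - 1). b x y)"

definition model_graph :: "('a \<Rightarrow> 'a \<Rightarrow> real) \<Rightarrow> ('a \<Rightarrow> real) \<Rightarrow> bool" where
  "model_graph b m \<longleftrightarrow>
     (\<exists>x0. \<forall>x y. graph_dist b x x0 = graph_dist b y x0 \<longrightarrow>
        outer_curvature b m x0 x = outer_curvature b m x0 y \<and>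
        inner_curvature b m x0 x = inner_curvature b m x0 y)"

definition C_c :: "('a \<Rightarrow> real) set" where
  "C_c = {f. finite {x. f x \<noteq> 0}}"

definition C_0 :: "('a \<Rightarrow> real) set" where
  "C_0 = {f. \<exists>\<phi>. (\<forall>n. \<phi> n \<in> C_c) \<and> uniform_limit UNIV \<phi> f sequentially}"

definition ell2 :: "('a \<Rightarrow> real) \<Rightarrow> ('a \<Rightarrow> real) set" where
  "ell2 m = {f. (\<lambda>x. (f x)\<^sup>2 * m x) summable_on UNIV}"

definition ell2_inner :: "('a \<Rightarrow> real) \<Rightarrow> ('a \<Rightarrow> real) \<Rightarrow> ('a \<Rightarrow> real) \<Rightarrow> real" where
  "ell2_inner m f g = (\<Sum>\<^sub>\<infinity>x. f x * g x * m x)"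

definition ell2_norm :: "('a \<Rightarrow> real) \<Rightarrow> ('a \<Rightarrow> real) \<Rightarrow> real" where
  "ell2_norm m f = sqrt (ell2_inner m f f)"

text \<open>The form is only used on \<open>C_c\<close>, where the sum has finitely many nonzero terms.\<close>

definition energy :: "('a \<Rightarrow> 'a \<Rightarrow> real) \<Rightarrow> ('a \<Rightarrow> real) \<Rightarrow> ('a \<Rightarrow> real) \<Rightarrow> real" where
  "energy b f g = 1 / 2 * (\<Sum>\<^sub>\<infinity>(x, y). b x y * (f x - f y) * (g x - g y))"

text \<open>\<open>\<phi>\<close> is a sequence in \<open>C_c\<close> that converges to \<open>f\<close> in \<open>\<ell>\<^sup>2(X,m)\<close> and is Cauchy for the
  form. The closure of the form has as domain the limits of all such sequences, and its values
  are the limits of the values along them.\<close>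

definition form_approx ::
    "('a \<Rightarrow> 'a \<Rightarrow> real) \<Rightarrow> ('a \<Rightarrow> real) \<Rightarrow> (nat \<Rightarrow> 'a \<Rightarrow> real) \<Rightarrow> ('a \<Rightarrow> real) \<Rightarrow> bool" where
  "form_approx b m \<phi> f \<longleftrightarrow>
     f \<in> ell2 m \<and> (\<forall>n. \<phi> n \<in> C_c) \<and>
     (\<lambda>n. ell2_norm m (\<lambda>x. \<phi> n x - f x)) \<longlonglongrightarrow> 0 \<and>
     (\<forall>\<epsilon>>0. \<exists>N. \<forall>i\<ge>N. \<forall>j\<ge>N. energy b (\<lambda>x. \<phi> i x - \<phi> j x) (\<lambda>x. \<phi> i x - \<phi> j x) < \<epsilon>)"

definition closed_form_dom :: "('a \<Rightarrow> 'a \<Rightarrow> real) \<Rightarrow> ('a \<Rightarrow> real) \<Rightarrow> ('a \<Rightarrow> real) set" where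
  "closed_form_dom b m = {f. \<exists>\<phi>. form_approx b m \<phi> f}"

definition closed_form ::
    "('a \<Rightarrow> 'a \<Rightarrow> real) \<Rightarrow> ('a \<Rightarrow> real) \<Rightarrow> ('a \<Rightarrow> real) \<Rightarrow> ('a \<Rightarrow> real) \<Rightarrow> real" where
  "closed_form b m f g =
     (THE c. \<forall>\<phi> \<psi>. form_approx b m \<phi> f \<longrightarrow> form_approx b m \<psi> g \<longrightarrow>
        (\<lambda>n. energy b (\<phi> n) (\<psi> n)) \<longlonglongrightarrow> c)"

text \<open>The self-adjoint operator of the closed form, as an operator graph: \<open>(f, g)\<close> belongs to it
  iff \<open>f\<close> is in the domain of \<open>\<Delta>\<close> and \<open>\<Delta> f = g\<close>.\<close>

definition laplacian ::
    "('a \<Rightarrow> 'a \<Rightarrow> real) \<Rightarrow> ('a \<Rightarrow> real) \<Rightarrow> (('a \<Rightarrow> real) \<times> ('a \<Rightarrow> real)) set" where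
  "laplacian b m =
     {(f, g). f \<in> closed_form_dom b m \<and> g \<in> ell2 m \<and>
        (\<forall>h \<in> closed_form_dom b m. closed_form b m f h = ell2_inner m g h)}"

definition contraction_semigroup ::
    "('a \<Rightarrow> real) \<Rightarrow> (real \<Rightarrow> ('a \<Rightarrow> real) \<Rightarrow> ('a \<Rightarrow> real)) \<Rightarrow> bool" where
  "contraction_semigroup m P \<longleftrightarrow>
     (\<forall>t\<ge>0. \<forall>f\<in>ell2 m. P t f \<in> ell2 m \<and> ell2_norm m (P t f) \<le> ell2_norm m f) \<and>
     (\<forall>t\<ge>0. \<forall>f\<in>ell2 m. \<forall>g\<in>ell2 m. P t (\<lambda>x. f x + g x) = (\<lambda>x. P t f x + P t g x)) \<and>
     (\<forall>t\<ge>0. \<forall>f\<in>ell2 m. \<forall>c. P t (\<lambda>x. c * f x) = (\<lambda>x. c * P t f x)) \<and>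
     (\<forall>f\<in>ell2 m. P 0 f = f) \<and>
     (\<forall>s\<ge>0. \<forall>t\<ge>0. \<forall>f\<in>ell2 m. P (s + t) f = P s (P t f)) \<and>
     (\<forall>f\<in>ell2 m. ((\<lambda>t. ell2_norm m (\<lambda>x. P t f x - f x)) \<longlongrightarrow> 0) (at_right 0))"

definition generator ::
    "('a \<Rightarrow> real) \<Rightarrow> (real \<Rightarrow> ('a \<Rightarrow> real) \<Rightarrow> ('a \<Rightarrow> real)) \<Rightarrow> (('a \<Rightarrow> real) \<times> ('a \<Rightarrow> real)) set" where
  "generator m P =
     {(f, g). f \<in> ell2 m \<and> g \<in> ell2 m \<and>
        ((\<lambda>t. ell2_norm m (\<lambda>x. (P t f x - f x) / t - g x)) \<longlongrightarrow> 0) (at_right 0)}"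

text \<open>\<open>e\<^bsup>-t\<Delta>\<^esup>\<close> is the strongly continuous contraction semigroup on \<open>\<ell>\<^sup>2(X,m)\<close> with generator
  \<open>-\<Delta>\<close>. By the Hille--Yosida theorem it exists and is uniquely determined for \<open>t \<ge> 0\<close> on
  \<open>\<ell>\<^sup>2(X,m)\<close>; the choice operator only affects the irrelevant values outside.\<close>

definition heat_semigroup ::
    "('a \<Rightarrow> 'a \<Rightarrow> real) \<Rightarrow> ('a \<Rightarrow> real) \<Rightarrow> real \<Rightarrow> ('a \<Rightarrow> real) \<Rightarrow> ('a \<Rightarrow> real)" where
  "heat_semigroup b m =
     (SOME P. contraction_semigroup m P \<and>
        generator m P = {(f, \<lambda>x. - g x) | f g. (f, g) \<in> laplacian b m})"

text \<open>The kernel is forced by \<open>P\<^sub>t f(x) = \<Sum>\<^sub>y p\<^sub>t(x,y) f(y) m(y)\<close> at the indicator functions of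
  single vertices.\<close>

definition heat_kernel ::
    "('a \<Rightarrow> 'a \<Rightarrow> real) \<Rightarrow> ('a \<Rightarrow> real) \<Rightarrow> real \<Rightarrow> 'a \<Rightarrow> 'a \<Rightarrow> real" where
  "heat_kernel b m t x y = heat_semigroup b m t (indicator {y}) x / m y"

definition heat_bounded ::
    "('a \<Rightarrow> 'a \<Rightarrow> real) \<Rightarrow> ('a \<Rightarrow> real) \<Rightarrow> real \<Rightarrow> ('a \<Rightarrow> real) \<Rightarrow> ('a \<Rightarrow> real)" where
  "heat_bounded b m t f x = (\<Sum>\<^sub>\<infinity>y. heat_kernel b m t x y * f y * m y)"

definition feller :: "('a \<Rightarrow> 'a \<Rightarrow> real) \<Rightarrow> ('a \<Rightarrow> real) \<Rightarrow> bool" where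
  "feller b m \<longleftrightarrow> (\<forall>t\<ge>0. \<forall>f\<in>C_0. heat_bounded b m t f \<in> C_0)"

end

theory Submission
  imports Defs "HOL-Real_Asymp.Real_Asymp"
begin

text \<open>
  The Feller property follows from a barrier. Suppose that a positive function \<open>v\<close> vanishes at
  infinity and satisfies \<open>\<Delta> v + a v \<ge> 0\<close> for the formal Laplacian and some \<open>a \<ge> 0\<close>. Such a
  supersolution is compared with the heat flow: if \<open>\<phi>\<close> is finitely supported and \<open>0 \<le> \<phi> \<le> v\<close>,
  then \<open>0 \<le> P\<^sub>t \<phi> \<le> e\<^bsup>at\<^esup> v\<close> (\<open>heat_bound\<close>). A multiple of \<open>v\<close> dominates the
  indicator of any single vertex, so every \<open>p\<^sub>t(\<cdot>, y)\<close> vanishes at infinity; together with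
  \<open>P\<^sub>t 1 \<le> 1\<close>, which is the same comparison with \<open>v = 1\<close> and \<open>a = 0\<close>, this carries over to all of
  \<open>C\<^sub>0(X)\<close> (\<open>feller_if_decaying_supersolution\<close>).

  In a model graph the barrier can be taken radial. For \<open>v(x) = u(d(x, o))\<close> the equation
  \<open>\<Delta> v + v = 0\<close> away from the root is the second order difference equation
  \<open>D(n) (u(n) - u(n+1)) - D(n-1) (u(n-1) - u(n)) + \<mu>(n) u(n) = 0\<close>, where \<open>\<mu>(n)\<close> is the measure of the
  sphere of radius \<open>n\<close> and \<open>D(n)\<close> the weight of the edges that leave it outwards. Let \<open>w\<close> be its increasing
  solution that is regular at the root, and \<open>F(n) = D(n) (w(n+1) - w(n)) = \<Sum>\<^bsub>k\<le>n\<^esub> \<mu>(k) w(k)\<close>.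
  Reduction of order gives the decreasing solution
  \<open>u(n) = w(n) \<Sum>\<^bsub>k\<ge>n\<^esub> 1 / (D(k) w(k) w(k+1))\<close>. The summands equal
  \<open>(1/w(k) - 1/w(k+1)) / F(k)\<close>, and \<open>F\<close> is increasing, so telescoping yields
  \<open>u(n) \<le> 1 / F(n) \<le> 1 / m(B\<^sub>n)\<close> for the balls \<open>B\<^sub>n\<close>. This tends to \<open>0\<close> because
  \<open>m(X) = \<infinity>\<close> (\<open>decaying_supersolution_sequence\<close>, \<open>decaying_supersolution\<close>).

  The heat semigroup is specified only by its generator, so the comparison requires a construction
  of it and a uniqueness theorem. For \<open>c > 0\<close> and \<open>g \<ge> 0\<close> in \<open>\<ell>\<^sup>2\<close> a monotone iteration through
  finitely supported functions converges to the smallest nonnegative solution of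
  \<open>\<Delta> w + c w = g\<close>, and this solution lies in the form domain (\<open>minimal_resolvent\<close>). Hence \<open>-\<Delta>\<close> is a
  maximal dissipative operator, and the Yosida approximations \<open>e\<^bsup>tc(J\<^sub>c - 1)\<^esup>\<close> with
  \<open>J\<^sub>c = c (c + \<Delta>)\<^sup>-\<^sup>1\<close> converge to a contraction semigroup that it generates (\<open>gen_semigroup\<close>).
  Minimality of the resolvent is a comparison principle for \<open>J\<^sub>c\<close>; the exponential series and the
  limit preserve it (\<open>semigroup_bound\<close>). Semigroups with the same generator agree on its domain
  (\<open>semigroup_unique\<close>), which contains the finitely supported functions, and the heat kernel is
  determined by the values there (\<open>heat_semigroup_eq\<close>).
\<close>

section \<open>The Hilbert space of square summable functions\<close>

text \<open>The sequences are unweighted, so that one type serves both for \<open>\<ell>\<^sup>2(X, m)\<close>, after multiplication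
  by \<open>\<surd>m\<close>, and for the square summable functions on pairs of vertices, which hold the gradients.\<close>

typedef 'a l2 = "{f :: 'a \<Rightarrow> real. (\<lambda>x. (f x)\<^sup>2) summable_on UNIV}"
  morphisms coord Abs_l2
  by (rule exI[of _ "\<lambda>_. 0"]) simp

setup_lifting type_definition_l2

lemma summable_square [simp]: "(\<lambda>x. (coord f x)\<^sup>2) summable_on UNIV"
  using coord[of f] by simp

lemma summable_product:
  fixes f g :: "'a \<Rightarrow> real"
  assumes "(\<lambda>x. (f x)\<^sup>2) summable_on A" "(\<lambda>x. (g x)\<^sup>2) summable_on A"
  shows "(\<lambda>x. f x * g x) summable_on A"
proof -
  have "(\<lambda>x. norm (f x * g x)) summable_on A"
  proof (rule summable_on_comparison_test)
    show "(\<lambda>x. (f x)\<^sup>2 + (g x)\<^sup>2) summable_on A"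
      using assms by (rule summable_on_add)
    show "norm (f x * g x) \<le> (f x)\<^sup>2 + (g x)\<^sup>2" for x
    proof -
      have "0 \<le> (\<bar>f x\<bar> - \<bar>g x\<bar>)\<^sup>2" by simp
      then have "2 * (\<bar>f x\<bar> * \<bar>g x\<bar>) \<le> (f x)\<^sup>2 + (g x)\<^sup>2" by (simp add: power2_diff)
      moreover have "0 \<le> \<bar>f x\<bar> * \<bar>g x\<bar>" by simp
      ultimately have "\<bar>f x\<bar> * \<bar>g x\<bar> \<le> (f x)\<^sup>2 + (g x)\<^sup>2" by linarith
      then show ?thesis by (simp add: abs_mult)
    qed
  qed auto
  then show ?thesis by (rule abs_summable_summable)
qed

lemma summable_square_add:
  fixes f g :: "'a \<Rightarrow> real"
  assumes "(\<lambda>x. (f x)\<^sup>2) summable_on A" "(\<lambda>x. (g x)\<^sup>2) summable_on A"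
  shows "(\<lambda>x. (f x + g x)\<^sup>2) summable_on A"
proof -
  have "(\<lambda>x. (f x)\<^sup>2 + (g x)\<^sup>2 + 2 * (f x * g x)) summable_on A"
    using assms by (intro summable_on_add summable_on_cmult_right summable_product)
  then show ?thesis by (simp add: power2_sum mult.assoc)
qed

lemma summable_square_scale:
  fixes f :: "'a \<Rightarrow> real"
  assumes "(\<lambda>x. (f x)\<^sup>2) summable_on A"
  shows "(\<lambda>x. (c * f x)\<^sup>2) summable_on A"
  using summable_on_cmult_right[OF assms, of "c\<^sup>2"] by (simp add: power_mult_distrib)

instantiation l2 :: (type) real_inner
begin

lift_definition zero_l2 :: "'a l2" is "\<lambda>_. 0" by simp
lift_definition plus_l2 :: "'a l2 \<Rightarrow> 'a l2 \<Rightarrow> 'a l2" is "\<lambda>f g x. f x + g x"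
  by (rule summable_square_add)
lift_definition uminus_l2 :: "'a l2 \<Rightarrow> 'a l2" is "\<lambda>f x. - f x" by simp
lift_definition minus_l2 :: "'a l2 \<Rightarrow> 'a l2 \<Rightarrow> 'a l2" is "\<lambda>f g x. f x - g x"
proof -
  fix f g :: "'a \<Rightarrow> real"
  assume "(\<lambda>x. (f x)\<^sup>2) summable_on UNIV" "(\<lambda>x. (g x)\<^sup>2) summable_on UNIV"
  then show "(\<lambda>x. (f x - g x)\<^sup>2) summable_on UNIV"
    using summable_square_add[of f UNIV "\<lambda>x. - g x"] by simp
qed
lift_definition scaleR_l2 :: "real \<Rightarrow> 'a l2 \<Rightarrow> 'a l2" is "\<lambda>c f x. c * f x"
  by (rule summable_square_scale)
definition inner_l2 :: "'a l2 \<Rightarrow> 'a l2 \<Rightarrow> real" where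
  "inner_l2 f g = (\<Sum>\<^sub>\<infinity>x. coord f x * coord g x)"
definition norm_l2 :: "'a l2 \<Rightarrow> real" where
  "norm_l2 f = sqrt (inner f f)"
definition sgn_l2 :: "'a l2 \<Rightarrow> 'a l2" where
  "sgn_l2 f = scaleR (inverse (norm f)) f"
definition dist_l2 :: "'a l2 \<Rightarrow> 'a l2 \<Rightarrow> real" where
  "dist_l2 f g = norm (f - g)"
definition uniformity_l2 :: "('a l2 \<times> 'a l2) filter" where
  "uniformity_l2 = (INF e\<in>{0<..}. principal {(x, y). dist x y < e})"
definition open_l2 :: "'a l2 set \<Rightarrow> bool" where
  "open_l2 U = (\<forall>x\<in>U. eventually (\<lambda>(x', y). x' = x \<longrightarrow> y \<in> U) uniformity)"

instance
proof
  have prod: "(\<lambda>x. coord f x * coord g x) summable_on UNIV" for f g :: "'a l2"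
    by (rule summable_product) simp_all
  fix f g h :: "'a l2" and c d :: real
  show "f + g + h = f + (g + h)" by transfer (simp add: add.assoc)
  show "f + g = g + f" by transfer (simp add: add.commute)
  show "0 + f = f" by transfer simp
  show "- f + f = 0" by transfer simp
  show "f - g = f + - g" by transfer simp
  show "c *\<^sub>R (f + g) = c *\<^sub>R f + c *\<^sub>R g" by transfer (simp add: algebra_simps)
  show "(c + d) *\<^sub>R f = c *\<^sub>R f + d *\<^sub>R f" by transfer (simp add: algebra_simps)
  show "c *\<^sub>R d *\<^sub>R f = (c * d) *\<^sub>R f" by transfer (simp add: algebra_simps)
  show "1 *\<^sub>R f = f" by transfer simp
  show "dist f g = norm (f - g)" by (simp add: dist_l2_def)
  show "sgn f = inverse (norm f) *\<^sub>R f" by (simp add: sgn_l2_def)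
  show "norm f = sqrt (inner f f)" by (simp add: norm_l2_def)
  show "inner f g = inner g f" by (simp add: inner_l2_def mult.commute)
  show "inner (f + g) h = inner f h + inner g h"
    by (simp add: inner_l2_def plus_l2.rep_eq distrib_right infsum_add prod)
  show "inner (c *\<^sub>R f) g = c * inner f g"
    by (simp add: inner_l2_def scaleR_l2.rep_eq mult.assoc infsum_cmult_right')
  show "0 \<le> inner f f" by (simp add: inner_l2_def infsum_nonneg)
  show "inner f f = 0 \<longleftrightarrow> f = 0"
  proof
    assume "inner f f = 0"
    have "coord f x = 0" for x
    proof -
      have "sum (\<lambda>x. coord f x * coord f x) {x} \<le> inner f f"
        unfolding inner_l2_def by (rule finite_sum_le_infsum[OF prod]) auto
      then have "coord f x * coord f x \<le> 0" using \<open>inner f f = 0\<close> by simp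
      then show ?thesis by (metis mult_eq_0_iff order_antisym zero_le_square)
    qed
    then show "f = 0" by transfer auto
  qed (simp add: inner_l2_def zero_l2.rep_eq)
qed (fact uniformity_l2_def open_l2_def)+

end

lemmas coord_simps [simp] =
  zero_l2.rep_eq plus_l2.rep_eq uminus_l2.rep_eq minus_l2.rep_eq scaleR_l2.rep_eq

lemma norm_l2_square: "(norm f)\<^sup>2 = (\<Sum>\<^sub>\<infinity>x. (coord f x)\<^sup>2)" for f :: "'a l2"
  by (subst power2_norm_eq_inner) (simp add: inner_l2_def power2_eq_square)

lemma sum_square_le_norm:
  fixes f :: "'a l2"
  assumes "finite K"
  shows "(\<Sum>x\<in>K. (coord f x)\<^sup>2) \<le> (norm f)\<^sup>2"
  unfolding norm_l2_square by (rule finite_sum_le_infsum) (use assms in auto)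

lemma coord_le_norm: "\<bar>coord f x\<bar> \<le> norm f" for f :: "'a l2"
  using sum_square_le_norm[of "{x}" f] by (simp add: abs_le_square_iff[symmetric])

lemma bounded_linear_coord: "bounded_linear (\<lambda>f. coord f x)"
  by (rule bounded_linear_intro[where K = 1]) (auto simp: coord_le_norm)

lemmas tendsto_coord = bounded_linear.tendsto[OF bounded_linear_coord]

lemma in_l2_if_bounded_sums:
  fixes f :: "'a \<Rightarrow> real"
  assumes "\<And>K. finite K \<Longrightarrow> (\<Sum>x\<in>K. (f x)\<^sup>2) \<le> C"
  shows "(\<lambda>x. (f x)\<^sup>2) summable_on UNIV" and "(\<Sum>\<^sub>\<infinity>x. (f x)\<^sup>2) \<le> C"
proof -
  show *: "(\<lambda>x. (f x)\<^sup>2) summable_on UNIV"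
    by (rule nonneg_bdd_above_summable_on) (auto intro!: bdd_aboveI2[where M = C] assms)
  show "(\<Sum>\<^sub>\<infinity>x. (f x)\<^sup>2) \<le> C"
    by (rule infsum_le_finite_sums[OF *]) (use assms in auto)
qed

text \<open>A Cauchy sequence converges pointwise. All estimates are made on finite sets of coordinates,
  where the pointwise limit may be taken, and then hold for the full sums.\<close>
instance l2 :: (type) banach
proof
  fix F :: "nat \<Rightarrow> 'a l2"
  assume F: "Cauchy F"
  have "Cauchy (\<lambda>n. coord (F n) x)" for x
    using bounded_linear.Cauchy[OF bounded_linear_coord F] .
  then have "convergent (\<lambda>n. coord (F n) x)" for x
    by (simp add: Cauchy_convergent_iff)
  then obtain f where f: "(\<lambda>n. coord (F n) x) \<longlonglongrightarrow> f x" for x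
    unfolding convergent_def by metis
  have close: "\<exists>N. \<forall>n\<ge>N. \<forall>K. finite K \<longrightarrow> (\<Sum>x\<in>K. (f x - coord (F n) x)\<^sup>2) \<le> e\<^sup>2"
    if "e > 0" for e
  proof -
    obtain N where N: "norm (F i - F j) < e" if "i \<ge> N" "j \<ge> N" for i j
      using F \<open>e > 0\<close> by (metis CauchyD)
    have "(\<Sum>x\<in>K. (f x - coord (F n) x)\<^sup>2) \<le> e\<^sup>2" if "n \<ge> N" "finite K" for n K
    proof (rule LIMSEQ_le_const2)
      show "(\<lambda>i. \<Sum>x\<in>K. (coord (F i) x - coord (F n) x)\<^sup>2) \<longlonglongrightarrow> (\<Sum>x\<in>K. (f x - coord (F n) x)\<^sup>2)"
        by (intro tendsto_intros f)
      have "(\<Sum>x\<in>K. (coord (F i) x - coord (F n) x)\<^sup>2) \<le> e\<^sup>2" if "i \<ge> N" for i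
      proof -
        have "(\<Sum>x\<in>K. (coord (F i - F n) x)\<^sup>2) \<le> (norm (F i - F n))\<^sup>2"
          by (rule sum_square_le_norm) fact
        also have "\<dots> \<le> e\<^sup>2"
          using N[OF that \<open>n \<ge> N\<close>] by (intro power_mono) auto
        finally show ?thesis by simp
      qed
      then show "\<exists>N. \<forall>i\<ge>N. (\<Sum>x\<in>K. (coord (F i) x - coord (F n) x)\<^sup>2) \<le> e\<^sup>2" by blast
    qed
    then show ?thesis by blast
  qed
  obtain N where N: "\<And>K. finite K \<Longrightarrow> (\<Sum>x\<in>K. (f x - coord (F N) x)\<^sup>2) \<le> 1\<^sup>2"
    using close[of 1] by auto
  have "(\<lambda>x. (f x - coord (F N) x)\<^sup>2) summable_on UNIV"
    by (rule in_l2_if_bounded_sums(1)[OF N])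
  from summable_square_add[OF this summable_square[of "F N"]]
  have fl: "(\<lambda>x. (f x)\<^sup>2) summable_on UNIV" by simp
  define L where "L = Abs_l2 f"
  have L: "coord L = f" using fl by (simp add: L_def Abs_l2_inverse)
  have "F \<longlonglongrightarrow> L"
  proof (rule LIMSEQ_I)
    fix e :: real assume "e > 0"
    then have "e / 2 > 0" by simp
    from close[OF this] obtain N where
      N: "\<forall>n\<ge>N. \<forall>K. finite K \<longrightarrow> (\<Sum>x\<in>K. (f x - coord (F n) x)\<^sup>2) \<le> (e / 2)\<^sup>2" by blast
    have "norm (F n - L) < e" if "n \<ge> N" for n
    proof -
      have "(norm (L - F n))\<^sup>2 \<le> (e / 2)\<^sup>2"
        unfolding norm_l2_square using N that by (intro in_l2_if_bounded_sums(2)) (auto simp: L)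
      then have "norm (L - F n) \<le> e / 2" using \<open>e > 0\<close> by (simp add: power2_le_iff_abs_le)
      then show ?thesis using \<open>e > 0\<close> by (simp add: norm_minus_commute)
    qed
    then show "\<exists>N. \<forall>n\<ge>N. norm (F n - L) < e" by blast
  qed
  then show "convergent F" by (rule convergentI)
qed

text \<open>Perfectness stands for the space being nonzero; it gives the identity operator the norm \<open>1\<close>.\<close>
instance l2 :: (type) perfect_space
proof
  fix f :: "'a l2"
  have "(\<lambda>x :: 'a. (indicator {undefined} x :: real)\<^sup>2) summable_on UNIV"
    by (rule summable_on_cong_neutral[where T = "{undefined}", THEN iffD2]) auto
  then have "coord (Abs_l2 (indicator {undefined :: 'a})) undefined = 1"
    by (simp add: Abs_l2_inverse)
  then obtain g :: "'a l2" where "g \<noteq> 0" by (metis coord_simps(1) zero_neq_one)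
  show "\<not> open {f}"
  proof
    assume "open {f}"
    then obtain e where e: "e > 0" "\<And>h. dist h f < e \<Longrightarrow> h = f"
      by (auto simp: open_dist)
    define h where "h = f + (e / 2 / norm g) *\<^sub>R g"
    have "dist h f < e" using \<open>g \<noteq> 0\<close> e(1) by (simp add: h_def dist_norm)
    then have "h = f" by (rule e(2))
    then show False using \<open>e > 0\<close> \<open>g \<noteq> 0\<close> by (simp add: h_def)
  qed
qed

section \<open>Bounded endomorphisms and their exponential\<close>

text \<open>With composition as multiplication the bounded endomorphisms form a unital Banach algebra. As a
  type of their own they are an instance of the corresponding classes, and thereby inherit the
  exponential, its power series and its derivative.\<close>
typedef (overloaded) ('h::real_normed_vector) endo = "UNIV :: ('h \<Rightarrow>\<^sub>L 'h) set"
  morphisms blinfun_of_endo Endo by auto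

setup_lifting type_definition_endo

instantiation endo :: ("{real_normed_vector, perfect_space}") real_normed_algebra_1
begin

lift_definition zero_endo :: "'a endo" is 0 .
lift_definition one_endo :: "'a endo" is id_blinfun .
lift_definition plus_endo :: "'a endo \<Rightarrow> 'a endo \<Rightarrow> 'a endo" is plus .
lift_definition minus_endo :: "'a endo \<Rightarrow> 'a endo \<Rightarrow> 'a endo" is minus .
lift_definition uminus_endo :: "'a endo \<Rightarrow> 'a endo" is uminus .
lift_definition times_endo :: "'a endo \<Rightarrow> 'a endo \<Rightarrow> 'a endo" is "(o\<^sub>L)" .
lift_definition scaleR_endo :: "real \<Rightarrow> 'a endo \<Rightarrow> 'a endo" is scaleR .
lift_definition norm_endo :: "'a endo \<Rightarrow> real" is norm .
definition sgn_endo :: "'a endo \<Rightarrow> 'a endo" where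
  "sgn_endo S = scaleR (inverse (norm S)) S"
definition dist_endo :: "'a endo \<Rightarrow> 'a endo \<Rightarrow> real" where
  "dist_endo S T = norm (S - T)"
definition uniformity_endo :: "('a endo \<times> 'a endo) filter" where
  "uniformity_endo = (INF e\<in>{0<..}. principal {(x, y). dist x y < e})"
definition open_endo :: "'a endo set \<Rightarrow> bool" where
  "open_endo U = (\<forall>x\<in>U. eventually (\<lambda>(x', y). x' = x \<longrightarrow> y \<in> U) uniformity)"

instance
proof
  fix R S T :: "'a endo" and c d :: real
  show "R + S + T = R + (S + T)" by transfer (simp add: add.assoc)
  show "S + T = T + S" by transfer (simp add: add.commute)
  show "0 + S = S" by transfer simp
  show "- S + S = 0" by transfer simp
  show "S - T = S + - T" by transfer simp
  show "R * S * T = R * (S * T)" by transfer (simp add: blinfun_eqI)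
  show "(R + S) * T = R * T + S * T"
    by transfer (simp add: blinfun_eqI blinfun.bilinear_simps)
  show "R * (S + T) = R * S + R * T"
    by transfer (simp add: blinfun_eqI blinfun.bilinear_simps)
  show "1 * S = S" by transfer (simp add: blinfun_eqI)
  show "S * 1 = S" by transfer (simp add: blinfun_eqI)
  show "(0 :: 'a endo) \<noteq> 1"
  proof transfer
    show "(0 :: 'a \<Rightarrow>\<^sub>L 'a) \<noteq> id_blinfun"
      using norm_blinfun_id[where 'a = 'a] by (metis norm_zero zero_neq_one)
  qed
  show "c *\<^sub>R (S + T) = c *\<^sub>R S + c *\<^sub>R T" by transfer (simp add: algebra_simps)
  show "(c + d) *\<^sub>R S = c *\<^sub>R S + d *\<^sub>R S" by transfer (simp add: algebra_simps)
  show "c *\<^sub>R d *\<^sub>R S = (c * d) *\<^sub>R S" by transfer simp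
  show "1 *\<^sub>R S = S" by transfer simp
  show "c *\<^sub>R S * T = c *\<^sub>R (S * T)"
    by transfer (simp add: blinfun_eqI blinfun.bilinear_simps)
  show "S * c *\<^sub>R T = c *\<^sub>R (S * T)"
    by transfer (simp add: blinfun_eqI blinfun.bilinear_simps)
  show "dist S T = norm (S - T)" by (simp add: dist_endo_def)
  show "sgn S = inverse (norm S) *\<^sub>R S" by (simp add: sgn_endo_def)
  show "norm S = 0 \<longleftrightarrow> S = 0" by transfer simp
  show "norm (S + T) \<le> norm S + norm T" by transfer (rule norm_triangle_ineq)
  show "norm (c *\<^sub>R S) = \<bar>c\<bar> * norm S" by transfer simp
  show "norm (S * T) \<le> norm S * norm T" by transfer (rule norm_blinfun_compose)
  show "norm (1 :: 'a endo) = 1" by transfer simp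
qed (fact uniformity_endo_def open_endo_def)+

end

instance endo :: ("{banach, perfect_space}") banach
proof
  fix F :: "nat \<Rightarrow> 'a endo"
  assume F: "Cauchy F"
  have dist: "dist (blinfun_of_endo S) (blinfun_of_endo T) = dist S T" for S T :: "'a endo"
    by (simp add: dist_norm norm_endo.rep_eq minus_endo.rep_eq)
  have "Cauchy (\<lambda>n. blinfun_of_endo (F n))"
    using F by (simp add: Cauchy_def dist)
  then obtain L where "(\<lambda>n. blinfun_of_endo (F n)) \<longlonglongrightarrow> L"
    by (auto simp: Cauchy_convergent_iff convergent_def)
  moreover have "L = blinfun_of_endo (Endo L)" by (simp add: Endo_inverse)
  ultimately have "F \<longlonglongrightarrow> Endo L"
    by (metis (no_types, lifting) dist lim_sequentially)
  then show "convergent F" by (rule convergentI)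
qed

lift_definition app :: "'h::real_normed_vector endo \<Rightarrow> 'h \<Rightarrow> 'h" is blinfun_apply .

lemma bounded_bilinear_app: "bounded_bilinear (app :: 'h::{real_normed_vector, perfect_space} endo \<Rightarrow> _)"
proof
  fix S T :: "'h endo" and f g :: 'h and c :: real
  show "app (S + T) f = app S f + app T f" by transfer (simp add: blinfun.bilinear_simps)
  show "app S (f + g) = app S f + app S g" by transfer (simp add: blinfun.bilinear_simps)
  show "app (c *\<^sub>R S) f = c *\<^sub>R app S f" by transfer (simp add: blinfun.bilinear_simps)
  show "app S (c *\<^sub>R f) = c *\<^sub>R app S f" by transfer (simp add: blinfun.bilinear_simps)
  show "\<exists>K. \<forall>S (f :: 'h). norm (app S f) \<le> norm S * norm f * K"
    by (rule exI[of _ 1], transfer) (simp add: norm_blinfun)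
qed

interpretation app: bounded_bilinear "app :: 'h::{real_normed_vector, perfect_space} endo \<Rightarrow> _"
  by (rule bounded_bilinear_app)

lemma norm_app: "norm (app S f) \<le> norm S * norm f"
  for S :: "'h::{real_normed_vector, perfect_space} endo"
  by transfer (rule norm_blinfun)

lemma norm_app_contraction:
  fixes S :: "'h::{real_normed_vector, perfect_space} endo"
  assumes "norm S \<le> 1" shows "norm (app S f) \<le> norm f"
  using norm_app[of S f] mult_right_mono[OF assms, of "norm f"] by simp

lemma app_mult [simp]: "app (S * T) f = app S (app T f)"
  for S T :: "'h::{real_normed_vector, perfect_space} endo"
  by transfer simp

lemma app_one [simp]: "app 1 f = f" for f :: "'h::{real_normed_vector, perfect_space}"
  by transfer simp

lemma endo_eqI: "(\<And>f. app S f = app T f) \<Longrightarrow> S = T"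
  for S T :: "'h::{real_normed_vector, perfect_space} endo"
  by transfer (rule blinfun_eqI)

lemma app_Endo_Blinfun: "bounded_linear F \<Longrightarrow> app (Endo (Blinfun F)) f = F f"
  by (simp add: app.rep_eq Endo_inverse bounded_linear_Blinfun_apply)

lemma mean_value_vector:
  fixes \<phi> :: "real \<Rightarrow> 'h::real_normed_vector"
  assumes "0 \<le> t"
    and "\<And>s. 0 \<le> s \<Longrightarrow> s \<le> t \<Longrightarrow> (\<phi> has_vector_derivative \<phi>' s) (at s within {0..t})"
    and "\<And>s. 0 \<le> s \<Longrightarrow> s \<le> t \<Longrightarrow> norm (\<phi>' s) \<le> B"
  shows "norm (\<phi> t - \<phi> 0) \<le> t * B"
proof -
  have "norm (\<phi> t - \<phi> 0) \<le> B * norm (t - 0)"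
  proof (rule differentiable_bound[where S = "{0..t}" and f' = "\<lambda>s h. h *\<^sub>R \<phi>' s"])
    show "(\<phi> has_derivative (\<lambda>h. h *\<^sub>R \<phi>' s)) (at s within {0..t})" if "s \<in> {0..t}" for s
      using assms(2) that by (simp add: has_vector_derivative_def)
    show "onorm (\<lambda>h. h *\<^sub>R \<phi>' s) \<le> B" if "s \<in> {0..t}" for s
    proof (rule onorm_le)
      fix h :: real
      have "\<bar>h\<bar> * norm (\<phi>' s) \<le> \<bar>h\<bar> * B" using that assms(3) by (intro mult_left_mono) auto
      then show "norm (h *\<^sub>R \<phi>' s) \<le> B * norm h" by (simp add: mult.commute)
    qed
  qed (use assms(1) in auto)
  then show ?thesis using assms(1) by (simp add: mult.commute)
qed

lemma has_vector_derivative_app_exp: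
  fixes D C :: "'h::{banach, perfect_space} endo"
  shows "((\<lambda>s. app C (app (exp (s *\<^sub>R D)) f)) has_vector_derivative
           app C (app (exp (s *\<^sub>R D)) (app D f))) (at s within T)"
proof -
  have "((\<lambda>s. app (C * exp (s *\<^sub>R D)) f) has_vector_derivative
           app (C * (exp (s *\<^sub>R D) * D)) f) (at s within T)"
    by (rule bounded_linear.has_vector_derivative[OF app.bounded_linear_left])
       (intro has_vector_derivative_mult_right exp_scaleR_has_vector_derivative_right)
  then show ?thesis by simp
qed

text \<open>The operator \<open>e\<^bsup>tT\<^esup> e\<^bsup>s(S - T)\<^esup> = e\<^bsup>sS\<^esup> e\<^bsup>(t - s)T\<^esup>\<close> runs from \<open>e\<^bsup>tT\<^esup>\<close> to \<open>e\<^bsup>tS\<^esup>\<close> as \<open>s\<close> runs from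
  \<open>0\<close> to \<open>t\<close>. Its derivative in \<open>s\<close> is itself times \<open>S - T\<close>, hence at \<open>f\<close> its norm is at most that
  of \<open>(S - T) f\<close>. The case \<open>T = 0\<close> bounds the displacement \<open>e\<^bsup>tS\<^esup> f - f\<close>.\<close>
lemma exp_difference_le:
  fixes S T :: "'h::{banach, perfect_space} endo"
  assumes "0 \<le> t" and comm: "S * T = T * S"
    and S: "\<And>s. 0 \<le> s \<Longrightarrow> norm (exp (s *\<^sub>R S)) \<le> 1"
    and T: "\<And>s. 0 \<le> s \<Longrightarrow> norm (exp (s *\<^sub>R T)) \<le> 1"
  shows "norm (app (exp (t *\<^sub>R S)) f - app (exp (t *\<^sub>R T)) f) \<le> t * norm (app S f - app T f)"
proof -
  let ?E = "\<lambda>s. exp (t *\<^sub>R T) * exp (s *\<^sub>R (S - T))"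
  have E: "?E s = exp (s *\<^sub>R S) * exp ((t - s) *\<^sub>R T)" for s
  proof -
    have "?E s = exp (t *\<^sub>R T + s *\<^sub>R (S - T))"
      by (rule exp_add_commuting[symmetric]) (simp add: comm algebra_simps)
    also have "t *\<^sub>R T + s *\<^sub>R (S - T) = s *\<^sub>R S + (t - s) *\<^sub>R T"
      by (simp add: algebra_simps)
    also have "exp \<dots> = exp (s *\<^sub>R S) * exp ((t - s) *\<^sub>R T)"
      by (rule exp_add_commuting) (simp add: comm)
    finally show ?thesis .
  qed
  have "norm (app (exp (t *\<^sub>R T)) (app (exp (t *\<^sub>R (S - T))) f)
           - app (exp (t *\<^sub>R T)) (app (exp (0 *\<^sub>R (S - T))) f)) \<le> t * norm (app (S - T) f)"
  proof (rule mean_value_vector[OF \<open>0 \<le> t\<close> has_vector_derivative_app_exp])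
    fix s assume s: "0 \<le> s" "s \<le> t"
    have "norm (?E s) \<le> norm (exp (s *\<^sub>R S)) * norm (exp ((t - s) *\<^sub>R T))"
      unfolding E by (rule norm_mult_ineq)
    also have "\<dots> \<le> 1 * 1" using s by (intro mult_mono S T) auto
    finally have "norm (app (?E s) (app (S - T) f)) \<le> norm (app (S - T) f)"
      by (intro norm_app_contraction) simp
    then show "norm (app (exp (t *\<^sub>R T)) (app (exp (s *\<^sub>R (S - T))) (app (S - T) f)))
        \<le> norm (app (S - T) f)"
      by simp
  qed
  moreover have "app (exp (t *\<^sub>R T)) (app (exp (t *\<^sub>R (S - T))) f) = app (exp (t *\<^sub>R S)) f"
    using E[of t] by (simp flip: app_mult)
  ultimately show ?thesis by (simp add: app.diff_left)
qed

lemma exp_taylor_le: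
  fixes S :: "'h::{banach, perfect_space} endo"
  assumes "0 \<le> t"
    and "\<And>s. 0 \<le> s \<Longrightarrow> s \<le> t \<Longrightarrow> norm (app (exp (s *\<^sub>R S)) (app S f) - app S f) \<le> B"
  shows "norm (app (exp (t *\<^sub>R S)) f - f - t *\<^sub>R app S f) \<le> t * B"
proof -
  let ?\<phi> = "\<lambda>s. app 1 (app (exp (s *\<^sub>R S)) f) - s *\<^sub>R app S f"
  have "norm (?\<phi> t - ?\<phi> 0) \<le> t * B"
  proof (rule mean_value_vector[OF \<open>0 \<le> t\<close>])
    show "(?\<phi> has_vector_derivative app 1 (app (exp (s *\<^sub>R S)) (app S f)) - app S f) (at s within {0..t})" for s
      by (intro has_vector_derivative_diff has_vector_derivative_app_exp)
         (auto intro!: derivative_eq_intros)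
  qed (use assms in auto)
  then show ?thesis by (simp add: algebra_simps)
qed

section \<open>Contraction semigroups and their generators\<close>

text \<open>Strongly continuous contraction semigroups on a normed space. The values for \<open>t < 0\<close> are left
  arbitrary.\<close>
definition contr_semigroup :: "(real \<Rightarrow> 'h \<Rightarrow> 'h::real_normed_vector) \<Rightarrow> bool" where
  "contr_semigroup P \<longleftrightarrow>
     (\<forall>t\<ge>0. linear (P t)) \<and> (\<forall>t\<ge>0. \<forall>f. norm (P t f) \<le> norm f) \<and> (\<forall>f. P 0 f = f) \<and>
     (\<forall>s\<ge>0. \<forall>t\<ge>0. \<forall>f. P (s + t) f = P s (P t f)) \<and>
     (\<forall>f. ((\<lambda>t. P t f) \<longlongrightarrow> f) (at_right 0))"

definition gen :: "(real \<Rightarrow> 'h \<Rightarrow> 'h::real_normed_vector) \<Rightarrow> ('h \<times> 'h) set" where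
  "gen P = {(f, g). ((\<lambda>t. (P t f - f) /\<^sub>R t) \<longlongrightarrow> g) (at_right 0)}"

lemma contr_semigroupD:
  assumes "contr_semigroup P"
  shows "\<And>t. 0 \<le> t \<Longrightarrow> linear (P t)" "\<And>t f. 0 \<le> t \<Longrightarrow> norm (P t f) \<le> norm f" "P 0 f = f"
    "\<And>s t. 0 \<le> s \<Longrightarrow> 0 \<le> t \<Longrightarrow> P (s + t) f = P s (P t f)" "((\<lambda>t. P t f) \<longlongrightarrow> f) (at_right 0)"
  using assms by (auto simp: contr_semigroup_def)

lemma gen_diff:
  assumes "contr_semigroup P" "(f, g) \<in> gen P" "(f', g') \<in> gen P"
  shows "(f - f', g - g') \<in> gen P"
proof -
  have "((\<lambda>t. (P t f - f) /\<^sub>R t - (P t f' - f') /\<^sub>R t) \<longlongrightarrow> g - g') (at_right 0)"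
    using assms(2,3) by (intro tendsto_diff) (auto simp: gen_def)
  moreover have "eventually (\<lambda>t. (P t f - f) /\<^sub>R t - (P t f' - f') /\<^sub>R t
      = (P t (f - f') - (f - f')) /\<^sub>R t) (at_right 0)"
    using eventually_at_right_less[of 0]
    by eventually_elim (simp add: linear_diff[OF contr_semigroupD(1)[OF assms(1)]] algebra_simps)
  ultimately have "((\<lambda>t. (P t (f - f') - (f - f')) /\<^sub>R t) \<longlongrightarrow> g - g') (at_right 0)"
    by (rule Lim_transform_eventually)
  then show ?thesis by (simp add: gen_def)
qed

lemma gen_dissipative:
  fixes P :: "real \<Rightarrow> 'h \<Rightarrow> 'h::real_inner"
  assumes "contr_semigroup P" "(f, g) \<in> gen P"
  shows "inner f g \<le> 0"
proof (rule tendsto_upperbound)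
  show "((\<lambda>t. inner f ((P t f - f) /\<^sub>R t)) \<longlongrightarrow> inner f g) (at_right 0)"
    using assms(2) by (intro tendsto_intros) (auto simp: gen_def)
  show "eventually (\<lambda>t. inner f ((P t f - f) /\<^sub>R t) \<le> 0) (at_right 0)"
    using eventually_at_right_less[of 0]
  proof eventually_elim
    case (elim t)
    have "inner f (P t f) \<le> norm f * norm (P t f)" by (rule norm_cauchy_schwarz)
    also have "\<dots> \<le> norm f * norm f" using contr_semigroupD(2)[OF assms(1)] elim by (intro mult_left_mono) auto
    finally have "inner f (P t f - f) \<le> 0" by (simp add: inner_diff_right power2_norm_eq_inner[symmetric] power2_eq_square)
    then show ?case using elim by (simp add: mult_nonneg_nonpos)
  qed
qed simp

text \<open>The generator is defined by a right derivative at \<open>0\<close>. For a two-sided derivative at \<open>r\<close> the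
  difference quotient is written as the image, under the contraction belonging to the smaller of
  the two times, of an expression in the increment \<open>h\<close> alone; on the left the additional term
  \<open>P\<^sub>h g - g\<close> enters, which tends to \<open>0\<close> by strong continuity.\<close>
lemma semigroup_derivative:
  fixes P :: "real \<Rightarrow> 'h \<Rightarrow> 'h::real_normed_vector"
  assumes P: "contr_semigroup P" and fg: "(f, g) \<in> gen P" and "0 \<le> r"
  shows "((\<lambda>t. P t f) has_vector_derivative P r g) (at r within {0..})"
proof -
  \<comment> \<open>The error per unit of time, which serves for increments of either sign.\<close>
  define \<epsilon> where "\<epsilon> h = norm ((P h f - f) /\<^sub>R h - g) + norm (P h g - g)" for h
  have "(\<epsilon> \<longlongrightarrow> norm (g - g) + norm (g - g)) (at_right 0)"
    unfolding \<epsilon>_def using fg contr_semigroupD(5)[OF P] by (intro tendsto_intros) (auto simp: gen_def)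
  then have \<epsilon>: "(\<epsilon> \<longlongrightarrow> 0) (at_right 0)" by simp
  have step: "norm (P h f - f - h *\<^sub>R g) + h * norm (P h g - g) = h * \<epsilon> h" if "h > 0" for h
  proof -
    have "P h f - f - h *\<^sub>R g = h *\<^sub>R ((P h f - f) /\<^sub>R h - g)"
      using that by (simp add: algebra_simps)
    then show ?thesis using that by (simp add: \<epsilon>_def distrib_left)
  qed
  have bound: "norm (P s f - P r f - (s - r) *\<^sub>R P r g) \<le> \<bar>s - r\<bar> * \<epsilon> \<bar>s - r\<bar>"
    if "0 \<le> s" "s \<noteq> r" for s
  proof (cases "r < s")
    case True
    define h where "h = s - r"
    have h: "h > 0" "s = r + h" using True by (auto simp: h_def)
    have "P s f - P r f - (s - r) *\<^sub>R P r g = P r (P h f - f - h *\<^sub>R g)"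
      using h \<open>0 \<le> r\<close> contr_semigroupD(4)[OF P, of r h f]
      by (simp add: linear_diff[OF contr_semigroupD(1)[OF P]] linear_cmul[OF contr_semigroupD(1)[OF P]])
    then have "norm (P s f - P r f - (s - r) *\<^sub>R P r g) \<le> norm (P h f - f - h *\<^sub>R g)"
      using contr_semigroupD(2)[OF P \<open>0 \<le> r\<close>] by simp
    also have "\<dots> \<le> h * \<epsilon> h" using step[OF h(1)] h(1) by (simp add: le_add_same_cancel1 flip: step)
    finally show ?thesis using h by simp
  next
    case False
    define h where "h = r - s"
    have h: "h > 0" "r = s + h" using False that by (auto simp: h_def)
    have "P s f - P r f - (s - r) *\<^sub>R P r g = P s (h *\<^sub>R (P h g - g) - (P h f - f - h *\<^sub>R g))"
      using h \<open>0 \<le> s\<close> contr_semigroupD(4)[OF P, of s h f] contr_semigroupD(4)[OF P, of s h g]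
      by (simp add: linear_diff[OF contr_semigroupD(1)[OF P]] linear_add[OF contr_semigroupD(1)[OF P]]
          linear_cmul[OF contr_semigroupD(1)[OF P]] algebra_simps)
    then have "norm (P s f - P r f - (s - r) *\<^sub>R P r g) \<le> norm (h *\<^sub>R (P h g - g) - (P h f - f - h *\<^sub>R g))"
      using contr_semigroupD(2)[OF P \<open>0 \<le> s\<close>] by simp
    also have "\<dots> \<le> norm (h *\<^sub>R (P h g - g)) + norm (P h f - f - h *\<^sub>R g)" by (rule norm_triangle_ineq4)
    also have "\<dots> = h * \<epsilon> h" using step[OF h(1)] h(1) by simp
    finally show ?thesis using h by simp
  qed
  have lim: "((\<lambda>s. \<epsilon> \<bar>s - r\<bar>) \<longlongrightarrow> 0) (at r within {0..})"
  proof (rule filterlim_compose[OF \<epsilon>])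
    have "((\<lambda>s. \<bar>s - r\<bar>) \<longlongrightarrow> \<bar>r - r\<bar>) (at r within {0..})" by (intro tendsto_intros)
    then show "filterlim (\<lambda>s. \<bar>s - r\<bar>) (at_right 0) (at r within {0..})"
      by (auto simp: filterlim_at eventually_at_filter)
  qed
  have "((\<lambda>s. norm ((P s f - (P r f + (s - r) *\<^sub>R P r g)) /\<^sub>R norm (s - r))) \<longlongrightarrow> 0) (at r within {0..})"
  proof (rule tendsto_sandwich[OF _ _ tendsto_const lim])
    have "norm ((P s f - (P r f + (s - r) *\<^sub>R P r g)) /\<^sub>R norm (s - r)) \<le> \<epsilon> \<bar>s - r\<bar>"
      if "0 \<le> s" "s \<noteq> r" for s
    proof -
      have "norm (P s f - P r f - (s - r) *\<^sub>R P r g) / \<bar>s - r\<bar> \<le> \<epsilon> \<bar>s - r\<bar>"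
        using bound[OF that] that(2) by (simp add: pos_divide_le_eq mult.commute)
      then show ?thesis by (simp add: diff_diff_eq[symmetric] divide_inverse mult.commute)
    qed
    then show "eventually (\<lambda>s. norm ((P s f - (P r f + (s - r) *\<^sub>R P r g)) /\<^sub>R norm (s - r)) \<le> \<epsilon> \<bar>s - r\<bar>)
        (at r within {0..})"
      by (auto simp: eventually_at_filter)
  qed simp
  then have "((\<lambda>s. (P s f - (P r f + (s - r) *\<^sub>R P r g)) /\<^sub>R norm (s - r)) \<longlongrightarrow> 0) (at r within {0..})"
    by (rule tendsto_norm_zero_cancel)
  then show ?thesis
    by (simp add: has_vector_derivative_def has_derivative_within bounded_linear_scaleR_left inverse_eq_divide)
qed

lemma semigroup_domain_invariant:
  assumes P: "contr_semigroup P" and fg: "(f, g) \<in> gen P" and "0 \<le> r"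
  shows "(P r f, P r g) \<in> gen P"
proof -
  have 1: "((\<lambda>t. norm ((P t f - f) /\<^sub>R t - g)) \<longlongrightarrow> 0) (at_right 0)"
    using fg by (simp add: gen_def tendsto_norm_zero_iff LIM_zero_iff)
  have "((\<lambda>t. norm ((P t (P r f) - P r f) /\<^sub>R t - P r g)) \<longlongrightarrow> 0) (at_right 0)"
  proof (rule tendsto_sandwich[OF _ _ tendsto_const 1])
    show "eventually (\<lambda>t. norm ((P t (P r f) - P r f) /\<^sub>R t - P r g) \<le> norm ((P t f - f) /\<^sub>R t - g)) (at_right 0)"
      using eventually_at_right_less[of 0]
    proof eventually_elim
      case (elim t)
      have "P t (P r f) = P r (P t f)"
        using contr_semigroupD(4)[OF P, of t r f] contr_semigroupD(4)[OF P, of r t f] elim \<open>0 \<le> r\<close> by (simp add: add.commute)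
      then have "(P t (P r f) - P r f) /\<^sub>R t - P r g = P r ((P t f - f) /\<^sub>R t - g)"
        using \<open>0 \<le> r\<close> by (simp add: linear_diff[OF contr_semigroupD(1)[OF P]] linear_cmul[OF contr_semigroupD(1)[OF P]])
      then show ?case using contr_semigroupD(2)[OF P \<open>0 \<le> r\<close>] by simp
    qed
  qed simp
  then show ?thesis
    by (simp add: gen_def tendsto_norm_zero_iff LIM_zero_iff)
qed

text \<open>The difference \<open>u\<close> of two orbits stays in the domain, where the generator is dissipative, so
  \<open>\<parallel>u\<parallel>\<^sup>2\<close> is nonincreasing; it vanishes at time \<open>0\<close>.\<close>
lemma semigroup_unique:
  fixes P Q :: "real \<Rightarrow> 'h \<Rightarrow> 'h::real_inner"
  assumes P: "contr_semigroup P" and Q: "contr_semigroup Q" and eq: "gen P = gen Q" and fg: "(f, g) \<in> gen P" and "0 \<le> t"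
  shows "P t f = Q t f"
proof -
  let ?u = "\<lambda>t. P t f - Q t f"
  let ?\<phi> = "\<lambda>t. inner (?u t) (?u t)"
  have "?\<phi> t \<le> ?\<phi> 0"
  proof (cases "t = 0")
    case False
    then have "0 < t" using \<open>0 \<le> t\<close> by simp
    have u: "(?u has_vector_derivative (P s g - Q s g)) (at s within {0..})" if "0 \<le> s" for s
      using semigroup_derivative[OF P fg that] semigroup_derivative[OF Q _ that, of f g] fg eq
      by (intro has_vector_derivative_diff) auto
    have d: "(?\<phi> has_field_derivative 2 * inner (?u s) (P s g - Q s g)) (at s within {0..})"
      if "0 \<le> s" for s
    proof -
      have "(?\<phi> has_derivative (\<lambda>h. inner (?u s) (h *\<^sub>R (P s g - Q s g)) + inner (h *\<^sub>R (P s g - Q s g)) (?u s))) (at s within {0..})"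
        using u[OF that] unfolding has_vector_derivative_def by (intro has_derivative_inner)
      then show ?thesis
        unfolding has_field_derivative_def
        by (rule has_derivative_eq_rhs) (auto simp: inner_commute algebra_simps)
    qed
    show ?thesis
    proof (rule DERIV_nonpos_imp_decreasing_open[OF \<open>0 \<le> t\<close>])
      fix s assume s: "0 < s" "s < t"
      have "(?\<phi> has_field_derivative 2 * inner (?u s) (P s g - Q s g)) (at s)"
        using d[of s] s at_within_interior[of s "{0..}"] by simp
      moreover have "(?u s, P s g - Q s g) \<in> gen P"
        using s fg eq by (intro gen_diff[OF P] semigroup_domain_invariant[OF P])
          (auto intro!: semigroup_domain_invariant[OF Q])
      then have "2 * inner (?u s) (P s g - Q s g) \<le> 0"
        using gen_dissipative[OF P] by fastforce
      ultimately show "\<exists>y. DERIV ?\<phi> s :> y \<and> y \<le> 0" by blast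
    next
      have "continuous_on {0..} ?\<phi>"
        by (rule DERIV_continuous_on[OF d]) simp
      then show "continuous_on {0..t} ?\<phi>" by (rule continuous_on_subset) simp
    qed
  qed simp
  then show ?thesis by (simp add: contr_semigroupD(3)[OF P] contr_semigroupD(3)[OF Q] flip: power2_norm_eq_inner)
qed

section \<open>The Hille--Yosida theorem for dissipative operators\<close>

text \<open>A densely defined, maximal dissipative operator on a Hilbert space, given by its graph.\<close>
locale m_dissipative =
  fixes A :: "('h::{real_inner, banach, perfect_space} \<times> 'h) set"
  assumes sub: "subspace A"
    and diss: "(f, g) \<in> A \<Longrightarrow> inner f g \<le> 0"
    and range: "\<alpha> > 0 \<Longrightarrow> \<exists>f g. (f, g) \<in> A \<and> \<alpha> *\<^sub>R f - g = h"
    and dense: "closure (fst ` A) = UNIV"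
begin

lemma resolvent_unique:
  assumes "\<alpha> > 0" "(f, g) \<in> A" "(f', g') \<in> A" "\<alpha> *\<^sub>R f - g = \<alpha> *\<^sub>R f' - g'"
  shows "f = f'"
proof -
  have "(f - f', g - g') \<in> A" using subspace_diff[OF sub assms(2,3)] by simp
  then have "inner (f - f') (g - g') \<le> 0" by (rule diss)
  moreover have "g - g' = \<alpha> *\<^sub>R (f - f')" using assms(4) by (simp add: algebra_simps)
  ultimately have "\<alpha> * inner (f - f') (f - f') \<le> 0" by simp
  then have "inner (f - f') (f - f') \<le> 0" using assms(1) by (simp add: mult_le_0_iff)
  then show ?thesis by (simp flip: power2_norm_eq_inner)
qed

definition resolvent :: "real \<Rightarrow> 'h \<Rightarrow> 'h" where
  "resolvent \<alpha> h = (THE f. \<exists>g. (f, g) \<in> A \<and> \<alpha> *\<^sub>R f - g = h)"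

lemma resolventI:
  assumes "\<alpha> > 0" "(f, g) \<in> A" "\<alpha> *\<^sub>R f - g = h"
  shows "resolvent \<alpha> h = f"
  unfolding resolvent_def
  by (rule the_equality) (use assms resolvent_unique in blast)+

lemma resolvent_in:
  assumes "\<alpha> > 0"
  shows "(resolvent \<alpha> h, \<alpha> *\<^sub>R resolvent \<alpha> h - h) \<in> A"
proof -
  obtain f g where fg: "(f, g) \<in> A" "\<alpha> *\<^sub>R f - g = h" using range[OF assms] by blast
  have "resolvent \<alpha> h = f" using assms fg by (rule resolventI)
  moreover have "\<alpha> *\<^sub>R f - h = g" using fg(2) by (simp add: algebra_simps)
  ultimately show ?thesis using fg(1) by simp
qed

lemma resolvent_add:
  assumes "\<alpha> > 0" shows "resolvent \<alpha> (h + k) = resolvent \<alpha> h + resolvent \<alpha> k"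
  by (rule resolventI[OF assms subspace_add[OF sub resolvent_in[OF assms] resolvent_in[OF assms],
        unfolded add_Pair]]) (simp add: algebra_simps)

lemma resolvent_scale:
  assumes "\<alpha> > 0" shows "resolvent \<alpha> (c *\<^sub>R h) = c *\<^sub>R resolvent \<alpha> h"
  by (rule resolventI[OF assms subspace_scale[OF sub resolvent_in[OF assms],
        unfolded scaleR_Pair]]) (simp add: algebra_simps)

lemma norm_resolvent:
  assumes "\<alpha> > 0" shows "\<alpha> * norm (resolvent \<alpha> h) \<le> norm h"
proof (cases "resolvent \<alpha> h = 0")
  case False
  let ?f = "resolvent \<alpha> h"
  have "inner ?f (\<alpha> *\<^sub>R ?f - h) \<le> 0" using resolvent_in[OF assms] by (rule diss)
  then have "\<alpha> * (norm ?f * norm ?f) \<le> inner ?f h"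
    by (simp add: inner_diff_right flip: power2_norm_eq_inner power2_eq_square)
  also have "\<dots> \<le> norm ?f * norm h" by (rule norm_cauchy_schwarz)
  finally have "norm ?f * (\<alpha> * norm ?f) \<le> norm ?f * norm h" by (simp add: algebra_simps)
  then show ?thesis using False by simp
qed simp

text \<open>The resolvent identity expresses the composition through the difference of the two resolvents,
  divided by \<open>\<alpha> - \<mu>\<close>, and this is symmetric.\<close>
lemma resolvent_commute:
  assumes "\<alpha> > 0" "\<mu> > 0"
  shows "resolvent \<alpha> (resolvent \<mu> h) = resolvent \<mu> (resolvent \<alpha> h)"
proof (cases "\<alpha> = \<mu>")
  case False
  have *: "resolvent \<mu> h = resolvent \<alpha> h + (\<alpha> - \<mu>) *\<^sub>R resolvent \<alpha> (resolvent \<mu> h)"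
    if "\<alpha> > 0" "\<mu> > 0" for \<alpha> \<mu>
  proof -
    let ?f = "resolvent \<mu> h"
    have "resolvent \<alpha> (h + (\<alpha> - \<mu>) *\<^sub>R ?f) = ?f"
      by (rule resolventI[OF that(1) resolvent_in[OF that(2)]]) (simp add: algebra_simps)
    then show ?thesis using that by (simp add: resolvent_add resolvent_scale)
  qed
  have "(\<alpha> - \<mu>) *\<^sub>R resolvent \<alpha> (resolvent \<mu> h) = (\<alpha> - \<mu>) *\<^sub>R resolvent \<mu> (resolvent \<alpha> h)"
  proof -
    have "(\<alpha> - \<mu>) *\<^sub>R resolvent \<alpha> (resolvent \<mu> h) = resolvent \<mu> h - resolvent \<alpha> h"
      using *[OF assms] by (metis add_diff_cancel_left')
    moreover have "(\<mu> - \<alpha>) *\<^sub>R resolvent \<mu> (resolvent \<alpha> h) = resolvent \<alpha> h - resolvent \<mu> h"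
      using *[OF assms(2,1)] by (metis add_diff_cancel_left')
    ultimately show ?thesis by (metis minus_diff_eq scaleR_minus_left)
  qed
  then show ?thesis using False by simp
qed simp

text \<open>The resolvent scaled to a contraction; it approximates the identity as \<open>\<alpha> \<rightarrow> \<infinity>\<close>.\<close>
definition J :: "real \<Rightarrow> 'h endo" where
  "J \<alpha> = Endo (Blinfun (\<lambda>h. \<alpha> *\<^sub>R resolvent \<alpha> h))"

lemma app_J:
  assumes "\<alpha> > 0" shows "app (J \<alpha>) h = \<alpha> *\<^sub>R resolvent \<alpha> h"
  unfolding J_def
proof (rule app_Endo_Blinfun)
  show "bounded_linear (\<lambda>h. \<alpha> *\<^sub>R resolvent \<alpha> h)"
    by (rule bounded_linear_intro[where K = 1])
       (use assms norm_resolvent in \<open>auto simp: resolvent_add resolvent_scale algebra_simps\<close>)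
qed

lemma norm_J:
  assumes "\<alpha> > 0" shows "norm (J \<alpha>) \<le> 1"
proof -
  have "norm (blinfun_of_endo (J \<alpha>)) \<le> 1"
    by (rule norm_blinfun_bound) (use norm_resolvent assms in \<open>auto simp: app_J simp flip: app.rep_eq\<close>)
  then show ?thesis by (simp add: norm_endo.rep_eq)
qed

lemma J_commute:
  assumes "\<alpha> > 0" "\<mu> > 0" shows "J \<alpha> * J \<mu> = J \<mu> * J \<alpha>"
  by (rule endo_eqI)
     (use assms resolvent_commute in \<open>simp add: app_J resolvent_scale mult.commute\<close>)

text \<open>The Yosida approximation, a bounded operator: on the domain it is \<open>J \<alpha>\<close> composed with the
  operator itself.\<close>
definition Y :: "real \<Rightarrow> 'h endo" where
  "Y \<alpha> = \<alpha> *\<^sub>R (J \<alpha> - 1)"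

lemma Y_commute:
  assumes "\<alpha> > 0" "\<mu> > 0" shows "Y \<alpha> * Y \<mu> = Y \<mu> * Y \<alpha>"
  using J_commute[OF assms] by (simp add: Y_def algebra_simps)

lemma Y_on_domain:
  assumes "\<alpha> > 0" "(f, g) \<in> A" shows "app (Y \<alpha>) f = app (J \<alpha>) g"
proof -
  have "resolvent \<alpha> (\<alpha> *\<^sub>R f - g) = f" using assms by (rule resolventI) simp
  moreover have "\<alpha> *\<^sub>R f - g = \<alpha> *\<^sub>R f + (-1) *\<^sub>R g" by simp
  ultimately have "\<alpha> *\<^sub>R resolvent \<alpha> f - resolvent \<alpha> g = f"
    using assms(1) by (simp only: resolvent_add resolvent_scale) simp
  then have "\<alpha> *\<^sub>R resolvent \<alpha> f - f = resolvent \<alpha> g" by (simp add: algebra_simps)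
  then show ?thesis
    using assms(1) by (simp add: Y_def app.diff_left app.scaleR_left app_J)
qed

text \<open>Splitting off the scalar factor shows that \<open>e\<^bsup>tY\<^esup>\<close> is an average of powers of the contraction
  \<open>J \<alpha>\<close>, with Poisson weights. Contractivity follows at once, and so will the order bounds.\<close>
lemma exp_Y: "exp (t *\<^sub>R Y \<alpha>) = exp (- (t * \<alpha>)) *\<^sub>R exp ((t * \<alpha>) *\<^sub>R J \<alpha>)"
proof -
  have "exp (t *\<^sub>R Y \<alpha>) = exp ((t * \<alpha>) *\<^sub>R J \<alpha> + (of_real (- (t * \<alpha>)) :: 'h endo))"
    by (simp add: Y_def of_real_def algebra_simps)
  also have "\<dots> = exp ((t * \<alpha>) *\<^sub>R J \<alpha>) * exp (of_real (- (t * \<alpha>)))"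
    by (rule exp_add_commuting) (simp add: of_real_def)
  finally show ?thesis by (simp only: exp_of_real) (simp add: of_real_def)
qed

lemma norm_exp_Y:
  assumes "\<alpha> > 0" "t \<ge> 0" shows "norm (exp (t *\<^sub>R Y \<alpha>)) \<le> 1"
proof -
  have "norm (exp ((t * \<alpha>) *\<^sub>R J \<alpha>)) \<le> exp (norm ((t * \<alpha>) *\<^sub>R J \<alpha>))" by (rule norm_exp)
  also have "\<dots> \<le> exp (t * \<alpha>)"
    using assms norm_J[OF assms(1)] mult_left_mono[of "norm (J \<alpha>)" 1 "t * \<alpha>"] by simp
  finally have "exp (- (t * \<alpha>)) * norm (exp ((t * \<alpha>) *\<^sub>R J \<alpha>)) \<le> exp (- (t * \<alpha>)) * exp (t * \<alpha>)"
    by (rule mult_left_mono) simp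
  then show ?thesis unfolding exp_Y by (simp flip: exp_add)
qed

lemma domain_approx:
  assumes "\<epsilon> > 0" obtains f g where "(f, g) \<in> A" "norm (f - h) < \<epsilon>"
proof -
  have "h \<in> closure (fst ` A)" by (simp add: dense)
  then obtain p where "p \<in> A" "dist (fst p) h < \<epsilon>" using assms by (auto simp: closure_approachable)
  then show ?thesis using that[of "fst p" "snd p"] by (simp add: dist_norm)
qed

text \<open>On the domain the error is the resolvent of the image, of size \<open>O(1 / n)\<close>; density and
  contractivity do the rest.\<close>
lemma J_tendsto: "(\<lambda>n. app (J (real (Suc n))) h) \<longlonglongrightarrow> h"
proof (rule LIMSEQ_I)
  fix \<epsilon> :: real assume "\<epsilon> > 0"
  obtain f g where fg: "(f, g) \<in> A" "norm (f - h) < \<epsilon> / 3"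
      by (rule domain_approx[of "\<epsilon> / 3"]) (use \<open>\<epsilon> > 0\<close> in auto)
  obtain N where N: "real N > 3 * norm g / \<epsilon>" using reals_Archimedean2 by blast
  have "norm (app (J (real (Suc n))) h - h) < \<epsilon>" if "n \<ge> N" for n
  proof -
    let ?J = "J (real (Suc n))" and ?\<alpha> = "real (Suc n)"
    have "app (Y ?\<alpha>) f = app ?J g" by (rule Y_on_domain[OF _ fg(1)]) simp
    then have "?\<alpha> *\<^sub>R (app ?J f - f) = app ?J g"
      by (simp add: Y_def app.diff_left app.scaleR_left)
    then have "?\<alpha> * norm (app ?J f - f) = norm (app ?J g)"
      by (metis norm_scaleR abs_of_nat)
    also have "\<dots> \<le> norm g" by (intro norm_app_contraction norm_J) simp
    also have "\<dots> < \<epsilon> / 3 * ?\<alpha>"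
    proof -
      have "3 * norm g / \<epsilon> < ?\<alpha>" using N that by linarith
      then show ?thesis using \<open>\<epsilon> > 0\<close> by (simp add: field_simps)
    qed
    finally have 1: "norm (app ?J f - f) < \<epsilon> / 3" by (simp add: mult.commute)
    have 2: "norm (app ?J (h - f)) \<le> norm (h - f)" by (intro norm_app_contraction norm_J) simp
    have "app ?J h - h = app ?J (h - f) + (app ?J f - f) + (f - h)" by (simp add: app.diff_right)
    then have "norm (app ?J h - h) \<le> norm (app ?J (h - f)) + norm (app ?J f - f) + norm (f - h)"
      by (metis norm_triangle_ineq norm_triangle_mono order_refl)
    then show ?thesis using 1 2 fg(2) by (simp add: norm_minus_commute)
  qed
  then show "\<exists>N. \<forall>n\<ge>N. norm (app (J (real (Suc n))) h - h) < \<epsilon>" by blast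
qed

abbreviation E :: "nat \<Rightarrow> real \<Rightarrow> 'h endo" where
  "E n t \<equiv> exp (t *\<^sub>R Y (real (Suc n)))"

lemma norm_E: "t \<ge> 0 \<Longrightarrow> norm (app (E n t) f) \<le> norm f"
  by (intro norm_app_contraction norm_exp_Y) auto

lemma Y_tendsto:
  assumes "(f, g) \<in> A" shows "(\<lambda>n. app (Y (real (Suc n))) f) \<longlonglongrightarrow> g"
  using J_tendsto[of g] Y_on_domain[OF _ assms] by simp

text \<open>The approximations commute, so on the domain the distance of two approximate orbits is at most
  \<open>t\<close> times the distance of the approximate generators.\<close>
lemma E_convergent:
  assumes "t \<ge> 0" shows "convergent (\<lambda>n. app (E n t) h)"
proof -
  have "Cauchy (\<lambda>n. app (E n t) h)"
  proof (rule CauchyI)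
    fix \<epsilon> :: real assume "\<epsilon> > 0"
    obtain f g where fg: "(f, g) \<in> A" "norm (f - h) < \<epsilon> / 4"
      by (rule domain_approx[of "\<epsilon> / 4"]) (use \<open>\<epsilon> > 0\<close> in auto)
    have "Cauchy (\<lambda>n. app (Y (real (Suc n))) f)"
      using Y_tendsto[OF fg(1)] by (rule LIMSEQ_imp_Cauchy)
    then obtain N where N: "\<And>i j. i \<ge> N \<Longrightarrow> j \<ge> N \<Longrightarrow>
        norm (app (Y (real (Suc i))) f - app (Y (real (Suc j))) f) < \<epsilon> / (4 * (t + 1))"
      using \<open>\<epsilon> > 0\<close> assms by (metis CauchyD add_nonneg_pos divide_pos_pos mult_pos_pos zero_less_numeral zero_less_one)
    have "norm (app (E i t) h - app (E j t) h) < \<epsilon>" if "i \<ge> N" "j \<ge> N" for i j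
    proof -
      have "norm (app (E i t) f - app (E j t) f)
          \<le> t * norm (app (Y (real (Suc i))) f - app (Y (real (Suc j))) f)"
        by (rule exp_difference_le) (use assms in \<open>auto intro: Y_commute norm_exp_Y\<close>)
      also have "\<dots> \<le> t * (\<epsilon> / (4 * (t + 1)))"
        using N[OF that] assms by (intro mult_left_mono) auto
      also have "\<dots> \<le> \<epsilon> / 4" using assms \<open>\<epsilon> > 0\<close> by (simp add: field_simps)
      finally have 1: "norm (app (E i t) f - app (E j t) f) \<le> \<epsilon> / 4" .
      have 2: "norm (app (E i t) (h - f)) \<le> norm (h - f)" "norm (app (E j t) (h - f)) \<le> norm (h - f)"
        using assms by (rule norm_E)+
      have "app (E i t) h - app (E j t) h
          = app (E i t) (h - f) - app (E j t) (h - f) + (app (E i t) f - app (E j t) f)"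
        by (simp add: app.diff_right)
      then have "norm (app (E i t) h - app (E j t) h)
          \<le> norm (app (E i t) (h - f)) + norm (app (E j t) (h - f)) + norm (app (E i t) f - app (E j t) f)"
        by (metis norm_triangle_ineq4 norm_triangle_mono order_refl)
      then show ?thesis using 1 2 fg(2) norm_minus_commute[of h f] \<open>\<epsilon> > 0\<close> by linarith
    qed
    then show "\<exists>N. \<forall>i\<ge>N. \<forall>j\<ge>N. norm (app (E i t) h - app (E j t) h) < \<epsilon>" by blast
  qed
  then show ?thesis by (simp add: Cauchy_convergent_iff)
qed

definition semigroup :: "real \<Rightarrow> 'h \<Rightarrow> 'h" where
  "semigroup t h = lim (\<lambda>n. app (E n t) h)"

lemma E_tendsto: "t \<ge> 0 \<Longrightarrow> (\<lambda>n. app (E n t) h) \<longlonglongrightarrow> semigroup t h"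
  unfolding semigroup_def using E_convergent by (simp add: convergent_LIMSEQ_iff)

lemma norm_semigroup: 
  assumes "t \<ge> 0" shows "norm (semigroup t h) \<le> norm h"
  by (rule LIMSEQ_le_const2[OF tendsto_norm[OF E_tendsto[OF assms]]]) (use norm_E[OF assms] in blast)

lemma linear_semigroup:
  assumes "t \<ge> 0" shows "linear (semigroup t)"
proof (rule linearI)
  fix f g :: 'h and c :: real
  have "(\<lambda>n. app (E n t) f + app (E n t) g) \<longlonglongrightarrow> semigroup t f + semigroup t g"
    by (intro tendsto_add E_tendsto assms)
  with E_tendsto[OF assms, of "f + g"] show "semigroup t (f + g) = semigroup t f + semigroup t g"
    by (simp add: app.add_right LIMSEQ_unique)
  have "(\<lambda>n. c *\<^sub>R app (E n t) f) \<longlonglongrightarrow> c *\<^sub>R semigroup t f"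
    by (intro tendsto_scaleR tendsto_const E_tendsto assms)
  with E_tendsto[OF assms, of "c *\<^sub>R f"] show "semigroup t (c *\<^sub>R f) = c *\<^sub>R semigroup t f"
    by (simp add: app.scaleR_right LIMSEQ_unique)
qed

lemma semigroup_add:
  assumes "s \<ge> 0" "t \<ge> 0" shows "semigroup (s + t) h = semigroup s (semigroup t h)"
proof (rule LIMSEQ_unique[OF E_tendsto])
  have E: "app (E n (s + t)) h = app (E n s) (app (E n t) h)" for n
    by (simp add: scaleR_add_left exp_add_commuting)
  have 1: "(\<lambda>n. app (E n s) (app (E n t) h - semigroup t h)) \<longlonglongrightarrow> 0"
  proof (rule Lim_null_comparison)
    show "\<forall>\<^sub>F n in sequentially. norm (app (E n s) (app (E n t) h - semigroup t h))
        \<le> norm (app (E n t) h - semigroup t h)"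
      using norm_E[OF assms(1)] by simp
    show "(\<lambda>n. norm (app (E n t) h - semigroup t h)) \<longlonglongrightarrow> 0"
      using E_tendsto[OF assms(2)] by (simp add: tendsto_norm_zero_iff LIM_zero_iff)
  qed
  have "(\<lambda>n. app (E n s) (app (E n t) h - semigroup t h) + app (E n s) (semigroup t h))
      \<longlonglongrightarrow> 0 + semigroup s (semigroup t h)"
    by (intro tendsto_add 1 E_tendsto assms)
  then show "(\<lambda>n. app (E n (s + t)) h) \<longlonglongrightarrow> semigroup s (semigroup t h)"
    unfolding E by (simp add: app.diff_right)
qed (use assms in simp)

lemma semigroup_increment:
  assumes "t \<ge> 0" "(f, g) \<in> A" shows "norm (semigroup t f - f) \<le> t * norm g"
proof (rule LIMSEQ_le)
  show "(\<lambda>n. norm (app (E n t) f - f)) \<longlonglongrightarrow> norm (semigroup t f - f)"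
    by (intro tendsto_intros E_tendsto assms)
  show "(\<lambda>n. t * norm (app (Y (real (Suc n))) f)) \<longlonglongrightarrow> t * norm g"
    by (intro tendsto_intros Y_tendsto assms)
  have "norm (app (E n t) f - f) \<le> t * norm (app (Y (real (Suc n))) f)" for n
    using exp_difference_le[of t "Y (real (Suc n))" 0 f] assms(1) norm_exp_Y by (simp add: app.zero_left)
  then show "\<exists>N. \<forall>n\<ge>N. norm (app (E n t) f - f) \<le> t * norm (app (Y (real (Suc n))) f)" by blast
qed

lemma semigroup_increment_general:
  assumes "t \<ge> 0" "(f, g) \<in> A" shows "norm (semigroup t h - h) \<le> 2 * norm (h - f) + t * norm g"
proof -
  have "semigroup t h - h = semigroup t (h - f) - (h - f) + (semigroup t f - f)"
    by (simp add: linear_diff[OF linear_semigroup[OF assms(1)]])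
  then have "norm (semigroup t h - h) \<le> norm (semigroup t (h - f)) + norm (h - f) + norm (semigroup t f - f)"
    by (metis norm_triangle_ineq4 norm_triangle_mono order_refl)
  then show ?thesis
    using norm_semigroup[OF assms(1), of "h - f"] semigroup_increment[OF assms] by simp
qed

text \<open>The vector \<open>f'\<close> is an approximation of \<open>g\<close> from the domain. It makes the oscillation of the
  approximate orbits of \<open>g\<close> small uniformly in the order of approximation, so that the limit can be
  taken before \<open>t\<close> tends to \<open>0\<close>.\<close>
lemma semigroup_taylor:
  assumes "t \<ge> 0" "(f, g) \<in> A" "(f', g') \<in> A"
  shows "norm (semigroup t f - f - t *\<^sub>R g) \<le> t * (2 * norm (g - f') + t * norm g')"
proof (rule LIMSEQ_le)
  let ?Y = "\<lambda>n. Y (real (Suc n))"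
  let ?B = "\<lambda>n. 2 * norm (app (?Y n) f - f') + t * norm (app (?Y n) f')"
  show "(\<lambda>n. norm (app (E n t) f - f - t *\<^sub>R app (?Y n) f)) \<longlonglongrightarrow> norm (semigroup t f - f - t *\<^sub>R g)"
    by (intro tendsto_intros E_tendsto Y_tendsto assms)
  show "(\<lambda>n. t * ?B n) \<longlonglongrightarrow> t * (2 * norm (g - f') + t * norm g')"
    by (intro tendsto_intros Y_tendsto assms)
  have "norm (app (E n t) f - f - t *\<^sub>R app (?Y n) f) \<le> t * ?B n" for n
  proof (rule exp_taylor_le[OF assms(1)])
    fix s assume s: "0 \<le> s" "s \<le> t"
    let ?h = "app (?Y n) f"
    have "norm (app (E n s) f' - f') \<le> s * norm (app (?Y n) f')"
      using exp_difference_le[of s "?Y n" 0 f'] s(1) norm_exp_Y by (simp add: app.zero_left)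
    also have "\<dots> \<le> t * norm (app (?Y n) f')" using s by (intro mult_right_mono) auto
    finally have 1: "norm (app (E n s) f' - f') \<le> t * norm (app (?Y n) f')" .
    have "app (E n s) ?h - ?h = app (E n s) (?h - f') - (?h - f') + (app (E n s) f' - f')"
      by (simp add: app.diff_right)
    then have "norm (app (E n s) ?h - ?h)
        \<le> norm (app (E n s) (?h - f')) + norm (?h - f') + norm (app (E n s) f' - f')"
      by (metis norm_triangle_ineq4 norm_triangle_mono order_refl)
    then show "norm (app (E n s) ?h - ?h) \<le> ?B n"
      using norm_E[OF s(1), of n "?h - f'"] 1 by linarith
  qed
  then show "\<exists>N. \<forall>n\<ge>N. norm (app (E n t) f - f - t *\<^sub>R app (?Y n) f) \<le> t * ?B n" by blast
qed

lemma small_linear_tendsto_zero: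
  fixes \<phi> :: "real \<Rightarrow> real"
  assumes "\<And>\<epsilon>. \<epsilon> > 0 \<Longrightarrow> \<exists>C. \<forall>t>0. \<bar>\<phi> t\<bar> \<le> \<epsilon> + t * C"
  shows "(\<phi> \<longlongrightarrow> 0) (at_right 0)"
proof (rule tendstoI)
  fix e :: real assume "e > 0"
  then obtain C where C: "\<And>t. t > 0 \<Longrightarrow> \<bar>\<phi> t\<bar> \<le> e / 2 + t * C"
    using assms[of "e / 2"] by auto
  have "((\<lambda>t. e / 2 + t * C) \<longlongrightarrow> e / 2 + 0 * C) (at_right 0)"
    by (intro tendsto_intros)
  then have "eventually (\<lambda>t. e / 2 + t * C < e) (at_right 0)"
    by (rule order_tendstoD(2)) (use \<open>e > 0\<close> in simp)
  then show "eventually (\<lambda>t. dist (\<phi> t) 0 < e) (at_right 0)"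
    using eventually_at_right_less[of 0]
    by eventually_elim (use C in force)
qed

lemma contr_semigroup_semigroup: "contr_semigroup semigroup"
  unfolding contr_semigroup_def
proof (intro conjI allI impI)
  fix h :: 'h
  have "(\<lambda>n. app (E n 0) h) \<longlonglongrightarrow> semigroup 0 h" by (rule E_tendsto) simp
  then show "semigroup 0 h = h" by (simp add: LIMSEQ_const_iff)
  have "((\<lambda>t. norm (semigroup t h - h)) \<longlongrightarrow> 0) (at_right 0)"
  proof (rule small_linear_tendsto_zero)
    fix \<epsilon> :: real assume "\<epsilon> > 0"
    obtain f g where fg: "(f, g) \<in> A" "norm (f - h) < \<epsilon> / 2"
      by (rule domain_approx[of "\<epsilon> / 2"]) (use \<open>\<epsilon> > 0\<close> in auto)
    have "\<bar>norm (semigroup t h - h)\<bar> \<le> \<epsilon> + t * norm g" if "t > 0" for t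
      using semigroup_increment_general[of t f g h] fg that norm_minus_commute[of f h] by simp
    then show "\<exists>C. \<forall>t>0. \<bar>norm (semigroup t h - h)\<bar> \<le> \<epsilon> + t * C" by blast
  qed
  then show "((\<lambda>t. semigroup t h) \<longlongrightarrow> h) (at_right 0)"
    by (simp add: tendsto_norm_zero_iff LIM_zero_iff)
qed (simp_all add: linear_semigroup norm_semigroup semigroup_add)

text \<open>The generator extends the given operator by the Taylor estimate. It cannot be a proper extension:
  \<open>1 - A\<close> is already onto, and the generator, being dissipative, is injective after subtraction from
  the identity.\<close>
theorem gen_semigroup: "gen semigroup = A"
proof
  have sub': "(f, g) \<in> gen semigroup" if fg: "(f, g) \<in> A" for f g
  proof -
    have "((\<lambda>t. norm ((semigroup t f - f) /\<^sub>R t - g)) \<longlongrightarrow> 0) (at_right 0)"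
    proof (rule small_linear_tendsto_zero)
      fix \<epsilon> :: real assume "\<epsilon> > 0"
      obtain f' g' where fg': "(f', g') \<in> A" "norm (f' - g) < \<epsilon> / 2"
      by (rule domain_approx[of "\<epsilon> / 2"]) (use \<open>\<epsilon> > 0\<close> in auto)
      have "\<bar>norm ((semigroup t f - f) /\<^sub>R t - g)\<bar> \<le> \<epsilon> + t * norm g'" if "t > 0" for t
      proof -
        have "t * norm ((semigroup t f - f) /\<^sub>R t - g) = norm (semigroup t f - f - t *\<^sub>R g)"
        proof -
          have "semigroup t f - f - t *\<^sub>R g = t *\<^sub>R ((semigroup t f - f) /\<^sub>R t - g)"
            using that by (simp add: algebra_simps)
          then show ?thesis using that by simp
        qed
        also have "\<dots> \<le> t * (2 * norm (g - f') + t * norm g')"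
          using that by (intro semigroup_taylor fg fg') simp
        finally have "norm ((semigroup t f - f) /\<^sub>R t - g) \<le> 2 * norm (g - f') + t * norm g'"
          using that by simp
        then show ?thesis using fg'(2) norm_minus_commute[of g f'] by simp
      qed
      then show "\<exists>C. \<forall>t>0. \<bar>norm ((semigroup t f - f) /\<^sub>R t - g)\<bar> \<le> \<epsilon> + t * C" by blast
    qed
    then show ?thesis by (simp add: gen_def tendsto_norm_zero_iff LIM_zero_iff)
  qed
  then show "A \<subseteq> gen semigroup" by auto
  show "gen semigroup \<subseteq> A"
  proof
    fix p assume "p \<in> gen semigroup"
    then obtain f g where p: "p = (f, g)" and fg: "(f, g) \<in> gen semigroup" by (cases p) auto
    obtain f' g' where A: "(f', g') \<in> A" "1 *\<^sub>R f' - g' = f - g" using range[of 1 "f - g"] by auto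
    have eq: "g - g' = f - f'" using A(2) by (simp add: algebra_simps)
    have "inner (f - f') (g - g') \<le> 0"
      by (rule gen_dissipative[OF contr_semigroup_semigroup gen_diff[OF contr_semigroup_semigroup fg sub'[OF A(1)]]])
    then have "f = f'" by (simp add: eq flip: power2_norm_eq_inner)
    then show "p \<in> A" using A eq p by simp
  qed
qed

end

section \<open>The closed form and the Laplacian\<close>

context weighted_graph
begin

text \<open>Multiplication by \<open>\<surd>m\<close> is an isometry of \<open>\<ell>\<^sup>2(X, m)\<close> onto the unweighted space, with inverse
  \<open>proj\<close>. Outside \<open>\<ell>\<^sup>2(X, m)\<close> the value of \<open>embed\<close> is arbitrary.\<close>
definition embed :: "('a \<Rightarrow> real) \<Rightarrow> 'a l2" where
  "embed f = Abs_l2 (\<lambda>x. f x * sqrt (m x))"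

definition proj :: "'a l2 \<Rightarrow> 'a \<Rightarrow> real" where
  "proj F x = coord F x / sqrt (m x)"

lemma m_pos [simp]: "0 < m x" "0 \<le> m x" "m x \<noteq> 0"
  using measure_pos[of x] by auto

lemma ell2_iff: "f \<in> ell2 m \<longleftrightarrow> (\<lambda>x. (f x * sqrt (m x))\<^sup>2) summable_on UNIV"
  by (simp add: ell2_def power_mult_distrib)

lemma coord_embed: "f \<in> ell2 m \<Longrightarrow> coord (embed f) x = f x * sqrt (m x)"
  by (simp add: embed_def ell2_iff Abs_l2_inverse)

lemma proj_ell2: "proj F \<in> ell2 m"
  by (simp add: ell2_iff proj_def)

lemma embed_proj [simp]: "embed (proj F) = F"
  by (simp add: embed_def proj_def coord_inverse)

lemma proj_embed: "f \<in> ell2 m \<Longrightarrow> proj (embed f) = f"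
  by (rule ext) (simp add: proj_def coord_embed)

lemma l2_eqI: "(\<And>x. coord F x = coord G x) \<Longrightarrow> F = G"
  by (metis coord_inject ext)

lemma ell2_add: "f \<in> ell2 m \<Longrightarrow> g \<in> ell2 m \<Longrightarrow> (\<lambda>x. f x + g x) \<in> ell2 m"
  unfolding ell2_iff using summable_square_add by (fastforce simp: distrib_right)

lemma ell2_scale: "f \<in> ell2 m \<Longrightarrow> (\<lambda>x. c * f x) \<in> ell2 m"
  unfolding ell2_iff using summable_square_scale by (fastforce simp: mult.assoc)

lemma ell2_diff: "f \<in> ell2 m \<Longrightarrow> g \<in> ell2 m \<Longrightarrow> (\<lambda>x. f x - g x) \<in> ell2 m"
  using ell2_add[of f "\<lambda>x. -1 * g x"] ell2_scale[of g "-1"] by simp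

lemma ell2_minus: "f \<in> ell2 m \<Longrightarrow> (\<lambda>x. - f x) \<in> ell2 m"
  using ell2_scale[of f "-1"] by simp

lemma embed_add: "f \<in> ell2 m \<Longrightarrow> g \<in> ell2 m \<Longrightarrow> embed (\<lambda>x. f x + g x) = embed f + embed g"
  by (rule l2_eqI) (simp add: coord_embed ell2_add distrib_right)

lemma embed_scale: "f \<in> ell2 m \<Longrightarrow> embed (\<lambda>x. c * f x) = c *\<^sub>R embed f"
  by (rule l2_eqI) (simp add: coord_embed ell2_scale)

lemma embed_diff: "f \<in> ell2 m \<Longrightarrow> g \<in> ell2 m \<Longrightarrow> embed (\<lambda>x. f x - g x) = embed f - embed g"
  by (rule l2_eqI) (simp add: coord_embed ell2_diff left_diff_distrib)

lemma embed_minus: "f \<in> ell2 m \<Longrightarrow> embed (\<lambda>x. - f x) = - embed f"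
  using embed_scale[of f "-1"] by simp

lemma embed_inject: "f \<in> ell2 m \<Longrightarrow> g \<in> ell2 m \<Longrightarrow> embed f = embed g \<longleftrightarrow> f = g"
  by (metis proj_embed)

lemma ell2_inner_embed:
  assumes "f \<in> ell2 m" "g \<in> ell2 m" shows "ell2_inner m f g = inner (embed f) (embed g)"
  unfolding ell2_inner_def inner_l2_def
proof (rule infsum_cong)
  fix x
  have "f x * g x * m x = f x * g x * (sqrt (m x) * sqrt (m x))" by simp
  then show "f x * g x * m x = coord (embed f) x * coord (embed g) x"
    by (simp only: coord_embed[OF assms(1)] coord_embed[OF assms(2)] mult_ac)
qed

lemma ell2_norm_embed: "f \<in> ell2 m \<Longrightarrow> ell2_norm m f = norm (embed f)"
  by (simp only: ell2_norm_def ell2_inner_embed norm_eq_sqrt_inner)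

lemma C_c_ell2: assumes "\<phi> \<in> C_c" shows "\<phi> \<in> ell2 m"
proof -
  have "(\<lambda>x. (\<phi> x)\<^sup>2 * m x) summable_on {x. \<phi> x \<noteq> 0}"
    using assms by (simp add: C_c_def)
  also have "?this \<longleftrightarrow> (\<lambda>x. (\<phi> x)\<^sup>2 * m x) summable_on UNIV"
    by (rule summable_on_cong_neutral) auto
  finally show ?thesis by (simp add: ell2_def)
qed

lemma C_c_add:
  assumes "\<phi> \<in> C_c" "\<psi> \<in> C_c" shows "(\<lambda>x. \<phi> x + \<psi> x) \<in> C_c"
  unfolding C_c_def using assms
  by (auto simp: C_c_def intro: finite_subset[of _ "{x. \<phi> x \<noteq> 0} \<union> {x. \<psi> x \<noteq> 0}"])

lemma C_c_scale: "\<phi> \<in> C_c \<Longrightarrow> (\<lambda>x. c * \<phi> x) \<in> C_c"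
  by (auto simp: C_c_def elim: finite_subset[rotated])

definition nbrs :: "'a \<Rightarrow> 'a set" where
  "nbrs x = {y. b x y > 0}"

text \<open>The formal Laplacian.\<close>
definition Lap :: "('a \<Rightarrow> real) \<Rightarrow> 'a \<Rightarrow> real" where
  "Lap f x = (\<Sum>y\<in>nbrs x. b x y * (f x - f y)) / m x"

lemma finite_nbrs [simp]: "finite (nbrs x)"
  by (simp add: nbrs_def locally_finite)

lemma not_nbr: "y \<notin> nbrs x \<Longrightarrow> b x y = 0"
  using weight_nonneg[of x y] by (auto simp: nbrs_def)

lemma nbrs_sym: "y \<in> nbrs x \<longleftrightarrow> x \<in> nbrs y"
  by (simp add: nbrs_def weight_sym)

lemma Lap_add: "Lap (\<lambda>x. f x + g x) x = Lap f x + Lap g x"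
  by (simp add: Lap_def add_divide_distrib[symmetric] sum.distrib[symmetric] algebra_simps)

lemma Lap_scale: "Lap (\<lambda>x. c * f x) x = c * Lap f x"
  by (simp add: Lap_def sum_distrib_left algebra_simps)

lemma Lap_diff: "Lap (\<lambda>x. f x - g x) x = Lap f x - Lap g x"
  using Lap_add[of f "\<lambda>x. -1 * g x" x] Lap_scale[of "-1" g x] by simp

definition closed_nbhd :: "('a \<Rightarrow> real) \<Rightarrow> 'a set" where
  "closed_nbhd \<phi> = {x. \<phi> x \<noteq> 0} \<union> (\<Union>x\<in>{x. \<phi> x \<noteq> 0}. nbrs x)"

lemma finite_closed_nbhd: "\<phi> \<in> C_c \<Longrightarrow> finite (closed_nbhd \<phi>)"
  by (auto simp: closed_nbhd_def C_c_def)

lemma Lap_C_c: assumes "\<phi> \<in> C_c" shows "Lap \<phi> \<in> C_c"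
proof -
  have "Lap \<phi> x = 0" if "x \<notin> closed_nbhd \<phi>" for x
  proof -
    have "\<phi> x = 0" "\<phi> y = 0" if "y \<in> nbrs x" for y
      using that \<open>x \<notin> closed_nbhd \<phi>\<close> by (auto simp: closed_nbhd_def nbrs_sym[of y x])
    then show ?thesis by (simp add: Lap_def)
  qed
  then have "{x. Lap \<phi> x \<noteq> 0} \<subseteq> closed_nbhd \<phi>" by auto
  then show ?thesis using finite_closed_nbhd[OF assms] by (auto simp: C_c_def intro: finite_subset)
qed

lemma closed_nbhd_neutral:
  assumes "b x y * (\<phi> x - \<phi> y) \<noteq> 0" shows "x \<in> closed_nbhd \<phi>" "y \<in> closed_nbhd \<phi>"
proof -
  have "y \<in> nbrs x" "x \<in> nbrs y" "\<phi> x \<noteq> 0 \<or> \<phi> y \<noteq> 0"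
    using assms not_nbr[of y x] nbrs_sym[of y x] by auto
  then show "x \<in> closed_nbhd \<phi>" "y \<in> closed_nbhd \<phi>" by (auto simp: closed_nbhd_def)
qed

lemma double_sum_by_parts:
  assumes "finite N"
  shows "(\<Sum>x\<in>N. \<Sum>y\<in>N. b x y * (f x - f y) * (g x - g y))
    = 2 * (\<Sum>x\<in>N. \<Sum>y\<in>N. b x y * (f x - f y) * g x)"
proof -
  have "(\<Sum>x\<in>N. \<Sum>y\<in>N. b x y * (f x - f y) * g y) = (\<Sum>y\<in>N. \<Sum>x\<in>N. b x y * (f x - f y) * g y)"
    by (rule sum.swap)
  also have "\<dots> = (\<Sum>x\<in>N. \<Sum>y\<in>N. - (b x y * (f x - f y) * g x))"
    by (intro sum.cong refl) (simp add: weight_sym[of _ x for x] algebra_simps)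
  finally have "(\<Sum>x\<in>N. \<Sum>y\<in>N. b x y * (f x - f y) * g y)
      = - (\<Sum>x\<in>N. \<Sum>y\<in>N. b x y * (f x - f y) * g x)"
    by (simp add: sum_negf)
  then show ?thesis
    by (simp add: right_diff_distrib sum_subtractf)
qed

text \<open>Only pairs in the finite neighbourhood of the support of \<open>\<phi>\<close> contribute to the energy, whatever
  \<open>f\<close> is, and for these the symmetry of the weights allows summation by parts.\<close>
lemma green_formula:
  assumes "\<phi> \<in> C_c"
  shows "energy b f \<phi> = ell2_inner m (Lap f) \<phi>"
proof -
  let ?N = "closed_nbhd \<phi>"
  have fin: "finite ?N" using assms by (rule finite_closed_nbhd)
  have "(\<Sum>\<^sub>\<infinity>(x, y). b x y * (f x - f y) * (\<phi> x - \<phi> y))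
      = (\<Sum>\<^sub>\<infinity>(x, y)\<in>?N \<times> ?N. b x y * (f x - f y) * (\<phi> x - \<phi> y))"
  proof (rule infsum_cong_neutral)
    fix p assume "p \<in> UNIV - ?N \<times> ?N"
    then have "b (fst p) (snd p) * (\<phi> (fst p) - \<phi> (snd p)) = 0"
      using closed_nbhd_neutral[of "fst p" "snd p" \<phi>] by (cases p) auto
    then show "(case p of (x, y) \<Rightarrow> b x y * (f x - f y) * (\<phi> x - \<phi> y)) = 0"
      by (auto simp: case_prod_beta)
  qed auto
  also have "\<dots> = (\<Sum>x\<in>?N. \<Sum>y\<in>?N. b x y * (f x - f y) * (\<phi> x - \<phi> y))"
    using fin by (simp add: sum.cartesian_product)
  also have "\<dots> = 2 * (\<Sum>x\<in>?N. \<Sum>y\<in>?N. b x y * (f x - f y) * \<phi> x)"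
    by (rule double_sum_by_parts[OF fin])
  finally have "energy b f \<phi> = (\<Sum>x\<in>?N. \<Sum>y\<in>?N. b x y * (f x - f y) * \<phi> x)"
    by (simp add: energy_def)
  also have "\<dots> = (\<Sum>x\<in>?N. Lap f x * \<phi> x * m x)"
  proof (rule sum.cong[OF refl])
    fix x
    show "(\<Sum>y\<in>?N. b x y * (f x - f y) * \<phi> x) = Lap f x * \<phi> x * m x"
    proof (cases "\<phi> x = 0")
      case False
      then have "nbrs x \<subseteq> ?N" by (auto simp: closed_nbhd_def)
      then have "(\<Sum>y\<in>?N. b x y * (f x - f y) * \<phi> x) = (\<Sum>y\<in>nbrs x. b x y * (f x - f y) * \<phi> x)"
        by (intro sum.mono_neutral_right fin) (auto simp: not_nbr)
      also have "\<dots> = (\<Sum>y\<in>nbrs x. b x y * (f x - f y)) * \<phi> x"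
        by (simp add: sum_distrib_right)
      finally show ?thesis by (simp add: Lap_def)
    qed simp
  qed
  also have "\<dots> = (\<Sum>\<^sub>\<infinity>x\<in>?N. Lap f x * \<phi> x * m x)" using fin by simp
  also have "\<dots> = ell2_inner m (Lap f) \<phi>"
    unfolding ell2_inner_def by (rule infsum_cong_neutral) (auto simp: closed_nbhd_def)
  finally show ?thesis .
qed

text \<open>The gradient of \<open>f\<close> as a function on pairs of vertices, normalised such that the energy form is
  the inner product of gradients. The closure of the form then becomes convergence of gradients in a
  complete space.\<close>
definition weighted_diff :: "('a \<Rightarrow> real) \<Rightarrow> 'a \<times> 'a \<Rightarrow> real" where
  "weighted_diff f = (\<lambda>(x, y). sqrt (b x y / 2) * (f x - f y))"

definition finite_energy :: "('a \<Rightarrow> real) \<Rightarrow> bool" where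
  "finite_energy f \<longleftrightarrow> (\<lambda>p. (weighted_diff f p)\<^sup>2) summable_on UNIV"

definition grad :: "('a \<Rightarrow> real) \<Rightarrow> ('a \<times> 'a) l2" where
  "grad f = Abs_l2 (weighted_diff f)"

lemma coord_grad: "finite_energy f \<Longrightarrow> coord (grad f) (x, y) = sqrt (b x y / 2) * (f x - f y)"
  unfolding finite_energy_def grad_def by (subst Abs_l2_inverse) (auto simp: weighted_diff_def)

lemma finite_energyI:
  assumes "\<And>x y. coord G (x, y) = sqrt (b x y / 2) * (f x - f y)"
  shows "finite_energy f" and "grad f = G"
proof -
  have G: "weighted_diff f = coord G" using assms by (auto simp: weighted_diff_def fun_eq_iff)
  show "finite_energy f" by (simp add: finite_energy_def G)
  show "grad f = G" by (simp add: grad_def G coord_inverse)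
qed

lemma energy_inner:
  assumes "finite_energy f" "finite_energy g"
  shows "energy b f g = inner (grad f) (grad g)"
proof -
  have "1 / 2 * (b x y * (f x - f y) * (g x - g y)) = coord (grad f) (x, y) * coord (grad g) (x, y)" for x y
  proof -
    have "b x y / 2 = sqrt (b x y / 2) * sqrt (b x y / 2)" using weight_nonneg[of x y] by simp
    then have "1 / 2 * (b x y * (f x - f y) * (g x - g y))
        = (sqrt (b x y / 2) * sqrt (b x y / 2)) * (f x - f y) * (g x - g y)"
      by simp
    then show ?thesis by (simp only: coord_grad[OF assms(1)] coord_grad[OF assms(2)] mult_ac)
  qed
  then have "(\<Sum>\<^sub>\<infinity>p. 1 / 2 * (case p of (x, y) \<Rightarrow> b x y * (f x - f y) * (g x - g y))) = inner (grad f) (grad g)"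
    unfolding inner_l2_def by (intro infsum_cong) (auto simp: split_beta)
  then show ?thesis unfolding energy_def by (simp only: infsum_cmult_right')
qed

lemma finite_energy_C_c:
  assumes "\<phi> \<in> C_c" shows "finite_energy \<phi>"
  unfolding finite_energy_def
proof (rule summable_on_cong_neutral[THEN iffD2])
  show "(\<lambda>p. (weighted_diff \<phi> p)\<^sup>2) summable_on closed_nbhd \<phi> \<times> closed_nbhd \<phi>"
    using finite_closed_nbhd[OF assms] by simp
  show "(weighted_diff \<phi> p)\<^sup>2 = 0" if "p \<in> UNIV - closed_nbhd \<phi> \<times> closed_nbhd \<phi>" for p
    using closed_nbhd_neutral[of "fst p" "snd p" \<phi>] that by (cases p) (auto simp: weighted_diff_def)
qed auto

lemma finite_energy_lincomb:
  assumes "finite_energy f" "finite_energy g"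
  shows "finite_energy (\<lambda>x. c * f x + g x)" and "grad (\<lambda>x. c * f x + g x) = c *\<^sub>R grad f + grad g"
proof -
  have "coord (c *\<^sub>R grad f + grad g) (x, y) = sqrt (b x y / 2) * ((c * f x + g x) - (c * f y + g y))" for x y
    using assms by (simp add: coord_grad algebra_simps)
  from finite_energyI[OF this]
  show "finite_energy (\<lambda>x. c * f x + g x)" "grad (\<lambda>x. c * f x + g x) = c *\<^sub>R grad f + grad g" .
qed

lemma finite_energy_diff:
  assumes "finite_energy f" "finite_energy g"
  shows "finite_energy (\<lambda>x. f x - g x)" and "grad (\<lambda>x. f x - g x) = grad f - grad g"
  using finite_energy_lincomb[OF assms(2,1), of "-1"] by simp_all

lemma embed_tendsto_pointwise:
  assumes "\<And>n. \<phi> n \<in> ell2 m" "f \<in> ell2 m" "(\<lambda>n. embed (\<phi> n)) \<longlonglongrightarrow> embed f"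
  shows "(\<lambda>n. \<phi> n x) \<longlonglongrightarrow> f x"
proof -
  have "(\<lambda>n. coord (embed (\<phi> n)) x / sqrt (m x)) \<longlonglongrightarrow> coord (embed f) x / sqrt (m x)"
    by (intro tendsto_intros tendsto_coord assms) simp
  then show ?thesis using assms by (simp add: coord_embed)
qed

lemma grad_limit:
  assumes \<phi>: "\<And>n. \<phi> n \<in> C_c" and f: "f \<in> ell2 m"
    and "(\<lambda>n. embed (\<phi> n)) \<longlonglongrightarrow> embed f" and G: "(\<lambda>n. grad (\<phi> n)) \<longlonglongrightarrow> G"
  shows "finite_energy f" and "grad f = G"
proof -
  have pointwise: "(\<lambda>n. \<phi> n x) \<longlonglongrightarrow> f x" for x
    by (rule embed_tendsto_pointwise) (use assms C_c_ell2 in auto)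
  have "coord G (x, y) = sqrt (b x y / 2) * (f x - f y)" for x y
  proof (rule LIMSEQ_unique)
    show "(\<lambda>n. coord (grad (\<phi> n)) (x, y)) \<longlonglongrightarrow> coord G (x, y)"
      by (rule tendsto_coord[OF G])
    show "(\<lambda>n. coord (grad (\<phi> n)) (x, y)) \<longlonglongrightarrow> sqrt (b x y / 2) * (f x - f y)"
      using \<phi> by (simp add: coord_grad finite_energy_C_c) (intro tendsto_intros pointwise)
  qed
  from finite_energyI[OF this] show "finite_energy f" "grad f = G" .
qed

text \<open>This contains the closability of the form: a Cauchy sequence of gradients has a limit, and by
  pointwise convergence the limit can only be the gradient of \<open>f\<close>.\<close>
lemma form_approx_iff:
  "form_approx b m \<phi> f \<longleftrightarrow> f \<in> ell2 m \<and> (\<forall>n. \<phi> n \<in> C_c) \<and>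
     (\<lambda>n. embed (\<phi> n)) \<longlonglongrightarrow> embed f \<and> finite_energy f \<and> (\<lambda>n. grad (\<phi> n)) \<longlonglongrightarrow> grad f"
  (is "_ \<longleftrightarrow> ?R")
proof -
  have energy_diff: "energy b (\<lambda>x. \<phi> i x - \<phi> j x) (\<lambda>x. \<phi> i x - \<phi> j x) = (norm (grad (\<phi> i) - grad (\<phi> j)))\<^sup>2"
    if "\<forall>n. \<phi> n \<in> C_c" for i j
    using that by (simp add: energy_inner finite_energy_diff finite_energy_C_c power2_norm_eq_inner)
  have norm_diff: "ell2_norm m (\<lambda>x. \<phi> n x - f x) = norm (embed (\<phi> n) - embed f)"
    if "\<forall>n. \<phi> n \<in> C_c" "f \<in> ell2 m" for n
    using that by (simp add: ell2_norm_embed ell2_diff C_c_ell2 embed_diff)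
  show ?thesis
  proof
    assume "form_approx b m \<phi> f"
    then have f: "f \<in> ell2 m" and \<phi>: "\<forall>n. \<phi> n \<in> C_c"
      and lim: "(\<lambda>n. ell2_norm m (\<lambda>x. \<phi> n x - f x)) \<longlonglongrightarrow> 0"
      and cauchy: "\<forall>\<epsilon>>0. \<exists>N. \<forall>i\<ge>N. \<forall>j\<ge>N. energy b (\<lambda>x. \<phi> i x - \<phi> j x) (\<lambda>x. \<phi> i x - \<phi> j x) < \<epsilon>"
      by (auto simp: form_approx_def)
    have embed_lim: "(\<lambda>n. embed (\<phi> n)) \<longlonglongrightarrow> embed f"
      using lim f \<phi> by (simp add: norm_diff tendsto_norm_zero_iff LIM_zero_iff)
    have "Cauchy (\<lambda>n. grad (\<phi> n))"
    proof (rule CauchyI)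
      fix e :: real assume "e > 0"
      then have "e\<^sup>2 > 0" by simp
      then obtain N where "\<forall>i\<ge>N. \<forall>j\<ge>N. (norm (grad (\<phi> i) - grad (\<phi> j)))\<^sup>2 < e\<^sup>2"
        using cauchy energy_diff[OF \<phi>] by metis
      then show "\<exists>N. \<forall>i\<ge>N. \<forall>j\<ge>N. norm (grad (\<phi> i) - grad (\<phi> j)) < e"
        using \<open>e > 0\<close> by (meson less_imp_le power2_less_imp_less)
    qed
    then obtain G where G: "(\<lambda>n. grad (\<phi> n)) \<longlonglongrightarrow> G"
      by (auto simp: Cauchy_convergent_iff convergent_def)
    have "finite_energy f" "grad f = G"
      using grad_limit[OF _ f embed_lim G] \<phi> by simp_all
    then show ?R using f \<phi> embed_lim G by simp
  next
    assume R: ?R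
    have "\<exists>N. \<forall>i\<ge>N. \<forall>j\<ge>N. (norm (grad (\<phi> i) - grad (\<phi> j)))\<^sup>2 < \<epsilon>" if eps: "\<epsilon> > 0" for \<epsilon>
    proof -
      have cauchy: "Cauchy (\<lambda>n. grad (\<phi> n))" using R by (auto intro: LIMSEQ_imp_Cauchy)
      then obtain N where N: "\<forall>i\<ge>N. \<forall>j\<ge>N. norm (grad (\<phi> i) - grad (\<phi> j)) < sqrt \<epsilon>"
        using CauchyD[OF cauchy, of "sqrt \<epsilon>"] eps by auto
      have "(norm (grad (\<phi> i) - grad (\<phi> j)))\<^sup>2 < \<epsilon>" if "i \<ge> N" "j \<ge> N" for i j
      proof -
        have "(norm (grad (\<phi> i) - grad (\<phi> j)))\<^sup>2 < (sqrt \<epsilon>)\<^sup>2"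
          using N that by (intro power_strict_mono) auto
        then show ?thesis using \<open>\<epsilon> > 0\<close> by simp
      qed
      then show ?thesis by blast
    qed
    then show "form_approx b m \<phi> f"
      using R by (simp add: form_approx_def energy_diff norm_diff tendsto_norm_zero_iff LIM_zero_iff)
  qed
qed

abbreviation dom :: "('a \<Rightarrow> real) set" where
  "dom \<equiv> closed_form_dom b m"

lemma dom_iff: "f \<in> dom \<longleftrightarrow> (\<exists>\<phi>. form_approx b m \<phi> f)"
  by (simp add: closed_form_dom_def)

lemma domE:
  assumes "f \<in> dom"
  obtains \<phi> where "\<And>n. \<phi> n \<in> C_c" "(\<lambda>n. embed (\<phi> n)) \<longlonglongrightarrow> embed f" "(\<lambda>n. grad (\<phi> n)) \<longlonglongrightarrow> grad f"
  using assms unfolding dom_iff form_approx_iff by blast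

lemma dom_ell2: "f \<in> dom \<Longrightarrow> f \<in> ell2 m"
  and dom_finite_energy: "f \<in> dom \<Longrightarrow> finite_energy f"
  unfolding dom_iff form_approx_iff by blast+

lemma C_c_dom: assumes "\<phi> \<in> C_c" shows "\<phi> \<in> dom"
proof -
  have "form_approx b m (\<lambda>_. \<phi>) \<phi>"
    unfolding form_approx_iff using assms by (simp add: C_c_ell2 finite_energy_C_c)
  then show ?thesis unfolding dom_iff by blast
qed

lemma domI:
  assumes "\<And>n. \<phi> n \<in> C_c" "f \<in> ell2 m" "(\<lambda>n. embed (\<phi> n)) \<longlonglongrightarrow> embed f" "Cauchy (\<lambda>n. grad (\<phi> n))"
  shows "f \<in> dom"
proof -
  obtain G where G: "(\<lambda>n. grad (\<phi> n)) \<longlonglongrightarrow> G"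
    using assms(4) by (auto simp: Cauchy_convergent_iff convergent_def)
  have "form_approx b m \<phi> f"
    unfolding form_approx_iff using assms G grad_limit[OF assms(1-3) G] by simp
  then show ?thesis unfolding dom_iff by blast
qed

lemma dom_lincomb:
  assumes "f \<in> dom" "g \<in> dom" shows "(\<lambda>x. c * f x + g x) \<in> dom"
proof -
  obtain \<phi> where \<phi>: "\<And>n. \<phi> n \<in> C_c" "(\<lambda>n. embed (\<phi> n)) \<longlonglongrightarrow> embed f" "(\<lambda>n. grad (\<phi> n)) \<longlonglongrightarrow> grad f"
    using assms(1) by (rule domE) blast
  obtain \<psi> where \<psi>: "\<And>n. \<psi> n \<in> C_c" "(\<lambda>n. embed (\<psi> n)) \<longlonglongrightarrow> embed g" "(\<lambda>n. grad (\<psi> n)) \<longlonglongrightarrow> grad g"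
    using assms(2) by (rule domE) blast
  note mem = dom_ell2[OF assms(1)] dom_ell2[OF assms(2)] dom_finite_energy[OF assms(1)] dom_finite_energy[OF assms(2)]
  have "(\<lambda>n. c *\<^sub>R embed (\<phi> n) + embed (\<psi> n)) \<longlonglongrightarrow> c *\<^sub>R embed f + embed g"
    "(\<lambda>n. c *\<^sub>R grad (\<phi> n) + grad (\<psi> n)) \<longlonglongrightarrow> c *\<^sub>R grad f + grad g"
    by (intro tendsto_intros \<phi> \<psi>)+
  then have "form_approx b m (\<lambda>n x. c * \<phi> n x + \<psi> n x) (\<lambda>x. c * f x + g x)"
    using mem \<phi>(1) \<psi>(1)
    by (simp add: form_approx_iff ell2_add ell2_scale C_c_add C_c_scale embed_add embed_scale
        finite_energy_lincomb C_c_ell2 finite_energy_C_c)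
  then show ?thesis unfolding dom_iff by blast
qed

text \<open>No limits remain: the closed form is given by the gradients of its arguments.\<close>
lemma closed_form_eq:
  assumes "f \<in> dom" "g \<in> dom" shows "closed_form b m f g = inner (grad f) (grad g)"
  unfolding closed_form_def
proof (rule the_equality)
  show lim: "\<forall>\<phi> \<psi>. form_approx b m \<phi> f \<longrightarrow> form_approx b m \<psi> g \<longrightarrow>
      (\<lambda>n. energy b (\<phi> n) (\<psi> n)) \<longlonglongrightarrow> inner (grad f) (grad g)"
    by (auto simp: form_approx_iff energy_inner finite_energy_C_c intro!: tendsto_inner)
  fix c assume "\<forall>\<phi> \<psi>. form_approx b m \<phi> f \<longrightarrow> form_approx b m \<psi> g \<longrightarrow>
      (\<lambda>n. energy b (\<phi> n) (\<psi> n)) \<longlonglongrightarrow> c"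
  moreover obtain \<phi> \<psi> where "form_approx b m \<phi> f" "form_approx b m \<psi> g"
    using assms unfolding dom_iff by blast
  ultimately show "c = inner (grad f) (grad g)" using lim by (blast intro: LIMSEQ_unique)
qed

text \<open>Green's formula passes from finitely supported functions to the form domain by continuity.\<close>
lemma weak_equation:
  assumes f: "finite_energy f" and g: "Lap f \<in> ell2 m" and h: "h \<in> dom"
  shows "inner (grad f) (grad h) = inner (embed (Lap f)) (embed h)"
proof -
  obtain \<psi> where \<psi>: "\<And>n. \<psi> n \<in> C_c" "(\<lambda>n. embed (\<psi> n)) \<longlonglongrightarrow> embed h" "(\<lambda>n. grad (\<psi> n)) \<longlonglongrightarrow> grad h"
    using h by (rule domE) blast
  have "inner (grad f) (grad (\<psi> n)) = inner (embed (Lap f)) (embed (\<psi> n))" for n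
    using green_formula[OF \<psi>(1), of f n] f g \<psi>(1)
    by (simp add: energy_inner finite_energy_C_c ell2_inner_embed C_c_ell2)
  moreover have "(\<lambda>n. inner (grad f) (grad (\<psi> n))) \<longlonglongrightarrow> inner (grad f) (grad h)"
    by (intro tendsto_intros \<psi>)
  moreover have "(\<lambda>n. inner (embed (Lap f)) (embed (\<psi> n))) \<longlonglongrightarrow> inner (embed (Lap f)) (embed h)"
    by (intro tendsto_intros \<psi>)
  ultimately show ?thesis by (simp add: LIMSEQ_unique)
qed

text \<open>The self-adjoint operator acts as the formal Laplacian. Testing with the indicator of a vertex
  identifies its values; conversely, the weak equation extends to the whole form domain.\<close>
lemma laplacian_iff: "(f, g) \<in> laplacian b m \<longleftrightarrow> f \<in> dom \<and> g \<in> ell2 m \<and> g = Lap f"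
proof (intro iffI conjI)
  assume fg: "(f, g) \<in> laplacian b m"
  then show f: "f \<in> dom" and g: "g \<in> ell2 m" by (auto simp: laplacian_def)
  show "g = Lap f"
  proof
    fix x
    have i: "indicator {x} \<in> (C_c :: ('a \<Rightarrow> real) set)" by (simp add: C_c_def indicator_eq_0_iff)
    have inner_i: "ell2_inner m k (indicator {x}) = k x * m x" for k
    proof -
      have "ell2_inner m k (indicator {x}) = (\<Sum>\<^sub>\<infinity>z\<in>{x}. k z * m z)"
        unfolding ell2_inner_def by (rule infsum_cong_neutral) auto
      then show ?thesis by simp
    qed
    have "closed_form b m f (indicator {x}) = ell2_inner m g (indicator {x})"
      using fg C_c_dom[OF i] by (auto simp: laplacian_def)
    then have "energy b f (indicator {x}) = g x * m x"
      using f i by (simp add: closed_form_eq C_c_dom energy_inner dom_finite_energy finite_energy_C_c inner_i)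
    then show "g x = Lap f x" using green_formula[OF i, of f] by (simp add: inner_i)
  qed
next
  assume "f \<in> dom \<and> g \<in> ell2 m \<and> g = Lap f"
  then show "(f, g) \<in> laplacian b m"
    using weak_equation
    by (auto simp: laplacian_def closed_form_eq dom_finite_energy ell2_inner_embed dom_ell2)
qed

end

section \<open>The minimal resolvent\<close>

lemma inner_l2_mono:
  fixes F G H :: "'a l2"
  assumes "\<And>x. coord F x * coord H x \<le> coord G x * coord H x"
  shows "inner F H \<le> inner G H"
  unfolding inner_l2_def by (intro infsum_mono summable_product summable_square assms)

text \<open>The Dirichlet problem \<open>c w + \<Delta> w = g\<close> for \<open>g \<ge> 0\<close> is solved by Jacobi iteration, starting from
  \<open>0\<close> and restricting \<open>g\<close> to the sets of an exhaustion by finite sets. The iterates are finitely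
  supported, increase, and stay below every nonnegative supersolution.\<close>
locale resolvent_iteration = weighted_graph b m
  for b :: "'a \<Rightarrow> 'a \<Rightarrow> real" and m +
  fixes c :: real and g :: "'a \<Rightarrow> real"
  assumes c_pos: "c > 0" and g_ell2: "g \<in> ell2 m" and g_nonneg: "g x \<ge> 0"
begin

definition trunc :: "nat \<Rightarrow> 'a \<Rightarrow> real" where
  "trunc k x = (if to_nat_on (UNIV :: 'a set) x \<le> k then g x else 0)"

definition deg :: "'a \<Rightarrow> real" where
  "deg x = (\<Sum>y\<in>nbrs x. b x y)"

text \<open>The equation at \<open>x\<close> is solved for \<open>w x\<close> with the previous iterate at the neighbours.\<close>
primrec w :: "nat \<Rightarrow> 'a \<Rightarrow> real" where
  "w 0 = (\<lambda>x. 0)"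
| "w (Suc k) = (\<lambda>x. (trunc k x * m x + (\<Sum>y\<in>nbrs x. b x y * w k y)) / (c * m x + deg x))"

text \<open>The right hand side that the \<open>k\<close>-th iterate solves exactly.\<close>
definition L :: "nat \<Rightarrow> 'a \<Rightarrow> real" where
  "L k x = c * w k x + Lap (w k) x"

lemma deg_nonneg: "deg x \<ge> 0"
  by (simp add: deg_def sum_nonneg weight_nonneg)

lemma denom_pos: "c * m x + deg x > 0"
  using c_pos deg_nonneg[of x] by (simp add: add_pos_nonneg)

lemma Lap_mult: "Lap f x * m x = deg x * f x - (\<Sum>y\<in>nbrs x. b x y * f y)"
  by (simp add: Lap_def deg_def right_diff_distrib sum_subtractf sum_distrib_right)

lemma w_step: "w (Suc k) x * (c * m x + deg x) = trunc k x * m x + (\<Sum>y\<in>nbrs x. b x y * w k y)"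
  using denom_pos[of x] by simp

lemma trunc_bounds: "0 \<le> trunc k x" "trunc k x \<le> g x" "trunc k x \<le> trunc (Suc k) x"
  using g_nonneg[of x] by (auto simp: trunc_def)

lemma w_nonneg: "0 \<le> w k x"
proof (induction k arbitrary: x)
  case (Suc k)
  then have "0 \<le> trunc k x * m x + (\<Sum>y\<in>nbrs x. b x y * w k y)"
    using trunc_bounds(1)[of k x] by (auto intro!: add_nonneg_nonneg sum_nonneg mult_nonneg_nonneg weight_nonneg)
  then show ?case using denom_pos[of x] by simp
qed simp

lemma w_mono: "w k x \<le> w (Suc k) x"
proof (induction k arbitrary: x)
  case 0
  show ?case using w_nonneg[of "Suc 0" x] by simp
next
  case (Suc k)
  have "w (Suc k) x * (c * m x + deg x) \<le> w (Suc (Suc k)) x * (c * m x + deg x)"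
    unfolding w_step
    by (intro add_mono sum_mono mult_mono Suc.IH trunc_bounds) (auto simp: weight_nonneg w_nonneg trunc_bounds simp del: w.simps)
  then show ?case using denom_pos[of x] by (simp only: mult_le_cancel_right_pos)
qed

declare w.simps [simp del]

lemma incseq_w: "incseq (\<lambda>k. w k x)"
  by (rule incseq_SucI) (rule w_mono)

lemma w_mono': "j \<le> k \<Longrightarrow> w j x \<le> w k x"
  using incseqD[OF incseq_w] .

lemma finite_exhaustion: "finite {x :: 'a. to_nat_on UNIV x \<le> k}"
  by (rule inj_on_finite[of "to_nat_on UNIV" _ "{..k}"])
     (auto intro: inj_on_subset[OF inj_on_to_nat_on[OF countable_vertices]])

lemma w_C_c: "w k \<in> C_c"
proof (induction k)
  case 0
  then show ?case by (simp add: C_c_def w.simps)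
next
  case (Suc k)
  have "w (Suc k) x = 0" if "to_nat_on UNIV x > k" "x \<notin> closed_nbhd (w k)" for x
  proof -
    have "w k y = 0" if "y \<in> nbrs x" for y
      using that \<open>x \<notin> closed_nbhd (w k)\<close> by (auto simp: closed_nbhd_def nbrs_sym[of y x])
    then show ?thesis using that(1) by (simp add: w.simps trunc_def)
  qed
  then have "{x. w (Suc k) x \<noteq> 0} \<subseteq> {x. to_nat_on UNIV x \<le> k} \<union> closed_nbhd (w k)"
    by (auto simp: not_less) (metis not_less)
  then show ?case
    using finite_exhaustion finite_closed_nbhd[OF Suc.IH] by (auto simp: C_c_def intro: finite_subset)
qed

lemma L_Suc: "L (Suc k) x = trunc k x - (\<Sum>y\<in>nbrs x. b x y * (w (Suc k) y - w k y)) / m x"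
proof -
  have "L (Suc k) x * m x = w (Suc k) x * (c * m x + deg x) - (\<Sum>y\<in>nbrs x. b x y * w (Suc k) y)"
    using Lap_mult[of "w (Suc k)" x] by (simp add: L_def algebra_simps)
  also have "\<dots> = trunc k x * m x - (\<Sum>y\<in>nbrs x. b x y * (w (Suc k) y - w k y))"
    by (simp only: w_step) (simp add: right_diff_distrib sum_subtractf)
  finally show ?thesis by (simp add: field_simps)
qed

text \<open>Each iterate is a subsolution, because the neighbours have grown since they were used.\<close>
lemma L_le: "L k x \<le> g x"
proof (cases k)
  case 0
  then show ?thesis using g_nonneg by (simp add: L_def w.simps Lap_def)
next
  case (Suc j)
  have "0 \<le> (\<Sum>y\<in>nbrs x. b x y * (w (Suc j) y - w j y)) / m x"
    by (intro divide_nonneg_nonneg sum_nonneg mult_nonneg_nonneg weight_nonneg) (simp_all add: w_mono)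
  then show ?thesis using trunc_bounds(2)[of j x] by (simp add: Suc L_Suc)
qed

lemma L_C_c: "L k \<in> C_c"
  unfolding L_def[abs_def] by (intro C_c_add C_c_scale Lap_C_c w_C_c)

abbreviation W :: "nat \<Rightarrow> 'a l2" where "W k \<equiv> embed (w k)"
abbreviation D :: "nat \<Rightarrow> ('a \<times> 'a) l2" where "D k \<equiv> grad (w k)"

lemmas w_ell2 = C_c_ell2[OF w_C_c]
lemmas L_ell2 = C_c_ell2[OF L_C_c]

lemma inner_L: "inner (embed (L k)) (W j) = c * inner (W k) (W j) + inner (D k) (D j)"
proof -
  have "embed (L k) = c *\<^sub>R W k + embed (Lap (w k))"
    unfolding L_def[abs_def]
    by (simp add: embed_add embed_scale ell2_scale w_ell2 C_c_ell2[OF Lap_C_c[OF w_C_c]])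
  moreover have "inner (D k) (D j) = inner (embed (Lap (w k))) (W j)"
    by (intro weak_equation finite_energy_C_c w_C_c C_c_ell2 Lap_C_c C_c_dom)
  ultimately show ?thesis by (simp add: inner_add_left)
qed

lemma inner_L_le:
  assumes "\<And>x. 0 \<le> coord H x" shows "inner (embed (L k)) H \<le> inner (embed g) H"
proof (rule inner_l2_mono)
  fix x
  have "L k x * sqrt (m x) \<le> g x * sqrt (m x)" by (intro mult_right_mono L_le) simp
  then show "coord (embed (L k)) x * coord H x \<le> coord (embed g) x * coord H x"
    using assms by (simp add: coord_embed L_ell2 g_ell2 mult_right_mono)
qed

lemma coord_W_nonneg: "0 \<le> coord (W k) x"
  by (simp add: coord_embed w_ell2 w_nonneg)

lemma coord_W_mono: "j \<le> k \<Longrightarrow> coord (W j) x \<le> coord (W k) x"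
  by (simp add: coord_embed w_ell2 w_mono' mult_right_mono)

text \<open>The equation is tested with its own subsolution.\<close>
lemma norm_W: "c * norm (W k) \<le> norm (embed g)"
proof (cases "norm (W k) = 0")
  case False
  have "c * (norm (W k))\<^sup>2 \<le> inner (embed (L k)) (W k)"
    by (simp add: inner_L power2_norm_eq_inner)
  also have "\<dots> \<le> inner (embed g) (W k)" by (rule inner_L_le[OF coord_W_nonneg])
  also have "\<dots> \<le> norm (embed g) * norm (W k)" by (rule norm_cauchy_schwarz)
  finally have "(c * norm (W k)) * norm (W k) \<le> norm (embed g) * norm (W k)"
    by (simp add: power2_eq_square mult.assoc)
  then show ?thesis using False by simp
qed simp

text \<open>For nonnegative increasing functions \<open>\<langle>W\<^sub>k, W\<^sub>j\<rangle> \<ge> \<parallel>W\<^sub>j\<parallel>\<^sup>2\<close> if \<open>j \<le> k\<close>, so the squared distance is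
  bounded by the difference of the squared norms, and these form a bounded monotone sequence.\<close>
lemma W_convergent: obtains F where "W \<longlonglongrightarrow> F"
proof -
  define a where "a k = (norm (W k))\<^sup>2" for k
  have diff: "(norm (W k - W j))\<^sup>2 \<le> a k - a j" if "j \<le> k" for j k
  proof -
    have "inner (W j) (W j) \<le> inner (W k) (W j)"
      by (intro inner_l2_mono mult_right_mono coord_W_mono coord_W_nonneg that)
    then show ?thesis
      by (simp add: a_def power2_norm_eq_inner inner_diff inner_commute)
  qed
  have "incseq a"
  proof (rule incseq_SucI)
    fix k show "a k \<le> a (Suc k)" using diff[of k "Suc k"] zero_le_power2[of "norm (W (Suc k) - W k)"] by linarith
  qed
  moreover have "a k \<le> (norm (embed g) / c)\<^sup>2" for k
    unfolding a_def using norm_W[of k] c_pos by (intro power_mono) (auto simp: field_simps)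
  ultimately obtain l where l: "a \<longlonglongrightarrow> l" "\<And>k. a k \<le> l"
    using incseq_convergent[of a "(norm (embed g) / c)\<^sup>2"] by blast
  have "Cauchy W"
  proof (rule CauchyI')
    fix e :: real assume "e > 0"
    then obtain N where N: "\<And>k. k \<ge> N \<Longrightarrow> \<bar>a k - l\<bar> < e\<^sup>2"
      using LIMSEQ_D[OF l(1), of "e\<^sup>2"] by auto
    have "norm (W i - W j) < e" if "N \<le> i" "i < j" for i j
    proof -
      have "(norm (W j - W i))\<^sup>2 < e\<^sup>2" using diff[of i j] N[of i] l(2)[of i] l(2)[of j] that by auto
      then show ?thesis using \<open>e > 0\<close> by (simp add: norm_minus_commute power2_less_imp_less)
    qed
    then show "\<exists>N. \<forall>i\<ge>N. \<forall>j>i. dist (W i) (W j) < e" by (auto simp: dist_norm)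
  qed
  then show ?thesis using that by (auto simp: Cauchy_convergent_iff convergent_def)
qed

definition limit :: "'a \<Rightarrow> real" where
  "limit = proj (SOME F. W \<longlonglongrightarrow> F)"

lemma limit_ell2: "limit \<in> ell2 m"
  by (simp add: limit_def proj_ell2)

lemma W_tendsto: "W \<longlonglongrightarrow> embed limit"
  unfolding limit_def embed_proj using W_convergent by (metis someI_ex)

lemma w_tendsto: "(\<lambda>k. w k x) \<longlonglongrightarrow> limit x"
  by (rule embed_tendsto_pointwise[OF w_ell2 limit_ell2 W_tendsto])

lemma w_le_limit: "w k x \<le> limit x"
  by (rule incseq_le[OF incseq_w w_tendsto])

lemma limit_nonneg: "0 \<le> limit x"
  using w_nonneg w_le_limit by (rule order_trans)

lemma trunc_tendsto: "(\<lambda>k. trunc k x) \<longlonglongrightarrow> g x"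
proof (rule tendsto_eventually)
  show "\<forall>\<^sub>F k in sequentially. trunc k x = g x"
    using eventually_ge_at_top[of "to_nat_on UNIV x"] by eventually_elim (simp add: trunc_def)
qed

lemma limit_equation: "c * limit x + Lap limit x = g x"
proof -
  have "(\<lambda>k. w (Suc k) x * (c * m x + deg x)) \<longlonglongrightarrow> limit x * (c * m x + deg x)"
    by (intro tendsto_intros LIMSEQ_Suc w_tendsto)
  moreover have "(\<lambda>k. w (Suc k) x * (c * m x + deg x)) \<longlonglongrightarrow> g x * m x + (\<Sum>y\<in>nbrs x. b x y * limit y)"
    unfolding w_step by (intro tendsto_intros w_tendsto trunc_tendsto)
  ultimately have "limit x * (c * m x + deg x) = g x * m x + (\<Sum>y\<in>nbrs x. b x y * limit y)"
    by (rule LIMSEQ_unique)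
  then have "(c * limit x + Lap limit x) * m x = g x * m x"
    using Lap_mult[of limit x] by (simp add: algebra_simps)
  then show ?thesis by simp
qed

text \<open>The iteration is monotone in its right hand side and in the previous iterate, and a
  supersolution is not increased by one step.\<close>
lemma limit_minimal:
  assumes "\<And>x. 0 \<le> v x" "\<And>x. g x \<le> c * v x + Lap v x"
  shows "limit x \<le> v x"
proof -
  have "w k x \<le> v x" for k
  proof (induction k arbitrary: x)
    case 0
    then show ?case using assms(1) by (simp add: w.simps)
  next
    case (Suc k)
    have "w (Suc k) x * (c * m x + deg x) \<le> g x * m x + (\<Sum>y\<in>nbrs x. b x y * v y)"
      unfolding w_step
      by (intro add_mono sum_mono mult_mono Suc.IH trunc_bounds) (auto simp: weight_nonneg w_nonneg g_nonneg)
    also have "\<dots> \<le> (c * v x + Lap v x) * m x + (\<Sum>y\<in>nbrs x. b x y * v y)"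
      using assms(2) by (intro add_right_mono mult_right_mono) auto
    also have "\<dots> = v x * (c * m x + deg x)"
      using Lap_mult[of v x] by (simp add: algebra_simps)
    finally show ?case using denom_pos[of x] by (simp only: mult_le_cancel_right_pos)
  qed
  then show ?thesis by (intro LIMSEQ_le_const2[OF w_tendsto]) blast
qed

lemma L_tendsto: "(\<lambda>k. L k x) \<longlonglongrightarrow> g x"
proof -
  have "(\<lambda>k. L (Suc k) x) \<longlonglongrightarrow> g x - (\<Sum>y\<in>nbrs x. b x y * (limit y - limit y)) / m x"
    unfolding L_Suc by (intro tendsto_intros trunc_tendsto w_tendsto LIMSEQ_Suc) simp
  then show ?thesis by (intro LIMSEQ_imp_Suc[of "\<lambda>k. L k x"]) simp
qed

lemma inner_C_c:
  assumes "f \<in> ell2 m" "\<phi> \<in> C_c"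
  shows "inner (embed f) (embed \<phi>) = (\<Sum>x | \<phi> x \<noteq> 0. f x * \<phi> x * m x)"
proof -
  have "inner (embed f) (embed \<phi>) = (\<Sum>\<^sub>\<infinity>x. f x * \<phi> x * m x)"
    using ell2_inner_embed[OF assms(1) C_c_ell2[OF assms(2)]] by (simp add: ell2_inner_def)
  also have "\<dots> = (\<Sum>\<^sub>\<infinity>x\<in>{x. \<phi> x \<noteq> 0}. f x * \<phi> x * m x)"
    by (rule infsum_cong_neutral) auto
  finally show ?thesis using assms(2) by (simp add: C_c_def)
qed

lemma residual_tendsto: "(\<lambda>k. inner (embed g - embed (L k)) (W j)) \<longlonglongrightarrow> 0"
proof -
  have "inner (embed g - embed (L k)) (W j) = (\<Sum>x | w j x \<noteq> 0. (g x - L k x) * w j x * m x)" for k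
    using inner_C_c[OF ell2_diff[OF g_ell2 L_ell2] w_C_c] by (simp add: embed_diff g_ell2 L_ell2)
  moreover have "(\<lambda>k. \<Sum>x | w j x \<noteq> 0. (g x - L k x) * w j x * m x)
      \<longlonglongrightarrow> (\<Sum>x | w j x \<noteq> 0. (g x - g x) * w j x * m x)"
    by (intro tendsto_intros L_tendsto)
  ultimately show ?thesis by simp
qed

text \<open>Expansion of the square of \<open>W k - W j\<close> in the form norm. The mixed term is evaluated with the
  equation for the later iterate, which leaves the residual of step \<open>k\<close> tested with the finitely
  supported \<open>W j\<close>; for fixed \<open>j\<close> it tends to \<open>0\<close> as \<open>k\<close> grows.\<close>
lemma gradient_difference:
  assumes "j \<le> k"
  shows "(norm (D k - D j))\<^sup>2 \<le> inner (embed g) (embed limit - W j) + inner (embed g - embed (L k)) (W j)"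
proof -
  have "(norm (D k - D j))\<^sup>2 \<le> c * (norm (W k - W j))\<^sup>2 + (norm (D k - D j))\<^sup>2"
    using c_pos by simp
  also have "\<dots> = inner (embed (L k)) (W k - W j) + (inner (embed (L j)) (W j) - inner (embed (L k)) (W j))"
    by (simp add: power2_norm_eq_inner inner_diff inner_L inner_commute algebra_simps)
  also have "\<dots> \<le> inner (embed g) (embed limit - W j) + (inner (embed g) (W j) - inner (embed (L k)) (W j))"
  proof (intro add_mono diff_right_mono)
    have "inner (embed (L k)) (W k - W j) \<le> inner (embed g) (W k - W j)"
      by (rule inner_L_le) (simp add: coord_W_mono[OF assms])
    also have "\<dots> = inner (W k - W j) (embed g)" by (rule inner_commute)
    also have "\<dots> \<le> inner (embed limit - W j) (embed g)"
      by (rule inner_l2_mono)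
         (simp add: coord_embed w_ell2 limit_ell2 g_ell2 g_nonneg w_le_limit mult_right_mono)
    finally show "inner (embed (L k)) (W k - W j) \<le> inner (embed g) (embed limit - W j)"
      by (simp add: inner_commute)
    show "inner (embed (L j)) (W j) \<le> inner (embed g) (W j)"
      by (rule inner_L_le[OF coord_W_nonneg])
  qed
  finally show ?thesis by (simp add: inner_diff_left)
qed

text \<open>Two gradients are compared through a third one so far out that both residuals are small.\<close>
lemma Cauchy_D: "Cauchy D"
proof (rule CauchyI)
  fix e :: real assume "e > 0"
  then have e: "e\<^sup>2 / 8 > 0" by simp
  have "(\<lambda>j. inner (embed g) (embed limit - W j)) \<longlonglongrightarrow> inner (embed g) (embed limit - embed limit)"
    by (intro tendsto_intros W_tendsto)
  then have "\<forall>\<^sub>F j in sequentially. inner (embed g) (embed limit - W j) < e\<^sup>2 / 8"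
    by (rule order_tendstoD(2)) (use e in simp)
  then obtain N where N: "\<And>j. j \<ge> N \<Longrightarrow> inner (embed g) (embed limit - W j) < e\<^sup>2 / 8"
    by (auto simp: eventually_sequentially)
  have "norm (D i - D j) < e" if "i \<ge> N" "j \<ge> N" for i j
  proof -
    have "\<forall>\<^sub>F k in sequentially. inner (embed g - embed (L k)) (W l) < e\<^sup>2 / 8" for l
      using residual_tendsto e by (rule order_tendstoD(2))
    then have "\<forall>\<^sub>F k in sequentially. inner (embed g - embed (L k)) (W i) < e\<^sup>2 / 8
        \<and> inner (embed g - embed (L k)) (W j) < e\<^sup>2 / 8 \<and> k \<ge> max i j"
      by (intro eventually_conj eventually_ge_at_top)
    then obtain k where k: "inner (embed g - embed (L k)) (W i) < e\<^sup>2 / 8"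
        "inner (embed g - embed (L k)) (W j) < e\<^sup>2 / 8" "i \<le> k" "j \<le> k"
      by (auto simp: eventually_sequentially)
    have "(norm (D k - D l))\<^sup>2 < (e / 2)\<^sup>2" if "l \<ge> N" "l \<le> k" "inner (embed g - embed (L k)) (W l) < e\<^sup>2 / 8" for l
      using gradient_difference[OF that(2)] N[OF that(1)] that(3) by (simp add: power_divide)
    then have "norm (D k - D l) < e / 2" if "l \<ge> N" "l \<le> k" "inner (embed g - embed (L k)) (W l) < e\<^sup>2 / 8" for l
      using that \<open>e > 0\<close> by (meson half_gt_zero less_imp_le power2_less_imp_less)
    then have "norm (D k - D i) < e / 2" "norm (D k - D j) < e / 2" using that k by auto
    moreover have "norm (D i - D j) \<le> norm (D i - D k) + norm (D k - D j)"
      using norm_triangle_ineq[of "D i - D k" "D k - D j"] by simp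
    ultimately show ?thesis by (simp add: norm_minus_commute)
  qed
  then show "\<exists>N. \<forall>i\<ge>N. \<forall>j\<ge>N. norm (D i - D j) < e" by blast
qed

lemma limit_dom: "limit \<in> dom"
  by (rule domI[OF w_C_c limit_ell2 W_tendsto Cauchy_D])

end

context weighted_graph
begin

text \<open>Minimality is what makes the resolvent positive and comparable with supersolutions that are not
  square summable.\<close>
theorem minimal_resolvent:
  assumes "c > 0" "g \<in> ell2 m" "\<And>x. 0 \<le> g x"
  obtains w where "w \<in> dom" "\<And>x. 0 \<le> w x" "\<And>x. c * w x + Lap w x = g x"
    "\<And>v x. (\<And>y. 0 \<le> v y) \<Longrightarrow> (\<And>y. g y \<le> c * v y + Lap v y) \<Longrightarrow> w x \<le> v x"
proof -
  interpret resolvent_iteration b m c g by unfold_locales (use assms in auto)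
  show ?thesis
    using that[of limit] limit_dom limit_nonneg limit_equation limit_minimal by blast
qed

text \<open>The graph of \<open>-\<Delta>\<close>, transported to the unweighted space.\<close>
definition A :: "('a l2 \<times> 'a l2) set" where
  "A = {(embed f, - embed (Lap f)) | f. f \<in> dom \<and> Lap f \<in> ell2 m}"

lemma AI: "f \<in> dom \<Longrightarrow> Lap f \<in> ell2 m \<Longrightarrow> (embed f, - embed (Lap f)) \<in> A"
  by (auto simp: A_def)

lemma AE:
  assumes "(F, G) \<in> A"
  obtains f where "f \<in> dom" "Lap f \<in> ell2 m" "F = embed f" "G = - embed (Lap f)"
  using assms by (auto simp: A_def)

lemma A_lincomb:
  assumes "(F, G) \<in> A" "(F', G') \<in> A" shows "(c *\<^sub>R F + F', c *\<^sub>R G + G') \<in> A"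
proof -
  obtain f where f: "f \<in> dom" "Lap f \<in> ell2 m" "F = embed f" "G = - embed (Lap f)"
    using assms(1) by (rule AE)
  obtain g where g: "g \<in> dom" "Lap g \<in> ell2 m" "F' = embed g" "G' = - embed (Lap g)"
    using assms(2) by (rule AE)
  let ?h = "\<lambda>x. c * f x + g x"
  have Lap: "Lap ?h = (\<lambda>x. c * Lap f x + Lap g x)" by (simp add: fun_eq_iff Lap_add Lap_scale)
  have "(embed ?h, - embed (Lap ?h)) \<in> A"
    using f g by (intro AI dom_lincomb) (simp_all add: Lap ell2_add ell2_scale)
  then show ?thesis
    using f g dom_ell2 by (simp add: Lap embed_add embed_scale ell2_scale)
qed

lemma A_range:
  assumes "c > 0" shows "\<exists>F G. (F, G) \<in> A \<and> c *\<^sub>R F - G = H"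
proof -
  define g where "g = proj H"
  have g: "g \<in> ell2 m" by (simp add: g_def proj_ell2)
  have parts: "(\<lambda>x. max 0 (g x)) \<in> ell2 m" "(\<lambda>x. max 0 (- g x)) \<in> ell2 m"
    using g unfolding ell2_def
    by (auto elim!: summable_on_comparison_test simp: max_def)
  \<comment> \<open>The resolvent is linear, so positive and negative part are treated separately.\<close>
  obtain w1 where w1: "w1 \<in> dom" "\<And>x. c * w1 x + Lap w1 x = max 0 (g x)"
    by (rule minimal_resolvent[OF assms parts(1)]) auto
  obtain w2 where w2: "w2 \<in> dom" "\<And>x. c * w2 x + Lap w2 x = max 0 (- g x)"
    by (rule minimal_resolvent[OF assms parts(2)]) auto
  let ?f = "\<lambda>x. -1 * w2 x + w1 x"
  have f: "?f \<in> dom" by (rule dom_lincomb[OF w2(1) w1(1)])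
  have "c * ?f x + Lap ?f x = (c * w1 x + Lap w1 x) - (c * w2 x + Lap w2 x)" for x
    using Lap_diff[of w1 w2 x] by (simp add: algebra_simps)
  then have "c * ?f x + Lap ?f x = g x" for x by (simp add: w1 w2 max_def)
  then have Lap: "Lap ?f = (\<lambda>x. g x - c * ?f x)" by (auto simp: fun_eq_iff algebra_simps)
  have "Lap ?f \<in> ell2 m" unfolding Lap by (intro ell2_diff ell2_scale g dom_ell2[OF f])
  then have "(embed ?f, - embed (Lap ?f)) \<in> A" by (rule AI[OF f])
  moreover have "c *\<^sub>R embed ?f - - embed (Lap ?f) = H"
    unfolding Lap using embed_diff[OF g ell2_scale[OF dom_ell2[OF f]], of c] embed_scale[OF dom_ell2[OF f], of c]
    by (simp add: g_def)
  ultimately show ?thesis by blast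
qed

lemma C_c_in_A: "\<phi> \<in> C_c \<Longrightarrow> (embed \<phi>, - embed (Lap \<phi>)) \<in> A"
  by (intro AI C_c_dom C_c_ell2 Lap_C_c)

lemma C_c_dense: "closure (embed ` C_c) = UNIV"
proof -
  have "F \<in> closure (embed ` C_c)" for F
    unfolding closure_approachable
  proof (intro allI impI)
    fix e :: real assume "e > 0"
    then have "(e / 2)\<^sup>2 > 0" by simp
    obtain K where K: "finite K" "dist (\<Sum>x\<in>K. (coord F x)\<^sup>2) (\<Sum>\<^sub>\<infinity>x. (coord F x)\<^sup>2) \<le> (e / 2)\<^sup>2"
      using infsum_finite_approximation[OF summable_square[of F] \<open>(e / 2)\<^sup>2 > 0\<close>] by auto
    define \<phi> where "\<phi> x = (if x \<in> K then proj F x else 0)" for x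
    have \<phi>: "\<phi> \<in> C_c" using K(1) by (auto simp: C_c_def \<phi>_def)
    have coord: "coord (embed \<phi>) x = (if x \<in> K then coord F x else 0)" for x
      by (simp add: coord_embed C_c_ell2[OF \<phi>]) (simp add: \<phi>_def proj_def)
    have "inner H (embed \<phi>) = (\<Sum>\<^sub>\<infinity>x\<in>K. coord F x * coord H x)" if "\<And>x. x \<in> K \<Longrightarrow> coord H x = coord F x" for H
      unfolding inner_l2_def by (rule infsum_cong_neutral) (auto simp: coord)
    from this[of F] this[of "embed \<phi>"] have "inner F (embed \<phi>) = (\<Sum>x\<in>K. (coord F x)\<^sup>2)"
        "inner (embed \<phi>) (embed \<phi>) = (\<Sum>x\<in>K. (coord F x)\<^sup>2)"
      using K(1) by (simp_all add: coord power2_eq_square)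
    then have "(norm (embed \<phi> - F))\<^sup>2 = (norm F)\<^sup>2 - (\<Sum>x\<in>K. (coord F x)\<^sup>2)"
      by (simp add: power2_norm_eq_inner inner_diff inner_commute)
    also have "\<dots> \<le> (e / 2)\<^sup>2" using K(2) by (simp add: norm_l2_square dist_real_def)
    finally have "norm (embed \<phi> - F) \<le> e / 2" using \<open>e > 0\<close> by (simp add: power2_le_iff_abs_le)
    then have "dist (embed \<phi>) F < e" using \<open>e > 0\<close> by (simp add: dist_norm)
    then show "\<exists>G\<in>embed ` C_c. dist G F < e" using \<phi> by blast
  qed
  then show ?thesis by auto
qed

sublocale m_dissipative A
proof
  have "(embed (\<lambda>x. 0), - embed (Lap (\<lambda>x. 0))) \<in> A" by (intro C_c_in_A) (simp add: C_c_def)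
  moreover have "embed (\<lambda>x. 0) = 0" "Lap (\<lambda>x. 0) = (\<lambda>x. 0)"
    using embed_scale[OF C_c_ell2, of "\<lambda>x. 0" 0] by (auto simp: C_c_def Lap_def)
  ultimately have zero: "(0, 0) \<in> A" by simp
  show "subspace A"
    unfolding subspace_def
  proof (intro conjI ballI allI)
    show "0 \<in> A" using zero by (simp add: zero_prod_def)
    show "p + q \<in> A" if "p \<in> A" "q \<in> A" for p q
      using A_lincomb[of "fst p" "snd p" "fst q" "snd q" 1] that by (simp add: plus_prod_def)
    show "r *\<^sub>R p \<in> A" if "p \<in> A" for p r
      using A_lincomb[of "fst p" "snd p" 0 0 r] that zero by (simp add: scaleR_prod_def)
  qed
  show "inner F G \<le> 0" if FG: "(F, G) \<in> A" for F G
  proof -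
    obtain f where f: "f \<in> dom" "Lap f \<in> ell2 m" "F = embed f" "G = - embed (Lap f)"
      using FG by (rule AE)
    have "inner (embed (Lap f)) (embed f) \<ge> 0"
      using weak_equation[OF dom_finite_energy f(2) f(1)] f(1) by (metis inner_ge_zero)
    then show ?thesis using f by (simp add: inner_commute)
  qed
  show "\<exists>F G. (F, G) \<in> A \<and> c *\<^sub>R F - G = H" if "c > 0" for c H
    using A_range[OF that] .
  have "embed ` C_c \<subseteq> fst ` A" using C_c_in_A by force
  then have "closure (embed ` C_c) \<subseteq> closure (fst ` A)" by (rule closure_mono)
  then show "closure (fst ` A) = UNIV" using C_c_dense by auto
qed

end

section \<open>Order bounds for the heat semigroup\<close>

context weighted_graph
begin

text \<open>If \<open>\<Delta> v + a v \<ge> 0\<close>, then \<open>k v / (c - a)\<close> is a supersolution of the resolvent equation with any right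
  hand side below \<open>k v\<close>, so minimality applies.\<close>
lemma J_bound:
  assumes v: "\<And>x. 0 \<le> v x" "\<And>x. 0 \<le> Lap v x + a * v x" and "a \<ge> 0" "c > a" "k \<ge> 0"
    and F: "\<And>x. 0 \<le> coord F x" "\<And>x. coord F x \<le> k * v x * sqrt (m x)"
  shows "0 \<le> coord (app (J c) F) x" "coord (app (J c) F) x \<le> k * (c / (c - a)) * v x * sqrt (m x)"
proof -
  have "c > 0" using assms by simp
  have g: "proj F \<in> ell2 m" "\<And>x. 0 \<le> proj F x" "\<And>x. proj F x \<le> k * v x"
    using F by (simp_all add: proj_ell2) (simp_all add: proj_def pos_divide_le_eq)
  obtain w where w: "w \<in> dom" "\<And>x. 0 \<le> w x" "\<And>x. c * w x + Lap w x = proj F x"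
    and minimal: "\<And>v x. (\<And>y. 0 \<le> v y) \<Longrightarrow> (\<And>y. proj F y \<le> c * v y + Lap v y) \<Longrightarrow> w x \<le> v x"
    by (rule minimal_resolvent[OF \<open>c > 0\<close> g(1) g(2)]) blast
  have w_le: "w x \<le> k / (c - a) * v x" for x
  proof (rule minimal)
    show "0 \<le> k / (c - a) * v y" for y using assms by simp
    fix y
    have "proj F y \<le> k / (c - a) * ((c - a) * v y)" using g(3)[of y] \<open>c > a\<close> by simp
    also have "\<dots> \<le> k / (c - a) * (c * v y + Lap v y)"
      using v(2)[of y] assms(4,5) by (intro mult_left_mono) (auto simp: algebra_simps)
    also have "\<dots> = c * (k / (c - a) * v y) + Lap (\<lambda>x. k / (c - a) * v x) y"
      by (subst Lap_scale) (simp add: algebra_simps)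
    finally show "proj F y \<le> c * (k / (c - a) * v y) + Lap (\<lambda>x. k / (c - a) * v x) y" .
  qed
  have Lap_w: "Lap w = (\<lambda>x. proj F x - c * w x)" using w(3) by (auto simp: fun_eq_iff algebra_simps)
  have Lap_ell2: "Lap w \<in> ell2 m" unfolding Lap_w by (intro ell2_diff ell2_scale g dom_ell2 w(1))
  have "c *\<^sub>R embed w - - embed (Lap w) = F"
    unfolding Lap_w by (simp add: embed_diff ell2_scale dom_ell2 w(1) proj_ell2 embed_scale)
  then have "resolvent c F = embed w"
    by (rule resolventI[OF \<open>c > 0\<close> AI[OF w(1) Lap_ell2]])
  then have coord: "coord (app (J c) F) x = c * w x * sqrt (m x)"
    by (simp add: app_J[OF \<open>c > 0\<close>] coord_embed dom_ell2[OF w(1)])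
  show "0 \<le> coord (app (J c) F) x" using coord w(2)[of x] \<open>c > 0\<close> by simp
  have "c * w x * sqrt (m x) \<le> c * (k / (c - a) * v x) * sqrt (m x)"
    using w_le[of x] \<open>c > 0\<close> by (intro mult_right_mono mult_left_mono) auto
  then show "coord (app (J c) F) x \<le> k * (c / (c - a)) * v x * sqrt (m x)"
    unfolding coord by (simp add: mult_ac)
qed

lemma J_power_bound:
  assumes v: "\<And>x. 0 \<le> v x" "\<And>x. 0 \<le> Lap v x + a * v x" and "a \<ge> 0" "c > a"
    and F: "\<And>x. 0 \<le> coord F x" "\<And>x. coord F x \<le> v x * sqrt (m x)"
  shows "0 \<le> coord (app (J c ^ n) F) x \<and> coord (app (J c ^ n) F) x \<le> (c / (c - a)) ^ n * v x * sqrt (m x)"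
proof (induction n arbitrary: x)
  case (Suc n)
  have "(c / (c - a)) ^ n \<ge> 0" using assms(3,4) by simp
  from J_bound[OF v \<open>a \<ge> 0\<close> \<open>c > a\<close> this, of "app (J c ^ n) F" x] Suc.IH
  show ?case by (simp add: mult_ac)
qed (use F in simp)

text \<open>The bounds for the powers are summed against the exponential series, coordinate by coordinate.\<close>
lemma exp_J_bound:
  assumes v: "\<And>x. 0 \<le> v x" "\<And>x. 0 \<le> Lap v x + a * v x" and "a \<ge> 0" "c > a" "s \<ge> 0"
    and F: "\<And>x. 0 \<le> coord F x" "\<And>x. coord F x \<le> v x * sqrt (m x)"
  shows "0 \<le> coord (app (exp (s *\<^sub>R J c)) F) x"
    and "coord (app (exp (s *\<^sub>R J c)) F) x \<le> exp (s * (c / (c - a))) * v x * sqrt (m x)"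
proof -
  let ?q = "c / (c - a)"
  note bound = J_power_bound[OF v \<open>a \<ge> 0\<close> \<open>c > a\<close> F]
  have lin: "bounded_linear (\<lambda>S. coord (app S F) x)"
    by (rule bounded_linear_compose[OF bounded_linear_coord app.bounded_linear_left])
  have "(\<lambda>n. coord (app ((s *\<^sub>R J c) ^ n /\<^sub>R fact n) F) x) sums coord (app (exp (s *\<^sub>R J c)) F) x"
    by (rule bounded_linear.sums[OF lin exp_converges])
  then have sums: "(\<lambda>n. s ^ n / fact n * coord (app (J c ^ n) F) x) sums coord (app (exp (s *\<^sub>R J c)) F) x"
    by (simp add: app.scaleR_left scaleR_power divide_inverse mult_ac)
  show "0 \<le> coord (app (exp (s *\<^sub>R J c)) F) x"
    by (rule sums_le[OF _ sums_zero sums]) (use bound \<open>s \<ge> 0\<close> in simp)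
  have "(\<lambda>n. (s * ?q) ^ n /\<^sub>R fact n * (v x * sqrt (m x))) sums (exp (s * ?q) * (v x * sqrt (m x)))"
    by (intro sums_mult2 exp_converges)
  moreover have "s ^ n / fact n * coord (app (J c ^ n) F) x \<le> (s * ?q) ^ n /\<^sub>R fact n * (v x * sqrt (m x))" for n
  proof -
    have "s ^ n / fact n * coord (app (J c ^ n) F) x \<le> s ^ n / fact n * (?q ^ n * v x * sqrt (m x))"
      using bound[of n x] \<open>s \<ge> 0\<close> by (intro mult_left_mono) auto
    also have "\<dots> = (s * ?q) ^ n /\<^sub>R fact n * (v x * sqrt (m x))"
      unfolding power_mult_distrib by (simp add: divide_inverse mult_ac)
    finally show ?thesis .
  qed
  ultimately have "coord (app (exp (s *\<^sub>R J c)) F) x \<le> exp (s * ?q) * (v x * sqrt (m x))"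
    by (intro sums_le[OF _ sums])
  then show "coord (app (exp (s *\<^sub>R J c)) F) x \<le> exp (s * ?q) * v x * sqrt (m x)"
    by (simp add: mult.assoc)
qed

text \<open>The constants of the approximations combine to \<open>exp (t a c / (c - a))\<close>, which tends to \<open>exp (t a)\<close> as
  \<open>c \<rightarrow> \<infinity>\<close>.\<close>
theorem semigroup_bound:
  assumes v: "\<And>x. 0 \<le> v x" "\<And>x. 0 \<le> Lap v x + a * v x" and "a \<ge> 0" "t \<ge> 0"
    and F: "\<And>x. 0 \<le> coord F x" "\<And>x. coord F x \<le> v x * sqrt (m x)"
  shows "0 \<le> coord (semigroup t F) x" and "coord (semigroup t F) x \<le> exp (t * a) * v x * sqrt (m x)"
proof -
  have lim: "(\<lambda>n. coord (app (E n t) F) x) \<longlonglongrightarrow> coord (semigroup t F) x"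
    by (rule tendsto_coord[OF E_tendsto[OF \<open>t \<ge> 0\<close>]])
  have coord: "coord (app (E n t) F) x = exp (- (t * real (Suc n))) * coord (app (exp ((t * real (Suc n)) *\<^sub>R J (real (Suc n)))) F) x" for n
    unfolding exp_Y by (simp add: app.scaleR_left)
  obtain N where N: "real N > a" using reals_Archimedean2 by blast
  have bounds: "0 \<le> coord (app (E n t) F) x \<and>
      coord (app (E n t) F) x \<le> exp (t * (a * (real (Suc n) / (real (Suc n) - a)))) * v x * sqrt (m x)" if "n \<ge> N" for n
  proof -
    let ?c = "real (Suc n)"
    have c: "?c > a" using N that by simp
    have "t * ?c \<ge> 0" using \<open>t \<ge> 0\<close> by simp
    note J = exp_J_bound[OF v \<open>a \<ge> 0\<close> c this F, of x]
    have "- (t * ?c) + t * ?c * (?c / (?c - a)) = t * (a * (?c / (?c - a)))"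
      using c by (simp add: divide_simps) (simp add: algebra_simps)
    then have e: "exp (t * (a * (?c / (?c - a)))) = exp (- (t * ?c)) * exp (t * ?c * (?c / (?c - a)))"
      by (metis exp_add)
    show ?thesis
      unfolding coord e mult.assoc[of "exp (- (t * ?c))"] using J by (intro conjI mult_nonneg_nonneg mult_left_mono) (auto simp: mult.assoc)
  qed
  show "0 \<le> coord (semigroup t F) x"
    by (rule LIMSEQ_le_const[OF lim]) (use bounds in blast)
  have "(\<lambda>n. real (Suc n) / (real (Suc n) - a)) \<longlonglongrightarrow> 1"
    by real_asymp
  then have "(\<lambda>n. exp (t * (a * (real (Suc n) / (real (Suc n) - a)))) * v x * sqrt (m x))
      \<longlonglongrightarrow> exp (t * (a * 1)) * v x * sqrt (m x)"
    by (intro tendsto_intros)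
  then have "coord (semigroup t F) x \<le> exp (t * (a * 1)) * v x * sqrt (m x)"
    by (rule LIMSEQ_le[OF lim]) (use bounds in blast)
  then show "coord (semigroup t F) x \<le> exp (t * a) * v x * sqrt (m x)" by simp
qed

text \<open>A family of operators on \<open>\<ell>\<^sup>2(X, m)\<close>, seen on the unweighted space.\<close>
definition lift :: "(real \<Rightarrow> ('a \<Rightarrow> real) \<Rightarrow> 'a \<Rightarrow> real) \<Rightarrow> real \<Rightarrow> 'a l2 \<Rightarrow> 'a l2" where
  "lift P t F = embed (P t (proj F))"

lemma generator_lift:
  assumes "\<And>t f. t \<ge> 0 \<Longrightarrow> f \<in> ell2 m \<Longrightarrow> P t f \<in> ell2 m"
  shows "(f, g) \<in> generator m P \<longleftrightarrow> f \<in> ell2 m \<and> g \<in> ell2 m \<and> (embed f, embed g) \<in> gen (lift P)"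
proof -
  have "((\<lambda>t. ell2_norm m (\<lambda>x. (P t f x - f x) / t - g x)) \<longlongrightarrow> 0) (at_right 0)
      \<longleftrightarrow> ((\<lambda>t. (lift P t (embed f) - embed f) /\<^sub>R t) \<longlongrightarrow> embed g) (at_right 0)"
    if f: "f \<in> ell2 m" and g: "g \<in> ell2 m"
  proof -
    have "ell2_norm m (\<lambda>x. (P t f x - f x) / t - g x) = norm ((lift P t (embed f) - embed f) /\<^sub>R t - embed g)"
      if "t > 0" for t
    proof -
      have P: "P t f \<in> ell2 m" using assms that f by simp
      have "(\<lambda>x. (P t f x - f x) / t - g x) = (\<lambda>x. inverse t * (P t f x - f x) - g x)"
        by (simp add: divide_inverse mult.commute)
      then show ?thesis
        by (simp add: ell2_norm_embed ell2_diff ell2_scale P f g embed_diff embed_scale lift_def proj_embed)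
    qed
    then have "\<forall>\<^sub>F t in at_right 0. ell2_norm m (\<lambda>x. (P t f x - f x) / t - g x)
        = norm ((lift P t (embed f) - embed f) /\<^sub>R t - embed g)"
      using eventually_at_right_less[of 0] by (auto elim: eventually_mono)
    then have "((\<lambda>t. ell2_norm m (\<lambda>x. (P t f x - f x) / t - g x)) \<longlongrightarrow> 0) (at_right 0)
        \<longleftrightarrow> ((\<lambda>t. norm ((lift P t (embed f) - embed f) /\<^sub>R t - embed g)) \<longlongrightarrow> 0) (at_right 0)"
      by (rule tendsto_cong)
    then show ?thesis by (simp add: tendsto_norm_zero_iff LIM_zero_iff)
  qed
  then show ?thesis by (auto simp: generator_def gen_def)
qed

lemma contr_semigroup_lift:
  assumes P: "contraction_semigroup m P" shows "contr_semigroup (lift P)"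
proof -
  have mem: "P t f \<in> ell2 m" if "t \<ge> 0" "f \<in> ell2 m" for t f
    using P that by (simp add: contraction_semigroup_def)
  note mem' = mem[OF _ proj_ell2]
  have proj_lift: "proj (lift P t F) = P t (proj F)" if "t \<ge> 0" for t F
    by (simp add: lift_def proj_embed mem'[OF that])
  show ?thesis
    unfolding contr_semigroup_def
  proof (intro conjI allI impI)
    fix t :: real assume t: "0 \<le> t"
    show "linear (lift P t)"
    proof (rule linearI)
      fix F G :: "'a l2" and c :: real
      have "proj (F + G) = (\<lambda>x. proj F x + proj G x)"
        by (simp add: fun_eq_iff proj_def add_divide_distrib)
      then show "lift P t (F + G) = lift P t F + lift P t G"
        using P t by (simp add: lift_def contraction_semigroup_def proj_ell2 embed_add)
      have "proj (c *\<^sub>R F) = (\<lambda>x. c * proj F x)"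
        by (simp add: fun_eq_iff proj_def)
      then show "lift P t (c *\<^sub>R F) = c *\<^sub>R lift P t F"
        using P t by (simp add: lift_def contraction_semigroup_def proj_ell2 embed_scale)
    qed
    fix F :: "'a l2"
    show "norm (lift P t F) \<le> norm F"
    proof -
      have "ell2_norm m (P t (proj F)) \<le> ell2_norm m (proj F)"
        using P t by (simp add: contraction_semigroup_def proj_ell2)
      then show ?thesis by (simp add: ell2_norm_embed mem'[OF t] proj_ell2 lift_def)
    qed
  next
    fix F :: "'a l2"
    show "lift P 0 F = F" using P by (simp add: lift_def contraction_semigroup_def proj_ell2)
    have "((\<lambda>t. ell2_norm m (\<lambda>x. P t (proj F) x - proj F x)) \<longlongrightarrow> 0) (at_right 0)"
      using P by (simp add: contraction_semigroup_def proj_ell2)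
    moreover have "\<forall>\<^sub>F t in at_right 0. ell2_norm m (\<lambda>x. P t (proj F) x - proj F x) = norm (lift P t F - F)"
      using eventually_at_right_less[of 0]
      by eventually_elim (simp add: ell2_norm_embed ell2_diff mem' proj_ell2 embed_diff lift_def)
    ultimately have "((\<lambda>t. norm (lift P t F - F)) \<longlongrightarrow> 0) (at_right 0)"
      by (rule Lim_transform_eventually)
    then show "((\<lambda>t. lift P t F) \<longlongrightarrow> F) (at_right 0)"
      by (simp add: tendsto_norm_zero_iff LIM_zero_iff)
  next
    fix s t :: real and F :: "'a l2" assume "0 \<le> s" "0 \<le> t"
    then show "lift P (s + t) F = lift P s (lift P t F)"
      using P by (simp add: lift_def contraction_semigroup_def proj_ell2 proj_embed mem')
  qed
qed

definition heat :: "real \<Rightarrow> ('a \<Rightarrow> real) \<Rightarrow> 'a \<Rightarrow> real" where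
  "heat t f = proj (semigroup t (embed f))"

lemma heat_ell2: "heat t f \<in> ell2 m"
  by (simp add: heat_def proj_ell2)

lemma lift_heat: "lift heat = semigroup"
  by (simp add: fun_eq_iff lift_def heat_def)

lemma contraction_semigroup_heat: "contraction_semigroup m heat"
proof -
  note S = contr_semigroupD[OF contr_semigroup_semigroup]
  have "((\<lambda>t. norm (semigroup t (embed f) - embed f)) \<longlongrightarrow> 0) (at_right 0)" for f
    using S(5) by (simp add: tendsto_norm_zero_iff LIM_zero_iff)
  then show ?thesis
    unfolding contraction_semigroup_def
    by (auto simp: heat_def proj_ell2 ell2_norm_embed S(2-4) embed_add embed_scale ell2_diff embed_diff proj_embed
        linear_add[OF S(1)] linear_cmul[OF S(1)]) (simp_all add: proj_def fun_eq_iff add_divide_distrib)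
qed

lemma generator_heat: "generator m heat = {(f, \<lambda>x. - g x) | f g. (f, g) \<in> laplacian b m}"
proof (rule set_eqI)
  fix p :: "('a \<Rightarrow> real) \<times> ('a \<Rightarrow> real)"
  obtain f g where p: "p = (f, g)" by (cases p)
  have "(f, g) \<in> generator m heat \<longleftrightarrow> f \<in> ell2 m \<and> g \<in> ell2 m \<and> (embed f, embed g) \<in> A"
    by (simp add: generator_lift heat_ell2 lift_heat gen_semigroup)
  also have "\<dots> \<longleftrightarrow> f \<in> dom \<and> Lap f \<in> ell2 m \<and> g = (\<lambda>x. - Lap f x)"
  proof
    assume fg: "f \<in> ell2 m \<and> g \<in> ell2 m \<and> (embed f, embed g) \<in> A"
    then obtain f' where f': "f' \<in> dom" "Lap f' \<in> ell2 m" "embed f = embed f'" "embed g = - embed (Lap f')"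
      by (auto elim: AE)
    then have "f = f'" using fg embed_inject dom_ell2 by blast
    moreover have "embed g = embed (\<lambda>x. - Lap f' x)" using f' by (simp add: embed_minus)
    then have "g = (\<lambda>x. - Lap f' x)" using fg f' embed_inject ell2_minus by blast
    ultimately show "f \<in> dom \<and> Lap f \<in> ell2 m \<and> g = (\<lambda>x. - Lap f x)" using f' by simp
  next
    assume "f \<in> dom \<and> Lap f \<in> ell2 m \<and> g = (\<lambda>x. - Lap f x)"
    then show "f \<in> ell2 m \<and> g \<in> ell2 m \<and> (embed f, embed g) \<in> A"
      by (simp add: dom_ell2 ell2_minus embed_minus AI)
  qed
  also have "\<dots> \<longleftrightarrow> (f, g) \<in> {(f, \<lambda>x. - g x) | f g. (f, g) \<in> laplacian b m}"
    by (auto simp: laplacian_iff)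
  finally show "p \<in> generator m heat \<longleftrightarrow> p \<in> {(f, \<lambda>x. - g x) | f g. (f, g) \<in> laplacian b m}"
    by (simp add: p)
qed

text \<open>The choice in the definition of the heat semigroup ranges over a nonempty set, as \<open>heat\<close> shows,
  and every member of this set is the same on the domain of the generator.\<close>
theorem heat_semigroup_eq:
  assumes "\<phi> \<in> C_c" "t \<ge> 0" shows "heat_semigroup b m t \<phi> = heat t \<phi>"
proof -
  let ?H = "heat_semigroup b m"
  have H: "contraction_semigroup m ?H \<and> generator m ?H = {(f, \<lambda>x. - g x) | f g. (f, g) \<in> laplacian b m}"
    unfolding heat_semigroup_def
    by (rule someI[of _ heat]) (simp add: contraction_semigroup_heat generator_heat)
  have mem: "?H t f \<in> ell2 m" if "t \<ge> 0" "f \<in> ell2 m" for t f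
    using H that by (simp add: contraction_semigroup_def)
  have "(F, G) \<in> gen (lift ?H) \<longleftrightarrow> (F, G) \<in> gen semigroup" for F G
    using generator_lift[of ?H "proj F" "proj G", OF mem] generator_lift[of heat "proj F" "proj G", OF heat_ell2] H
    by (simp add: proj_ell2 lift_heat generator_heat)
  then have gen: "gen (lift ?H) = gen semigroup" by auto
  have "(embed \<phi>, - embed (Lap \<phi>)) \<in> gen (lift ?H)"
    using C_c_in_A[OF assms(1)] by (simp add: gen gen_semigroup)
  then have "lift ?H t (embed \<phi>) = semigroup t (embed \<phi>)"
    using H by (intro semigroup_unique[OF contr_semigroup_lift contr_semigroup_semigroup gen]) (use assms in auto)
  then have "proj (embed (?H t \<phi>)) = heat t \<phi>"
    by (simp add: lift_def heat_def proj_embed C_c_ell2 assms)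
  then show ?thesis by (simp add: proj_embed mem assms C_c_ell2)
qed

lemma heat_bound:
  assumes v: "\<And>x. 0 \<le> v x" "\<And>x. 0 \<le> Lap v x + a * v x" and "a \<ge> 0" "t \<ge> 0"
    and \<phi>: "\<phi> \<in> C_c" "\<And>x. 0 \<le> \<phi> x" "\<And>x. \<phi> x \<le> v x"
  shows "0 \<le> heat t \<phi> x" "heat t \<phi> x \<le> exp (t * a) * v x"
proof -
  have F: "0 \<le> coord (embed \<phi>) x" "coord (embed \<phi>) x \<le> v x * sqrt (m x)" for x
    using \<phi> by (simp_all add: coord_embed C_c_ell2 mult_right_mono)
  show "0 \<le> heat t \<phi> x" "heat t \<phi> x \<le> exp (t * a) * v x"
    using semigroup_bound[OF v \<open>a \<ge> 0\<close> \<open>t \<ge> 0\<close> F, of x]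
    by (simp_all add: heat_def proj_def pos_divide_le_eq)
qed

end

section \<open>A decaying supersolution on a model graph\<close>

text \<open>Reduction of order. The increasing solution \<open>w\<close> and its flux \<open>F\<close> are defined by a joint
  recursion; the Wronskian identity \<open>D n * (w (Suc n) * u n - w n * u (Suc n)) = 1\<close> then leads to the
  second solution \<open>u\<close>. It solves the equation for positive radii and has a unit source at the
  root.\<close>
lemma decaying_supersolution_sequence:
  fixes D \<mu> :: "nat \<Rightarrow> real"
  assumes D: "\<And>n. D n > 0" and \<mu>: "\<And>n. \<mu> n > 0"
    and divergent: "\<And>C. \<exists>n. C < (\<Sum>k\<le>n. \<mu> k)"
  obtains u where "\<And>n. 0 < u n" "u \<longlonglongrightarrow> 0" "0 \<le> D 0 * (u 0 - u 1) + \<mu> 0 * u 0"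
    "\<And>n. 0 \<le> D (Suc n) * (u (Suc n) - u (Suc (Suc n))) - D n * (u n - u (Suc n)) + \<mu> (Suc n) * u (Suc n)"
proof -
  \<comment> \<open>The pair of \<open>w\<close> and its flux \<open>F\<close>, with \<open>D n * (w (Suc n) - w n) = F n\<close>.\<close>
  define wF where "wF = rec_nat (1, \<mu> 0) (\<lambda>n p. let w' = fst p + snd p / D n in (w', snd p + \<mu> (Suc n) * w'))"
  define w F where "w n = fst (wF n)" and "F n = snd (wF n)" for n
  have w_0: "w 0 = 1" and F_0: "F 0 = \<mu> 0"
    and w_Suc: "w (Suc n) = w n + F n / D n" and F_Suc: "F (Suc n) = F n + \<mu> (Suc n) * w (Suc n)" for n
    by (simp_all add: w_def F_def wF_def Let_def)
  have wF: "1 \<le> w n \<and> (\<Sum>k\<le>n. \<mu> k) \<le> F n" for n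
  proof (induction n)
    case (Suc n)
    have "0 \<le> (\<Sum>k\<le>n. \<mu> k)" using \<mu> by (simp add: sum_nonneg less_imp_le)
    then have "0 \<le> F n / D n" using Suc D[of n] by simp
    then have 1: "1 \<le> w (Suc n)" using Suc by (simp add: w_Suc)
    then have "\<mu> (Suc n) * 1 \<le> \<mu> (Suc n) * w (Suc n)" using \<mu>[of "Suc n"] by (intro mult_left_mono) auto
    then show ?case using Suc 1 by (simp add: F_Suc)
  qed (simp add: w_0 F_0)
  have w_pos: "0 < w n" for n using wF[of n] by simp
  have F_mono: "incseq F"
    by (rule incseq_SucI) (simp add: F_Suc less_imp_le \<mu> w_pos)
  have F_pos: "0 < F n" for n
    using incseqD[OF F_mono, of 0 n] \<mu>[of 0] by (simp add: F_0)
  define c where "c n = 1 / (D n * w n * w (Suc n))" for n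
  have c_pos: "0 < c n" for n using D w_pos by (simp add: c_def)
  \<comment> \<open>The summands telescope up to the decreasing factor \<open>1 / F n\<close>.\<close>
  have c_eq: "c n = (1 / w n - 1 / w (Suc n)) / F n" for n
  proof -
    have "(1 / w n - 1 / w (Suc n)) / F n = (w (Suc n) - w n) / F n / (w n * w (Suc n))"
      using w_pos[of n] w_pos[of "Suc n"] by (simp add: field_simps)
    also have "(w (Suc n) - w n) / F n = 1 / D n" using F_pos[of n] by (simp add: w_Suc)
    finally show ?thesis by (simp add: c_def)
  qed
  have partial: "(\<Sum>k<N. c (k + n)) \<le> 1 / (F n * w n)" for n N
  proof -
    have "(\<Sum>k<N. c (k + n)) \<le> (\<Sum>k<N. (1 / w (k + n) - 1 / w (Suc k + n)) / F n)"
    proof (rule sum_mono)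
      fix k
      have "F n \<le> F (k + n)" by (rule incseqD[OF F_mono]) simp
      moreover have "0 \<le> 1 / w (k + n) - 1 / w (Suc k + n)"
        using w_pos[of "k + n"] F_pos[of "k + n"] D[of "k + n"] by (simp add: w_Suc frac_le)
      ultimately show "c (k + n) \<le> (1 / w (k + n) - 1 / w (Suc k + n)) / F n"
        using F_pos[of n] by (simp add: c_eq frac_le)
    qed
    also have "\<dots> = (\<Sum>k<N. 1 / w (k + n) - 1 / w (Suc k + n)) / F n"
      by (simp add: sum_divide_distrib)
    also have "(\<Sum>k<N. 1 / w (k + n) - 1 / w (Suc k + n)) = 1 / w (0 + n) - 1 / w (N + n)"
      by (rule sum_lessThan_telescope')
    also have "(1 / w (0 + n) - 1 / w (N + n)) / F n \<le> (1 / w n) / F n"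
      using F_pos[of n] w_pos[of "N + n"] by (intro divide_right_mono) (auto simp: less_imp_le)
    finally show ?thesis by (simp add: mult.commute)
  qed
  have summable: "summable (\<lambda>k. c (k + n))" for n
    by (rule summableI_nonneg_bounded[where x = "1 / (F n * w n)"]) (use partial c_pos in \<open>auto simp: less_imp_le\<close>)
  define T where "T n = (\<Sum>k. c (k + n))" for n
  have T_Suc: "T n = c n + T (Suc n)" for n
    using suminf_split_head[OF summable[of n]] by (simp add: T_def)
  have T_pos: "0 < T n" for n
    unfolding T_def by (rule suminf_pos[OF summable c_pos])
  have T_le: "T n \<le> 1 / (F n * w n)" for n
    unfolding T_def by (rule suminf_le_const[OF summable partial])
  define u where "u n = w n * T n" for n
  have u_pos: "0 < u n" for n by (simp add: u_def w_pos T_pos)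
  have u_le: "u n \<le> 1 / F n" for n
    using mult_left_mono[OF T_le[of n], of "w n"] w_pos[of n] by (simp add: u_def)
  have "u \<longlonglongrightarrow> 0"
  proof (rule LIMSEQ_I)
    fix e :: real assume "e > 0"
    obtain N where N: "1 / e < (\<Sum>k\<le>N. \<mu> k)" using divergent by blast
    have "norm (u n - 0) < e" if "n \<ge> N" for n
    proof -
      have "1 / e < F n" using N wF[of N] incseqD[OF F_mono that] by linarith
      then have "1 / F n < e" using \<open>e > 0\<close> F_pos[of n] by (simp add: field_simps)
      then show ?thesis using u_le[of n] u_pos[of n] by simp
    qed
    then show "\<exists>N. \<forall>n\<ge>N. norm (u n - 0) < e" by blast
  qed
  moreover have flux: "D n * (u n - u (Suc n)) = 1 / w n - F n * T n" for n
  proof -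
    have "D n * (u n - u (Suc n)) = D n * ((w n - w (Suc n)) * T n + w (Suc n) * c n)"
      using T_Suc[of n] by (simp add: u_def algebra_simps)
    also have "\<dots> = - (F n * T n) + D n * w (Suc n) * c n"
      using D[of n] by (simp add: w_Suc field_simps)
    also have "D n * w (Suc n) * c n = 1 / w n"
      using D[of n] w_pos[of "Suc n"] by (simp add: c_def)
    finally show ?thesis by simp
  qed
  \<comment> \<open>The same flux, seen from the endpoint \<open>Suc n\<close>, to be compared with the flux of the next edge.\<close>
  have flux': "D n * (u n - u (Suc n)) = 1 / w (Suc n) - F n * T (Suc n)" for n
  proof -
    have "F n * c n = 1 / w n - 1 / w (Suc n)" using F_pos[of n] by (simp add: c_eq)
    then show ?thesis using flux[of n] T_Suc[of n] by (simp add: distrib_left)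
  qed
  have "D 0 * (u 0 - u 1) + \<mu> 0 * u 0 = 1"
    using flux[of 0] by (simp add: w_0 F_0 u_def)
  moreover have "D (Suc n) * (u (Suc n) - u (Suc (Suc n))) - D n * (u n - u (Suc n)) + \<mu> (Suc n) * u (Suc n) = 0" for n
    by (simp only: flux[of "Suc n"] flux'[of n] F_Suc) (simp add: u_def algebra_simps)
  ultimately show ?thesis using that[of u] u_pos by simp
qed

locale rooted_model = weighted_graph b m
  for b :: "'a \<Rightarrow> 'a \<Rightarrow> real" and m +
  fixes root :: 'a
  assumes connected: "connected_graph b"
    and symmetric: "graph_dist b x root = graph_dist b y root \<Longrightarrow>
        outer_curvature b m root x = outer_curvature b m root y \<and>
        inner_curvature b m root x = inner_curvature b m root y"
    and infinite_measure: "vertex_measure m UNIV = \<infinity>"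
begin

abbreviation d :: "'a \<Rightarrow> nat" where "d x \<equiv> graph_dist b x root"
abbreviation S :: "nat \<Rightarrow> 'a set" where "S n \<equiv> {x. d x = n}"

lemma path_length_d: "(adj b ^^ d x) x root"
proof -
  have "\<exists>n. (adj b ^^ n) x root"
    using connected by (auto simp: connected_graph_def dest: rtranclp_imp_relpowp)
  then show ?thesis unfolding graph_dist_def by (rule LeastI_ex)
qed

lemma d_le: "(adj b ^^ n) x root \<Longrightarrow> d x \<le> n"
  unfolding graph_dist_def by (rule Least_le)

lemma S_0: "S 0 = {root}"
  using path_length_d d_le[of 0 root] by (auto, metis relpowp.simps(1))

lemma d_nbr: "y \<in> nbrs x \<Longrightarrow> d x \<le> Suc (d y)"
  using d_le[OF relpowp_Suc_I2[OF _ path_length_d]] by (simp add: nbrs_def adj_def)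

lemma inner_nbr:
  assumes "d x = Suc n" obtains y where "y \<in> nbrs x" "d y = n"
proof -
  obtain y where y: "adj b x y" "(adj b ^^ n) y root"
    using path_length_d[of x] assms by (metis relpowp_Suc_D2)
  then have "y \<in> nbrs x" by (simp add: nbrs_def adj_def)
  then have "d y = n" using d_nbr[of y x] d_le[OF y(2)] assms by simp
  then show ?thesis using that \<open>y \<in> nbrs x\<close> by blast
qed

lemma finite_S: "finite (S n)"
proof (induction n)
  case (Suc n)
  have "S (Suc n) \<subseteq> (\<Union>y\<in>S n. nbrs y)"
    using inner_nbr nbrs_sym by (fast elim: inner_nbr)
  then show ?case by (rule finite_subset) (use Suc in auto)
qed (simp add: S_0)

lemma finite_ball: "finite {x. d x \<le> n}"
proof -
  have "{x. d x \<le> n} = (\<Union>k\<le>n. S k)" by auto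
  then show ?thesis by (simp add: finite_S)
qed

text \<open>A geodesic to the root meets all smaller spheres, so after an empty sphere there would be none, and
  the graph would be a finite ball.\<close>
lemma S_nonempty: "S n \<noteq> {}"
proof
  assume empty: "S n = {}"
  have "S (n + k) = {}" for k
  proof (induction k)
    case (Suc k)
    then show ?case by (auto elim: inner_nbr)
  qed (use empty in simp)
  then have "d x \<le> n" for x by (metis (mono_tags, lifting) empty_iff le_add_diff_inverse mem_Collect_eq nle_le)
  then have "(UNIV :: 'a set) = {x. d x \<le> n}" by auto
  then show False using finite_ball infinite_vertices by metis
qed

text \<open>The weight of the edges between consecutive spheres, and the measure of a sphere.\<close>
definition D :: "nat \<Rightarrow> real" where "D n = (\<Sum>x\<in>S n. \<Sum>y\<in>S (Suc n). b x y)"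
definition \<mu> :: "nat \<Rightarrow> real" where "\<mu> n = (\<Sum>x\<in>S n. m x)"

lemma \<mu>_pos: "\<mu> n > 0"
  unfolding \<mu>_def using S_nonempty finite_S by (intro sum_pos) auto

lemma D_pos: "D n > 0"
proof -
  obtain y where y: "d y = Suc n" using S_nonempty[of "Suc n"] by auto
  obtain x where x: "x \<in> nbrs y" "d x = n" using y by (rule inner_nbr)
  have "b x y \<le> (\<Sum>y\<in>S (Suc n). b x y)"
    using y by (intro member_le_sum finite_S) (auto simp: weight_nonneg)
  also have "\<dots> \<le> D n"
    unfolding D_def using x
    by (intro member_le_sum[where f = "\<lambda>x. \<Sum>y\<in>S (Suc n). b x y"] finite_S) (auto simp: weight_nonneg sum_nonneg)
  finally show ?thesis using x(1) by (simp add: nbrs_def weight_sym[of y])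
qed

text \<open>A quantity whose ratio to the measure is constant on a sphere is determined by its total. This
  turns the curvatures into quotients of \<open>D\<close> and \<open>\<mu>\<close>.\<close>
lemma proportional_sums:
  assumes "\<And>x y. x \<in> S n \<Longrightarrow> y \<in> S n \<Longrightarrow> 1 / m x * \<beta> x = 1 / m y * \<beta> y" and "d x = n"
  shows "\<beta> x = m x * ((\<Sum>z\<in>S n. \<beta> z) / \<mu> n)"
proof -
  have "(\<Sum>z\<in>S n. \<beta> z) = (\<Sum>z\<in>S n. m z * (\<beta> x / m x))"
    using assms(1)[of x] assms(2) by (intro sum.cong) (simp_all add: field_simps)
  also have "\<dots> = \<mu> n * (\<beta> x / m x)" by (simp only: \<mu>_def sum_distrib_right)
  finally show ?thesis using \<mu>_pos[of n] by simp
qed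

lemma outer_sum:
  assumes "d x = n" shows "(\<Sum>y\<in>S (Suc n). b x y) = m x * (D n / \<mu> n)"
proof -
  have "outer_curvature b m root z = 1 / m z * (\<Sum>y\<in>S (Suc n). b z y)" if "d z = n" for z
  proof -
    have "sphere_at b root (int (d z) + 1) = S (Suc n)" using that by (auto simp: sphere_at_def)
    then show ?thesis by (simp add: outer_curvature_def finite_S)
  qed
  then have "1 / m z * (\<Sum>y\<in>S (Suc n). b z y) = 1 / m z' * (\<Sum>y\<in>S (Suc n). b z' y)"
    if "z \<in> S n" "z' \<in> S n" for z z'
    using symmetric[of z z'] that by simp
  then show ?thesis
    unfolding D_def by (rule proportional_sums) (use assms in auto)
qed

lemma inner_sum:
  assumes "d x = Suc n" shows "(\<Sum>y\<in>S n. b x y) = m x * (D n / \<mu> (Suc n))"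
proof -
  have "inner_curvature b m root z = 1 / m z * (\<Sum>y\<in>S n. b z y)" if "d z = Suc n" for z
  proof -
    have "sphere_at b root (int (d z) - 1) = S n" using that by (auto simp: sphere_at_def)
    then show ?thesis by (simp add: inner_curvature_def finite_S)
  qed
  then have "1 / m z * (\<Sum>y\<in>S n. b z y) = 1 / m z' * (\<Sum>y\<in>S n. b z' y)"
    if "z \<in> S (Suc n)" "z' \<in> S (Suc n)" for z z'
    using symmetric[of z z'] that by simp
  then have "(\<Sum>y\<in>S n. b x y) = m x * ((\<Sum>z\<in>S (Suc n). \<Sum>y\<in>S n. b z y) / \<mu> (Suc n))"
    by (rule proportional_sums) (use assms in auto)
  also have "(\<Sum>z\<in>S (Suc n). \<Sum>y\<in>S n. b z y) = D n"
    unfolding D_def by (subst sum.swap) (simp add: weight_sym)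
  finally show ?thesis .
qed

lemma Lap_radial_root: "Lap (\<lambda>x. u (d x)) root = D 0 / \<mu> 0 * (u 0 - u 1)"
proof -
  have d0: "d root = 0" using S_0 by auto
  have sub: "nbrs root \<subseteq> S 0 \<union> S 1"
    using d_nbr nbrs_sym d0 by (fastforce simp: le_Suc_eq)
  have "(\<Sum>y\<in>nbrs root. b root y * (u (d root) - u (d y))) = (\<Sum>y\<in>S 0 \<union> S 1. b root y * (u (d root) - u (d y)))"
    using sub finite_S by (intro sum.mono_neutral_left) (auto simp: not_nbr)
  also have "\<dots> = (\<Sum>y\<in>S 0. b root y * (u (d root) - u (d y))) + (\<Sum>y\<in>S 1. b root y * (u (d root) - u (d y)))"
    by (rule sum.union_disjoint) (auto simp: finite_S)
  also have "\<dots> = (\<Sum>y\<in>S (Suc 0). b root y) * (u 0 - u 1)"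
    by (simp add: d0 sum_distrib_right)
  also have "\<dots> = m root * (D 0 / \<mu> 0 * (u 0 - u 1))"
    by (simp only: outer_sum[OF d0] mult.assoc)
  finally show ?thesis by (simp add: Lap_def)
qed

text \<open>Edges inside a sphere do not contribute for a radial function, and the others lead to an adjacent
  sphere.\<close>
lemma Lap_radial_Suc:
  assumes "d x = Suc n"
  shows "Lap (\<lambda>x. u (d x)) x
    = (D (Suc n) * (u (Suc n) - u (Suc (Suc n))) - D n * (u n - u (Suc n))) / \<mu> (Suc n)"
proof -
  let ?t = "\<lambda>y. b x y * (u (d x) - u (d y))"
  have sub: "nbrs x \<subseteq> S n \<union> (S (Suc n) \<union> S (Suc (Suc n)))"
  proof
    fix y assume "y \<in> nbrs x"
    then have "d x \<le> Suc (d y)" "d y \<le> Suc (d x)" using d_nbr nbrs_sym by blast+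
    then have "d y = n \<or> d y = Suc n \<or> d y = Suc (Suc n)" using assms by linarith
    then show "y \<in> S n \<union> (S (Suc n) \<union> S (Suc (Suc n)))" by simp
  qed
  have "sum ?t (nbrs x) = sum ?t (S n \<union> (S (Suc n) \<union> S (Suc (Suc n))))"
    using sub finite_S by (intro sum.mono_neutral_left) (auto simp: not_nbr)
  also have "\<dots> = sum ?t (S n) + sum ?t (S (Suc n) \<union> S (Suc (Suc n)))"
    by (rule sum.union_disjoint) (auto simp: finite_S)
  also have "sum ?t (S (Suc n) \<union> S (Suc (Suc n))) = sum ?t (S (Suc n)) + sum ?t (S (Suc (Suc n)))"
    by (rule sum.union_disjoint) (auto simp: finite_S)
  also have "sum ?t (S n) = (\<Sum>y\<in>S n. b x y) * (u (Suc n) - u n)"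
    by (simp add: assms sum_distrib_right)
  also have "sum ?t (S (Suc n)) = 0" by (simp add: assms)
  also have "sum ?t (S (Suc (Suc n))) = (\<Sum>y\<in>S (Suc (Suc n)). b x y) * (u (Suc n) - u (Suc (Suc n)))"
    by (simp add: assms sum_distrib_right)
  finally have "sum ?t (nbrs x) = m x *
      ((D (Suc n) * (u (Suc n) - u (Suc (Suc n))) - D n * (u n - u (Suc n))) / \<mu> (Suc n))"
    by (simp only: outer_sum[OF assms] inner_sum[OF assms]) (simp add: algebra_simps diff_divide_distrib add_divide_distrib)
  then show ?thesis by (simp add: Lap_def)
qed

lemma measure_unbounded: "\<exists>n. C < (\<Sum>k\<le>n. \<mu> k)"
proof (rule ccontr)
  assume "\<not> ?thesis"
  then have le: "(\<Sum>k\<le>n. \<mu> k) \<le> C" for n by (auto simp: not_less)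
  have ball: "(\<Sum>k\<le>n. \<mu> k) = (\<Sum>x | d x \<le> n. m x)" for n
  proof -
    have "(\<Sum>k\<le>n. \<mu> k) = (\<Sum>k\<le>n. \<Sum>x\<in>{x \<in> {x. d x \<le> n}. d x = k}. m x)"
      unfolding \<mu>_def by (intro sum.cong) auto
    also have "\<dots> = (\<Sum>x | d x \<le> n. m x)"
      by (rule sum.group) (auto simp: finite_ball)
    finally show ?thesis .
  qed
  have "(\<Sum>x\<in>K. ennreal (m x)) \<le> ennreal C" if K: "finite K" for K :: "'a set"
  proof -
    obtain n where "\<forall>i\<in>d ` K. i \<le> n"
      using finite_imageI[OF K, of d] unfolding finite_nat_set_iff_bounded_le by blast
    then have n: "d x \<le> n" if "x \<in> K" for x using that by blast
    have "(\<Sum>x\<in>K. m x) \<le> (\<Sum>x | d x \<le> n. m x)"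
      using n by (intro sum_mono2 finite_ball) auto
    also have "\<dots> \<le> C" using le[of n] by (simp add: ball)
    finally show ?thesis by (simp add: sum_ennreal ennreal_leI)
  qed
  then have "vertex_measure m UNIV \<le> ennreal C"
    unfolding vertex_measure_def by (intro infsum_le_finite_sums nonneg_summable_on_complete) auto
  then show False using infinite_measure by (simp add: top_unique)
qed

lemma decaying_supersolution:
  obtains v where "\<And>x. 0 < v x" "\<And>x. 0 \<le> Lap v x + 1 * v x" "\<And>e. e > 0 \<Longrightarrow> finite {x. e \<le> v x}"
proof -
  obtain u where u: "\<And>n. 0 < u n" "u \<longlonglongrightarrow> 0" "0 \<le> D 0 * (u 0 - u 1) + \<mu> 0 * u 0"
    "\<And>n. 0 \<le> D (Suc n) * (u (Suc n) - u (Suc (Suc n))) - D n * (u n - u (Suc n)) + \<mu> (Suc n) * u (Suc n)"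
    by (rule decaying_supersolution_sequence[of D \<mu>, OF D_pos \<mu>_pos measure_unbounded]) blast
  let ?v = "\<lambda>x. u (d x)"
  have "0 \<le> Lap ?v x + 1 * ?v x" for x
  proof (cases "d x")
    case 0
    then have x: "x = root" using S_0 by auto
    have "Lap ?v x + 1 * ?v x = (D 0 * (u 0 - u 1) + \<mu> 0 * u 0) / \<mu> 0"
      using 0 \<mu>_pos[of 0] unfolding x by (simp add: Lap_radial_root add_divide_distrib)
    then show ?thesis using u(3) \<mu>_pos[of 0] by simp
  next
    case (Suc n)
    have "Lap ?v x + 1 * ?v x = (D (Suc n) * (u (Suc n) - u (Suc (Suc n))) - D n * (u n - u (Suc n)) + \<mu> (Suc n) * u (Suc n)) / \<mu> (Suc n)"
      using \<mu>_pos[of "Suc n"] by (simp add: Lap_radial_Suc[OF Suc] Suc add_divide_distrib)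
    then show ?thesis using u(4)[of n] \<mu>_pos[of "Suc n"] by simp
  qed
  moreover have "finite {x. e \<le> ?v x}" if "e > 0" for e
  proof -
    have "\<forall>\<^sub>F n in sequentially. u n < e" using u(2) that by (rule order_tendstoD(2))
    then obtain N where N: "\<And>n. n \<ge> N \<Longrightarrow> u n < e" by (auto simp: eventually_sequentially)
    have "{x. e \<le> ?v x} \<subseteq> {x. d x \<le> N}"
      using N by (auto simp flip: not_less)
    then show ?thesis by (rule finite_subset) (rule finite_ball)
  qed
  ultimately show ?thesis using that[of ?v] u(1) by blast
qed

end

section \<open>The Feller property\<close>

lemma C_0_iff: "f \<in> C_0 \<longleftrightarrow> (\<forall>e>0. finite {x. e \<le> \<bar>f x\<bar>})"
proof (intro iffI allI impI)
  fix e :: real assume "f \<in> C_0" "e > 0"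
  then obtain \<phi> where \<phi>: "\<And>n. \<phi> n \<in> C_c" "uniform_limit UNIV \<phi> f sequentially" by (auto simp: C_0_def)
  then obtain n where n: "\<And>x. dist (\<phi> n x) (f x) < e"
    using \<open>e > 0\<close> unfolding uniform_limit_sequentially_iff by blast
  have "{x. e \<le> \<bar>f x\<bar>} \<subseteq> {x. \<phi> n x \<noteq> 0}"
  proof
    fix x assume "x \<in> {x. e \<le> \<bar>f x\<bar>}"
    then show "x \<in> {x. \<phi> n x \<noteq> 0}" using n[of x] by (auto simp: dist_real_def)
  qed
  then show "finite {x. e \<le> \<bar>f x\<bar>}" using \<phi>(1)[of n] by (auto simp: C_c_def intro: finite_subset)
next
  assume f: "\<forall>e>0. finite {x. e \<le> \<bar>f x\<bar>}"
  define \<phi> where "\<phi> n x = (if 1 / real (Suc n) \<le> \<bar>f x\<bar> then f x else 0)" for n x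
  have "\<phi> n \<in> C_c" for n
  proof -
    have "{x. \<phi> n x \<noteq> 0} \<subseteq> {x. 1 / real (Suc n) \<le> \<bar>f x\<bar>}" by (auto simp: \<phi>_def)
    moreover have "finite {x. 1 / real (Suc n) \<le> \<bar>f x\<bar>}" using f by simp
    ultimately show ?thesis by (auto simp: C_c_def intro: finite_subset)
  qed
  moreover have "uniform_limit UNIV \<phi> f sequentially"
    unfolding uniform_limit_sequentially_iff
  proof (intro allI impI)
    fix e :: real assume "e > 0"
    then obtain N where N: "1 / real (Suc N) < e" using nat_approx_posE by blast
    have "dist (\<phi> n x) (f x) < e" if "n \<ge> N" for n x
    proof -
      have "1 / real (Suc n) \<le> 1 / real (Suc N)" using that by (simp add: frac_le)
      then show ?thesis using N \<open>e > 0\<close> by (auto simp: \<phi>_def dist_real_def)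
    qed
    then show "\<exists>N. \<forall>n\<ge>N. \<forall>x\<in>UNIV. dist (\<phi> n x) (f x) < e" by blast
  qed
  ultimately show "f \<in> C_0" by (auto simp: C_0_def)
qed

context weighted_graph
begin

lemma indicator_C_c: "finite K \<Longrightarrow> indicator K \<in> (C_c :: ('a \<Rightarrow> real) set)"
  by (simp add: C_c_def indicator_eq_0_iff)

lemma heat_bounded_eq:
  assumes "t \<ge> 0" shows "heat_bounded b m t f x = (\<Sum>\<^sub>\<infinity>y. heat t (indicator {y}) x * f y)"
  unfolding heat_bounded_def heat_kernel_def
  by (intro infsum_cong) (simp add: heat_semigroup_eq indicator_C_c assms)

lemma heat_scale: "t \<ge> 0 \<Longrightarrow> f \<in> ell2 m \<Longrightarrow> heat t (\<lambda>x. c * f x) = (\<lambda>x. c * heat t f x)"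
  using contraction_semigroup_heat unfolding contraction_semigroup_def by blast

lemma heat_add: "t \<ge> 0 \<Longrightarrow> f \<in> ell2 m \<Longrightarrow> g \<in> ell2 m \<Longrightarrow>
    heat t (\<lambda>x. f x + g x) = (\<lambda>x. heat t f x + heat t g x)"
  using contraction_semigroup_heat unfolding contraction_semigroup_def by blast

lemma heat_sum_indicators:
  assumes "finite K" "t \<ge> 0"
  shows "(\<Sum>y\<in>K. heat t (indicator {y}) x) = heat t (indicator K) x"
  using assms(1)
proof (induction K)
  case empty
  have "(\<lambda>x. 0) \<in> ell2 m" by (simp add: ell2_def)
  from heat_scale[OF assms(2) this, of 0] have "heat t (\<lambda>x. 0) = (\<lambda>x. 0)" by simp
  moreover have "indicator {} = (\<lambda>x :: 'a. 0 :: real)" by auto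
  ultimately show ?case by simp
next
  case (insert z K)
  have "indicator (insert z K) = (\<lambda>x. indicator {z} x + indicator K x :: real)"
    using insert.hyps by (auto simp: fun_eq_iff indicator_def)
  moreover have "heat t (\<lambda>x. indicator {z} x + indicator K x) = (\<lambda>x. heat t (indicator {z}) x + heat t (indicator K) x)"
    using insert.hyps assms(2) by (simp add: heat_add C_c_ell2 indicator_C_c)
  ultimately show ?case using insert by simp
qed

lemma heat_indicator:
  assumes "t \<ge> 0" "finite K"
  shows "0 \<le> heat t (indicator K) x" and "heat t (indicator K) x \<le> 1"
  using heat_bound[of "\<lambda>_. 1" 0 t "indicator K" x] assms
  by (simp_all add: Lap_def indicator_C_c indicator_le_1)

text \<open>Outside a finite set \<open>K\<close> the function \<open>f\<close> is small, and its contribution is small by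
  \<open>P\<^sub>t 1 \<le> 1\<close>. On \<open>K\<close> only finitely many columns of the heat kernel are involved, each bounded by a
  multiple of \<open>v\<close>.\<close>
theorem feller_if_decaying_supersolution:
  assumes v: "\<And>x. 0 < v x" "\<And>x. 0 \<le> Lap v x + a * v x" "a \<ge> 0"
    and decay: "\<And>e. e > 0 \<Longrightarrow> finite {x. e \<le> v x}"
  shows "feller b m"
  unfolding feller_def
proof (intro allI impI ballI)
  fix t :: real and f :: "'a \<Rightarrow> real" assume t: "0 \<le> t" and "f \<in> C_0"
  then have f: "\<And>e. e > 0 \<Longrightarrow> finite {x. e \<le> \<bar>f x\<bar>}" by (simp add: C_0_iff)
  define q where "q x y = heat t (indicator {y}) x" for x y
  have q_nonneg: "0 \<le> q x y" for x y using heat_indicator[OF t] by (simp add: q_def)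
  have q_sum: "(\<Sum>y\<in>K. q x y) \<le> 1" if "finite K" for x K
    using heat_sum_indicators[OF that t] heat_indicator(2)[OF t that] by (simp add: q_def)
  have q_decay: "q x y \<le> exp (t * a) / v y * v x" for x y
  proof -
    have "q x y \<le> exp (t * a) * (1 / v y * v x)"
      unfolding q_def
    proof (rule heat_bound(2)[where v = "\<lambda>x. 1 / v y * v x"])
      show "0 \<le> Lap (\<lambda>x. 1 / v y * v x) z + a * (1 / v y * v z)" for z
      proof -
        have "Lap (\<lambda>x. 1 / v y * v x) z + a * (1 / v y * v z) = 1 / v y * (Lap v z + a * v z)"
          by (subst Lap_scale) (simp add: algebra_simps)
        then show ?thesis using v(2)[of z] v(1)[of y] by simp
      qed
      show "indicator {y} z \<le> 1 / v y * v z" for z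
        using v(1)[of y] v(1)[of z] by (simp add: indicator_def)
    qed (use v t in \<open>auto simp: indicator_C_c less_imp_le\<close>)
    then show ?thesis by simp
  qed
  show "heat_bounded b m t f \<in> C_0"
    unfolding C_0_iff
  proof (intro allI impI)
    fix e :: real assume "e > 0"
    define K where "K = {y. e / 2 \<le> \<bar>f y\<bar>}"
    have K: "finite K" using f[of "e / 2"] \<open>e > 0\<close> by (simp add: K_def)
    define s where "s x = (\<Sum>y\<in>K. q x y * \<bar>f y\<bar>)" for x
    have partial: "(\<Sum>y\<in>K'. norm (q x y * f y)) \<le> s x + e / 2" if "finite K'" for x K'
    proof -
      have "(\<Sum>y\<in>K'. norm (q x y * f y)) = (\<Sum>y\<in>K' \<inter> K. q x y * \<bar>f y\<bar>) + (\<Sum>y\<in>K' - K. q x y * \<bar>f y\<bar>)"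
        using sum.Int_Diff[OF that, of _ K] q_nonneg by (simp add: abs_mult)
      also have "\<dots> \<le> s x + (\<Sum>y\<in>K' - K. q x y * (e / 2))"
        unfolding s_def using K q_nonneg
        by (intro add_mono sum_mono2 sum_mono mult_left_mono) (auto simp: K_def)
      also have "(\<Sum>y\<in>K' - K. q x y * (e / 2)) \<le> 1 * (e / 2)"
        unfolding sum_distrib_right[symmetric] using that \<open>e > 0\<close> by (intro mult_right_mono q_sum) auto
      finally show ?thesis by simp
    qed
    have le: "\<bar>heat_bounded b m t f x\<bar> \<le> s x + e / 2" for x
    proof -
      have summable: "(\<lambda>y. norm (q x y * f y)) summable_on UNIV"
        by (rule nonneg_bdd_above_summable_on) (auto intro!: bdd_aboveI2[where M = "s x + e / 2"] partial simp del: real_norm_def)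
      have "norm (\<Sum>\<^sub>\<infinity>y. q x y * f y) \<le> (\<Sum>\<^sub>\<infinity>y. norm (q x y * f y))"
        using summable by (rule norm_infsum_bound)
      also have "\<dots> \<le> s x + e / 2"
        using summable by (rule infsum_le_finite_sums) (rule partial)
      finally show ?thesis by (simp add: heat_bounded_eq[OF t] q_def)
    qed
    define C where "C = (\<Sum>y\<in>K. exp (t * a) / v y * \<bar>f y\<bar>) + 1"
    have C: "C > 0" unfolding C_def
      by (intro add_nonneg_pos sum_nonneg mult_nonneg_nonneg divide_nonneg_nonneg) (auto simp: v less_imp_le)
    have s_le: "s x \<le> C * v x" for x
    proof -
      have "s x \<le> (\<Sum>y\<in>K. exp (t * a) / v y * v x * \<bar>f y\<bar>)"
        unfolding s_def by (intro sum_mono mult_right_mono q_decay) simp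
      also have "\<dots> = (\<Sum>y\<in>K. exp (t * a) / v y * \<bar>f y\<bar>) * v x"
        unfolding sum_distrib_right by (intro sum.cong refl) (simp add: mult_ac)
      also have "\<dots> \<le> C * v x" using v(1)[of x] by (simp add: C_def)
      finally show ?thesis .
    qed
    have "{x. e \<le> \<bar>heat_bounded b m t f x\<bar>} \<subseteq> {x. e / 2 / C \<le> v x}"
    proof
      fix x assume "x \<in> {x. e \<le> \<bar>heat_bounded b m t f x\<bar>}"
      then have "e / 2 \<le> C * v x" using le[of x] s_le[of x] by simp
      then show "x \<in> {x. e / 2 / C \<le> v x}" using C by (simp add: pos_divide_le_eq mult_ac)
    qed
    moreover have "finite {x. e / 2 / C \<le> v x}" using C \<open>e > 0\<close> by (intro decay) simp
    ultimately show "finite {x. e \<le> \<bar>heat_bounded b m t f x\<bar>}" by (rule finite_subset)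
  qed
qed

end

theorem corollary4p15:
  fixes b :: "'a \<Rightarrow> 'a \<Rightarrow> real" and m :: "'a \<Rightarrow> real"
  assumes "weighted_graph b m"
    and "connected_graph b"
    and "model_graph b m"
    and "vertex_measure m UNIV = \<infinity>"
  shows "feller b m"
proof -
  obtain root where root: "\<forall>x y. graph_dist b x root = graph_dist b y root \<longrightarrow>
        outer_curvature b m root x = outer_curvature b m root y \<and>
        inner_curvature b m root x = inner_curvature b m root y"
    using assms(3) unfolding model_graph_def by blast
  interpret weighted_graph b m by fact
  interpret rooted_model b m root
    by unfold_locales (fact assms(2), use root in blast, fact assms(4))
  obtain v where "\<And>x. 0 < v x" "\<And>x. 0 \<le> Lap v x + 1 * v x" "\<And>e. e > 0 \<Longrightarrow> finite {x. e \<le> v x}"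
    by (rule decaying_supersolution) blast
  then show ?thesis by (intro feller_if_decaying_supersolution[of v 1]) auto
qed

end
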